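(* Let $K\subset\mathbb{R}^d$ be a given cone. Every compact set $\mathcal{A}$ of $K$-Metzler operators possesses an extremal antinorm on $K$. If, in addition, every operator from $\mathcal{A}$ is $K$-irreducible, then there exists a positive invariant antinorm on $K$ for $\mathcal{A}$.
   Context: Every cone is convex, closed, solid, pointed, with apex at the origin. A linear operator $A$ on $\mathbb{R}^d$ is $K$-Metzler if there is $h>0$ with $(I+hA)K\subset K$. A face of $K$ is the intersection of $K$ with a supporting hyperplane through the apex; $\{0\}$ is the trivial face; a face plane is the linear span of a face. A $K$-Metzler operator is $K$-irreducible if none of the nontrivial face planes of $K$ is invariant under it. A trajectory is a solution $x(\cdot)$ of $\dot x(t)=A(t)x(t)$, $t\ge0$, where the control function $A(\cdot)$ is measurable with values in $\mathcal{A}$; a generalized trajectory is the same with values in the convex hull $\mathrm{co}(\mathcal{A})$. The lower Lyapunov exponent $\check\sigma=\check\sigma(\mathcal{A})$ is the infimum of numbers $\alpha$ for which there exists a control function $A(\cdot)$ with values in $\mathcal{A}$ such that every corresponding trajectory satisfies $\|x(t)\|\le Ce^{\alpha t}$. An antinorm on $K$ is a nontrivial (not identically zero) nonnegative concave (positively) homogeneous functional on $K$; it is positive if it is positive at all points of $K\setminus\{0\}$. An antinorm $f$ is extremal for $\mathcal{A}$ if for every trajectory starting in $K$ we have $f(x(t))\ge e^{\check\sigma t}f(x(0))$, $t\ge0$. An extremal antinorm is invariant if for every $x_0\in K$ there is a generalized trajectory $\bar x(\cdot)$ with $\bar x(0)=x_0$ such that $f(\bar x(t))=e^{\check\sigma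 t}f(x_0)$ for all $t\ge0$. *)

theory Defs
  imports "HOL-Analysis.Analysis"
begin

definition solid_cone :: "(real^'n) set \<Rightarrow> bool" where
  "solid_cone K \<longleftrightarrow> 0 \<in> K \<and> cone K \<and> convex K \<and> closed K \<and>
     interior K \<noteq> {} \<and> K \<inter> uminus ` K = {0}"

definition Metzler_on :: "(real^'n) set \<Rightarrow> real^'n^'n \<Rightarrow> bool" where
  "Metzler_on K A \<longleftrightarrow> (\<exists>h>0. \<forall>x\<in>K. x + h *\<^sub>R (A *v x) \<in> K)"

(* Faces in the sense of intersections with supporting hyperplanes (exposed faces). As v is
   nonzero, a solid cone is not a face of itself. *)
definition cone_face :: "(real^'n) set \<Rightarrow> (real^'n) set \<Rightarrow> bool" where
  "cone_face K F \<longleftrightarrow> (\<exists>v. v \<noteq> 0 \<and> (\<forall>x\<in>K. 0 \<le> v \<bullet> x) \<and> F = K \<inter> {x. v \<bullet> x = 0})"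

definition irreducible_on :: "(real^'n) set \<Rightarrow> real^'n^'n \<Rightarrow> bool" where
  "irreducible_on K A \<longleftrightarrow>
     (\<forall>F. cone_face K F \<and> F \<noteq> {0} \<longrightarrow> \<not> (\<forall>x\<in>span F. A *v x \<in> span F))"

definition control_function :: "(real^'n^'n) set \<Rightarrow> (real \<Rightarrow> real^'n^'n) \<Rightarrow> bool" where
  "control_function \<A> A \<longleftrightarrow> A \<in> borel_measurable (lebesgue_on {0..}) \<and> (\<forall>t\<ge>0. A t \<in> \<A>)"

(* Caratheodory solutions of x' = A(t) x on [0, oo): by Lebesgue integrability of the right-hand
   side, these are the locally absolutely continuous functions satisfying the equation almost
   everywhere. *)
definition solves_linear_ode :: "(real \<Rightarrow> real^'n^'n) \<Rightarrow> (real \<Rightarrow> real^'n) \<Rightarrow> bool" where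
  "solves_linear_ode A x \<longleftrightarrow>
     (\<forall>t\<ge>0. (\<lambda>s. A s *v x s) absolutely_integrable_on {0..t} \<and>
            x t = x 0 + integral {0..t} (\<lambda>s. A s *v x s))"

definition trajectory :: "(real^'n^'n) set \<Rightarrow> (real \<Rightarrow> real^'n) \<Rightarrow> bool" where
  "trajectory \<A> x \<longleftrightarrow> (\<exists>A. control_function \<A> A \<and> solves_linear_ode A x)"

definition generalized_trajectory :: "(real^'n^'n) set \<Rightarrow> (real \<Rightarrow> real^'n) \<Rightarrow> bool" where
  "generalized_trajectory \<A> x \<longleftrightarrow> trajectory (convex hull \<A>) x"

(* For nonempty bounded sets of matrices the set below is nonempty and bounded below, so that the
   real-valued infimum is meaningful. *)
definition lower_Lyapunov_exponent :: "(real^'n^'n) set \<Rightarrow> real" where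
  "lower_Lyapunov_exponent \<A> =
     Inf {\<alpha>. \<exists>A. control_function \<A> A \<and>
             (\<forall>x. solves_linear_ode A x \<longrightarrow> (\<exists>C. \<forall>t\<ge>0. norm (x t) \<le> C * exp (\<alpha> * t)))}"

definition antinorm_on :: "(real^'n) set \<Rightarrow> (real^'n \<Rightarrow> real) \<Rightarrow> bool" where
  "antinorm_on K f \<longleftrightarrow> (\<forall>x\<in>K. 0 \<le> f x) \<and> (\<exists>x\<in>K. f x \<noteq> 0) \<and> concave_on K f \<and>
     (\<forall>x\<in>K. \<forall>c\<ge>0. f (c *\<^sub>R x) = c * f x)"

definition positive_on :: "(real^'n) set \<Rightarrow> (real^'n \<Rightarrow> real) \<Rightarrow> bool" where
  "positive_on K f \<longleftrightarrow> (\<forall>x\<in>K - {0}. 0 < f x)"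

definition extremal_antinorm ::
  "(real^'n) set \<Rightarrow> (real^'n^'n) set \<Rightarrow> (real^'n \<Rightarrow> real) \<Rightarrow> bool" where
  "extremal_antinorm K \<A> f \<longleftrightarrow> antinorm_on K f \<and>
     (\<forall>x. trajectory \<A> x \<and> x 0 \<in> K \<longrightarrow>
        (\<forall>t\<ge>0. f (x t) \<ge> exp (lower_Lyapunov_exponent \<A> * t) * f (x 0)))"

definition invariant_antinorm ::
  "(real^'n) set \<Rightarrow> (real^'n^'n) set \<Rightarrow> (real^'n \<Rightarrow> real) \<Rightarrow> bool" where
  "invariant_antinorm K \<A> f \<longleftrightarrow> extremal_antinorm K \<A> f \<and>
     (\<forall>x0\<in>K. \<exists>x. generalized_trajectory \<A> x \<and> x 0 = x0 \<and>
        (\<forall>t\<ge>0. f (x t) = exp (lower_Lyapunov_exponent \<A> * t) * f x0))"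

end

theory Submission
  imports Defs "HOL-Complex_Analysis.Great_Picard"
begin

text \<open>
  Let \<open>\<sigma>\<close> be the lower Lyapunov exponent, \<open>v\<close> a functional that is strictly positive on
  \<open>K - {0}\<close>, and \<open>e\<close> an interior point of \<open>K\<close>. As all flows preserve \<open>K\<close>, the norm of a flow is at most
  a constant times the value of \<open>v\<close> at the image of \<open>e\<close>; repeating a control periodically shows that
  this value at time \<open>t\<close> is at least \<open>const * exp (\<sigma> t)\<close>, for every control. Hence the
  infimum over all controls and all times of \<open>exp (- \<sigma> t) v(x(t))\<close> is an extremal antinorm: it does
  not vanish at \<open>e\<close>.

  In the irreducible case a compactness argument gives \<open>\<kappa> > 0\<close> such that, for all controls, the
  state reached from \<open>x \<in> K\<close> at time 1 dominates \<open>\<kappa> v(x) e\<close>. Therefore the extremal antinorm \<open>f\<close> above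
  is positive, and the infima over all controls of \<open>exp (- \<sigma> t) f(x(t))\<close>, which increase with \<open>t\<close>, stay
  bounded. Their limit is extremal and continuous on \<open>K - {0}\<close>, and limits of
  nearly optimal trajectories, which are generalized trajectories, are constant for it up to the
  factor \<open>exp (\<sigma> t)\<close>.
\<close>

section \<open>Linear differential equations with measurable bounded coefficients\<close>

text \<open>Three obstacles shape the proof. Controls are merely measurable, so trajectories are
  differentiable only almost everywhere; differentiation is replaced by bounds on increments that
  are quadratic in the time step. A sequence of controls need not have a pointwise convergent
  subsequence, so limits of trajectories are governed by limits of convex combinations of controls;
  hence irreducibility has to be passed on to the convex hull before a compactness argument can use
  it. Finally, concavity gives no continuity on the boundary of \<open>K\<close>, where values still
  have to survive a limit; the domination at time 1 repairs this, as a small displacement of a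
  nonzero point is absorbed within one unit of time by a small part of the trajectory itself.

  Of the two stages of the construction, the first supplies a terminal functional \<open>f\<close>
  for which the finite-horizon values increase. Their bound comes from \<sigma> being an infimum: if
  every control were fast over one horizon, then domination of a multiple of \<open>e\<close> would
  let the fast growth repeat over each later period.\<close>

lemma bounded_bilinear_matrix_vector_mult:
  "bounded_bilinear (\<lambda>(A::real^'n^'n) x. A *v x)"
proof -
  have "bilinear (\<lambda>(A::real^'n^'n) x. A *v x)"
    unfolding bilinear_def
    by (auto intro!: linearI simp: matrix_vector_mult_add_rdistrib scaleR_matrix_vector_assoc)
  then show ?thesis by (simp add: bilinear_conv_bounded_bilinear)
qed

lemma gronwall:
  fixes u :: "real \<Rightarrow> real"
  assumes cont: "continuous_on {0..T} u"
    and le: "\<And>t. t \<in> {0..T} \<Longrightarrow> u t \<le> a + L * integral {0..t} u"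
    and t: "t \<in> {0..T}" and L: "0 \<le> L"
  shows "u t \<le> a * exp (L * t)"
proof (cases "t = 0")
  case True
  then show ?thesis using le[OF t] by simp
next
  case False
  with t have t0: "0 < t" by simp
  \<comment> \<open>Integrating factor: the bracket bounds \<open>u\<close> from above, so its
    derivative is at most \<open>L\<close> times itself, and \<open>w\<close> cannot
    increase.\<close>
  define w where "w s = (a + L * integral {0..s} u) * exp (- L * s)" for s
  have d: "((\<lambda>s. integral {0..s} u) has_real_derivative u s) (at s within {0..T})" if "s \<in> {0..T}" for s
    by (rule integral_has_real_derivative[OF cont that])
  have dw: "(w has_real_derivative (L * u s - L * (a + L * integral {0..s} u)) * exp (- L * s)) (at s within {0..T})"
    if "s \<in> {0..T}" for s
    unfolding w_def
    by (auto intro!: derivative_eq_intros d[OF that] simp: algebra_simps)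
  have "continuous_on {0..T} w"
    using dw by (meson DERIV_continuous continuous_on_eq_continuous_within)
  then have cw: "continuous_on {0..t} w" by (rule continuous_on_subset) (use t in auto)
  have "w t \<le> w 0"
  proof (rule DERIV_nonpos_imp_decreasing_open[OF less_imp_le[OF t0] _ cw])
    fix s assume s: "0 < s" "s < t"
    then have "s \<in> {0..T}" "at s within {0..T} = at s" using t by (auto intro!: at_within_Icc_at)
    with dw[of s] le[of s] L show "\<exists>y. DERIV w s :> y \<and> y \<le> 0"
      by (metis (no_types, lifting) diff_le_0_iff_le exp_ge_zero mult_left_mono mult_nonpos_nonneg)
  qed
  then have "(a + L * integral {0..t} u) * exp (- L * t) \<le> a" by (simp add: w_def)
  then have "a + L * integral {0..t} u \<le> a * exp (L * t)"
    by (simp add: exp_minus field_simps)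
  then show ?thesis using le[OF t] by linarith
qed

text \<open>Time reversal of the previous bound. It estimates the initial value by the final one,
  which later yields injectivity of flows and a lower bound for all exponents.\<close>

lemma gronwall_reverse:
  fixes u :: "real \<Rightarrow> real"
  assumes cont: "continuous_on {0..T} u"
    and le: "\<And>t. t \<in> {0..T} \<Longrightarrow> u t \<le> a + L * integral {t..T} u"
    and T: "0 \<le> T" and L: "0 \<le> L"
  shows "u 0 \<le> a * exp (L * T)"
proof -
  have c': "continuous_on {0..T} (\<lambda>s. u (T - s))"
    by (rule continuous_on_compose2[OF cont]) (auto intro!: continuous_intros)
  have "u (T - t) \<le> a + L * integral {0..t} (\<lambda>s. u (T - s))" if "t \<in> {0..T}" for t
  proof -
    have "integral {T-t..T} u = integral {0..t} (\<lambda>s. u (T - s))"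
    proof -
      have "(u has_integral integral {T-t..T} u) (cbox (T-t) T)"
        using that by (auto intro!: integrable_integral integrable_continuous_interval continuous_on_subset[OF cont])
      from has_integral_affinity[OF this, of "-1" T]
      have "((\<lambda>x. u (T - x)) has_integral integral {T-t..T} u) ((\<lambda>x. T - x) ` {T-t..T})"
        by simp
      moreover have "(\<lambda>x. T - x) ` {T-t..T} = {0..t}"
        by (simp add: image_diff_atLeastAtMost)
      ultimately show ?thesis by (metis integral_unique)
    qed
    then show ?thesis using le[of "T - t"] that by simp
  qed
  from gronwall[OF c' this, of T] T L show ?thesis by simp
qed

text \<open>The bound is on the action on vectors, so that \<open>L\<close> enters Gronwall
  estimates directly. No set of admissible values occurs, so perturbed controls that leave \<A> are
  covered.\<close>

definition bounded_control :: "real \<Rightarrow> (real \<Rightarrow> real^'n^'n) \<Rightarrow> bool" where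
  "bounded_control L A \<longleftrightarrow> 0 \<le> L \<and> A \<in> borel_measurable (lebesgue_on {0..}) \<and>
     (\<forall>t\<ge>0. \<forall>x. norm (A t *v x) \<le> L * norm x)"

lemma bounded_control_norm_le:
  "bounded_control L A \<Longrightarrow> 0 \<le> t \<Longrightarrow> norm (A t *v x) \<le> L * norm x"
  by (simp add: bounded_control_def)

lemma bounded_control_nonneg: "bounded_control L A \<Longrightarrow> 0 \<le> L"
  by (simp add: bounded_control_def)

lemma exists_bounded_control:
  fixes \<A> :: "(real^'n^'n) set"
  assumes "bounded \<A>"
  obtains L where "0 < L" "\<And>A. control_function \<A> A \<Longrightarrow> bounded_control L A"
    "\<And>A x. A \<in> \<A> \<Longrightarrow> norm (A *v x) \<le> L * norm x"
proof -
  obtain B where B: "B > 0" "\<And>A. A \<in> \<A> \<Longrightarrow> norm A \<le> B"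
    using assms unfolding bounded_pos by blast
  obtain c where c: "c > 0" "\<And>(A::real^'n^'n) x. norm (A *v x) \<le> norm A * norm x * c"
    using bounded_bilinear.pos_bounded[OF bounded_bilinear_matrix_vector_mult] by blast
  have *: "norm (A *v x) \<le> B * c * norm x" if "A \<in> \<A>" for A x
  proof -
    have "norm (A *v x) \<le> norm A * norm x * c" by (rule c)
    also have "\<dots> \<le> B * norm x * c" using B c that by (intro mult_right_mono) auto
    finally show ?thesis by (simp add: mult_ac)
  qed
  show ?thesis
    by (rule that[of "B * c"]) (use * B c in \<open>auto simp: bounded_control_def control_function_def\<close>)
qed

lemma control_measurable_on:
  fixes A :: "real \<Rightarrow> real^'n^'n" and x :: "real \<Rightarrow> real^'n"
  assumes "A \<in> borel_measurable (lebesgue_on {0..})" "continuous_on {a..b} x" "0 \<le> a"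
  shows "(\<lambda>s. A s *v x s) \<in> borel_measurable (lebesgue_on {a..b})"
proof (rule borel_measurable_continuous_Pair[where H = "(*v)"])
  show "A \<in> borel_measurable (lebesgue_on {a..b})"
    by (rule measurable_restrict_mono[OF assms(1)]) (use assms(3) in auto)
  show "x \<in> borel_measurable (lebesgue_on {a..b})"
    by (rule continuous_imp_measurable_on_sets_lebesgue[OF assms(2)]) auto
  show "continuous_on UNIV (\<lambda>p::(real^'n^'n) \<times> (real^'n). fst p *v snd p)"
    by (intro bounded_bilinear.continuous_on[OF bounded_bilinear_matrix_vector_mult] continuous_intros)
qed

lemma control_integrable:
  fixes A :: "real \<Rightarrow> real^'n^'n"
  assumes A: "bounded_control L A" and c: "continuous_on {a..b} x" and a: "0 \<le> a"
  shows "(\<lambda>s. A s *v x s) absolutely_integrable_on {a..b}"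
proof (rule measurable_bounded_by_integrable_imp_absolutely_integrable)
  show "(\<lambda>s. A s *v x s) \<in> borel_measurable (lebesgue_on {a..b})"
    using A by (intro control_measurable_on c a) (simp add: bounded_control_def)
  show "(\<lambda>s. L * norm (x s)) integrable_on {a..b}"
    by (intro integrable_continuous_interval continuous_intros c)
  show "norm (A s *v x s) \<le> L * norm (x s)" if "s \<in> {a..b}" for s
    using bounded_control_norm_le[OF A] that a by auto
qed auto

lemma control_integrable':
  "bounded_control L A \<Longrightarrow> continuous_on {a..b} x \<Longrightarrow> 0 \<le> a \<Longrightarrow> (\<lambda>s. A s *v x s) integrable_on {a..b}"
  using control_integrable set_lebesgue_integral_eq_integral(1) by blast

lemma solves_eq:
  "solves_linear_ode A x \<Longrightarrow> 0 \<le> t \<Longrightarrow> x t = x 0 + integral {0..t} (\<lambda>s. A s *v x s)"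
  unfolding solves_linear_ode_def by blast

lemma solves_integrable:
  "solves_linear_ode A x \<Longrightarrow> 0 \<le> t \<Longrightarrow> (\<lambda>s. A s *v x s) integrable_on {0..t}"
  unfolding solves_linear_ode_def using set_lebesgue_integral_eq_integral(1) by blast

lemma solves_continuous:
  assumes "solves_linear_ode A x"
  shows "continuous_on {0..T} x"
proof (cases "0 \<le> T")
  case True
  have "continuous_on {0..T} (\<lambda>t. x 0 + integral {0..t} (\<lambda>s. A s *v x s))"
    by (intro continuous_intros indefinite_integral_continuous_1 solves_integrable[OF assms True])
  then show ?thesis
    by (rule continuous_on_eq) (metis atLeastAtMost_iff solves_eq[OF assms])
qed auto

lemma solves_continuous_on: 
  assumes "solves_linear_ode A x" "0 \<le> a" shows "continuous_on {a..b} x"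
  by (rule continuous_on_subset[OF solves_continuous[OF assms(1), of b]]) (use assms in auto)

lemma solvesI:
  assumes "bounded_control L A" "\<And>T. continuous_on {0..T} x"
    and "\<And>t. 0 \<le> t \<Longrightarrow> x t = x 0 + integral {0..t} (\<lambda>s. A s *v x s)"
  shows "solves_linear_ode A x"
  unfolding solves_linear_ode_def using assms control_integrable[OF assms(1) _ order.refl] by blast

lemma solves_increment:
  assumes "bounded_control L A" "solves_linear_ode A x" "0 \<le> s" "s \<le> t"
  shows "x t = x s + integral {s..t} (\<lambda>r. A r *v x r)"
proof -
  have "integral {0..s} (\<lambda>r. A r *v x r) + integral {s..t} (\<lambda>r. A r *v x r) = integral {0..t} (\<lambda>r. A r *v x r)"
    by (rule Henstock_Kurzweil_Integration.integral_combine) (use assms in \<open>auto intro!: control_integrable' solves_continuous_on\<close>)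
  then show ?thesis
    using solves_eq[OF assms(2), of s] solves_eq[OF assms(2), of t] assms by (auto simp: algebra_simps)
qed

lemma integral_control_norm_le:
  assumes "bounded_control L A" "continuous_on {a..b} x" "0 \<le> a"
  shows "norm (integral {a..b} (\<lambda>s. A s *v x s)) \<le> L * integral {a..b} (\<lambda>s. norm (x s))"
proof -
  have "norm (integral {a..b} (\<lambda>s. A s *v x s)) \<le> integral {a..b} (\<lambda>s. L * norm (x s))"
    by (intro integral_norm_bound_integral control_integrable'[OF assms] integrable_continuous_interval continuous_intros assms)
       (use bounded_control_norm_le[OF assms(1)] assms(3) in auto)
  then show ?thesis by simp
qed

text \<open>The defect \<open>a\<close> in the integral equation is kept general:
  \<open>a = norm (x 0)\<close> gives the growth of solutions, \<open>a = 0\<close> agreement of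
  flows, and a small \<open>a\<close> convergence of the flows of perturbed controls.\<close>

lemma perturbed_solution_bound:
  assumes A: "bounded_control L A" and c: "continuous_on {0..T} x"
    and eq: "\<And>t. t \<in> {0..T} \<Longrightarrow> norm (x t - integral {0..t} (\<lambda>s. A s *v x s)) \<le> a"
    and t: "t \<in> {0..T}"
  shows "norm (x t) \<le> a * exp (L * t)"
proof (rule gronwall[where T = T and u = "\<lambda>t. norm (x t)"])
  show "norm (x t) \<le> a + L * integral {0..t} (\<lambda>t. norm (x t))" if "t \<in> {0..T}" for t
  proof -
    have "continuous_on {0..t} x" by (rule continuous_on_subset[OF c]) (use that in auto)
    from integral_control_norm_le[OF A this] eq[OF that] show ?thesis
      using norm_triangle_sub[of "x t" "integral {0..t} (\<lambda>s. A s *v x s)"] by simp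
  qed
qed (use t A c in \<open>auto simp: bounded_control_def intro!: continuous_intros\<close>)

lemma solves_norm_le:
  assumes "bounded_control L A" "solves_linear_ode A x" "0 \<le> t"
  shows "norm (x t) \<le> norm (x 0) * exp (L * t)"
  by (rule perturbed_solution_bound[OF assms(1), where T = t])
    (use assms(3) in \<open>auto intro!: solves_continuous[OF assms(2)] simp: algebra_simps dest!: solves_eq[OF assms(2)]\<close>)

lemma solves_norm_ge:
  assumes A: "bounded_control L A" and x: "solves_linear_ode A x" and T: "0 \<le> T"
  shows "norm (x 0) \<le> norm (x T) * exp (L * T)"
proof (rule gronwall_reverse[where u = "\<lambda>t. norm (x t)", OF _ _ T])
  show "norm (x t) \<le> norm (x T) + L * integral {t..T} (\<lambda>t. norm (x t))" if "t \<in> {0..T}" for t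
  proof -
    have "continuous_on {t..T} x" by (rule solves_continuous_on[OF x]) (use that in auto)
    from integral_control_norm_le[OF A this] solves_increment[OF A x, of t T] that show ?thesis
      using norm_triangle_ineq4[of "x T" "integral {t..T} (\<lambda>s. A s *v x s)"] by simp
  qed
qed (use A x in \<open>auto simp: bounded_control_def intro!: continuous_intros solves_continuous\<close>)

lemma solves_lipschitz:
  assumes A: "bounded_control L A" and x: "solves_linear_ode A x" and st: "0 \<le> s" "s \<le> t" "t \<le> T"
  shows "norm (x t - x s) \<le> L * norm (x 0) * exp (L * T) * (t - s)"
proof -
  have "norm (integral {s..t} (\<lambda>r. A r *v x r)) \<le> (L * (norm (x 0) * exp (L * T))) * Henstock_Kurzweil_Integration.content (cbox s t)"
  proof (rule has_integral_bound)
    show "((\<lambda>r. A r *v x r) has_integral integral {s..t} (\<lambda>r. A r *v x r)) (cbox s t)"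
      using st by (auto intro!: integrable_integral control_integrable'[OF A] solves_continuous_on[OF x])
    fix r assume r: "r \<in> cbox s t"
    then have "norm (x r) \<le> norm (x 0) * exp (L * r)" by (intro solves_norm_le[OF A x]) (use st in auto)
    also have "\<dots> \<le> norm (x 0) * exp (L * T)"
      using r st bounded_control_nonneg[OF A] by (auto intro!: mult_left_mono)
    finally show "norm (A r *v x r) \<le> L * (norm (x 0) * exp (L * T))"
      using r st by (intro order_trans[OF bounded_control_norm_le[OF A]] mult_left_mono bounded_control_nonneg[OF A]) auto
  qed (use bounded_control_nonneg[OF A] in auto)
  then show ?thesis using solves_increment[OF A x, of s t] st by (simp add: mult_ac)
qed

lemma solves_linear_combination:
  assumes A: "bounded_control L A" and x: "solves_linear_ode A x" and y: "solves_linear_ode A y"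
  shows "solves_linear_ode A (\<lambda>t. a *\<^sub>R x t + b *\<^sub>R y t)"
proof (rule solvesI[OF A])
  show "continuous_on {0..T} (\<lambda>t. a *\<^sub>R x t + b *\<^sub>R y t)" for T
    by (intro continuous_intros solves_continuous[OF x] solves_continuous[OF y])
  fix t :: real assume t: "0 \<le> t"
  have i: "(\<lambda>s. A s *v x s) integrable_on {0..t}" "(\<lambda>s. A s *v y s) integrable_on {0..t}"
    using control_integrable'[OF A] solves_continuous[OF x] solves_continuous[OF y] by auto
  have "integral {0..t} (\<lambda>s. A s *v (a *\<^sub>R x s + b *\<^sub>R y s)) = 
     integral {0..t} (\<lambda>s. a *\<^sub>R (A s *v x s) + b *\<^sub>R (A s *v y s))"
    by (simp add: matrix_vector_right_distrib matrix_vector_mult_scaleR)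
  also have "\<dots> = a *\<^sub>R integral {0..t} (\<lambda>s. A s *v x s) + b *\<^sub>R integral {0..t} (\<lambda>s. A s *v y s)"
    using i by (subst integral_add) (auto intro!: integrable_cmul)
  finally show "a *\<^sub>R x t + b *\<^sub>R y t = a *\<^sub>R x 0 + b *\<^sub>R y 0 + integral {0..t} (\<lambda>s. A s *v (a *\<^sub>R x s + b *\<^sub>R y s))"
    by (subst solves_eq[OF x t], subst solves_eq[OF y t]) (simp add: scaleR_right_distrib)
qed

lemma solves_unique:
  assumes A: "bounded_control L A" and x: "solves_linear_ode A x" and y: "solves_linear_ode A y"
    and "x 0 = y 0" "0 \<le> t"
  shows "x t = y t"
  using solves_norm_le[OF A solves_linear_combination[OF A x y, of 1 "-1"], of t] assms(4,5) by simp

text \<open>The terms of the Peano-Baker series, not the successive approximations, which are its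
  partial sums. Single terms have the factorial bound below and stay in a cone that all
  \<open>A t\<close> preserve.\<close>

primrec picard :: "(real \<Rightarrow> real^'n^'n) \<Rightarrow> real^'n \<Rightarrow> nat \<Rightarrow> real \<Rightarrow> real^'n" where
  "picard A x0 0 = (\<lambda>t. x0)"
| "picard A x0 (Suc k) = (\<lambda>t. integral {0..t} (\<lambda>s. A s *v picard A x0 k s))"

lemma picard_continuous:
  assumes "bounded_control L A"
  shows "continuous_on {0..T} (picard A x0 k)"
proof (induction k)
  case (Suc k)
  show ?case unfolding picard.simps
    by (intro indefinite_integral_continuous_1 control_integrable'[OF assms] Suc) auto
qed auto

lemma picard_norm_le:
  assumes A: "bounded_control L A" and "0 \<le> t"
  shows "norm (picard A x0 k t) \<le> norm x0 * ((L * t) ^ k / fact k)"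
  using \<open>0 \<le> t\<close>
proof (induction k arbitrary: t)
  case (Suc k)
  have d: "((\<lambda>s. norm x0 * ((L * s) ^ Suc k / fact (Suc k))) has_vector_derivative
      L * (norm x0 * ((L * s) ^ k / fact k))) (at s within {0..t})" for s
    unfolding has_real_derivative_iff_has_vector_derivative[symmetric]
    by (rule derivative_eq_intros refl | simp)+
  have i: "((\<lambda>s. L * (norm x0 * ((L * s) ^ k / fact k))) has_integral norm x0 * ((L * t) ^ Suc k / fact (Suc k))) {0..t}"
    using fundamental_theorem_of_calculus[OF Suc.prems d] by simp
  have "norm (integral {0..t} (\<lambda>s. A s *v picard A x0 k s)) \<le> integral {0..t} (\<lambda>s. L * (norm x0 * ((L * s) ^ k / fact k)))"
  proof (intro integral_norm_bound_integral control_integrable'[OF A] picard_continuous[OF A])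
    fix s assume "s \<in> {0..t}"
    then show "norm (A s *v picard A x0 k s) \<le> L * (norm x0 * ((L * s) ^ k / fact k))"
      using Suc.IH[of s] bounded_control_norm_le[OF A, of s] bounded_control_nonneg[OF A]
      by (meson atLeastAtMost_iff mult_left_mono order_trans)
  qed (use i in \<open>auto simp: has_integral_integrable\<close>)
  then show ?case using integral_unique[OF i] by simp
qed auto

definition flow :: "(real \<Rightarrow> real^'n^'n) \<Rightarrow> real \<Rightarrow> real^'n \<Rightarrow> real^'n" where
  "flow A t x0 = (\<Sum>k. picard A x0 k t)"

lemma picard_summable:
  assumes A: "bounded_control L A" and t: "0 \<le> t"
  shows "summable (\<lambda>k. norm (picard A x0 k t))"
proof (rule summable_comparison_test)
  show "summable (\<lambda>k. norm x0 * ((L * t) ^ k / fact k))"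
    using summable_exp[of "L * t"] by (intro summable_mult) (simp add: field_simps)
  show "\<exists>N. \<forall>n\<ge>N. norm (norm (picard A x0 n t)) \<le> norm x0 * ((L * t) ^ n / fact n)"
    using picard_norm_le[OF A t] by auto
qed

lemma flow_0 [simp]: "flow A 0 x0 = x0"
proof -
  have "(\<lambda>k. picard A x0 k 0) = (\<lambda>k. if k = 0 then x0 else 0)"
  proof
    show "picard A x0 k 0 = (if k = 0 then x0 else 0)" for k by (cases k) auto
  qed
  then show ?thesis using sums_single[of 0 "\<lambda>_. x0"] by (simp add: flow_def sums_iff)
qed

lemma flow_solves:
  assumes A: "bounded_control L A"
  shows "solves_linear_ode A (\<lambda>t. flow A t x0)"
proof -
  define S where "S n t = (\<Sum>k<n. picard A x0 k t)" for n t
  have S_lim: "(\<lambda>n. S n t) \<longlonglongrightarrow> flow A t x0" if "0 \<le> t" for t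
    using summable_LIMSEQ[OF summable_norm_cancel[OF picard_summable[OF A that]]] by (simp add: S_def flow_def)
  have S_cont: "continuous_on {0..T} (S n)" for n T
    unfolding S_def by (intro continuous_intros picard_continuous[OF A])
  have S_Suc: "S (Suc n) t = x0 + integral {0..t} (\<lambda>s. A s *v S n s)" for n t
  proof -
    have "S (Suc n) t = x0 + (\<Sum>k<n. integral {0..t} (\<lambda>s. A s *v picard A x0 k s))"
      unfolding S_def by (subst sum.lessThan_Suc_shift) simp
    also have "(\<Sum>k<n. integral {0..t} (\<lambda>s. A s *v picard A x0 k s)) = integral {0..t} (\<lambda>s. \<Sum>k<n. A s *v picard A x0 k s)"
      by (rule integral_sum[symmetric]) (auto intro!: control_integrable'[OF A] picard_continuous[OF A])
    finally show ?thesis by (simp add: S_def linear_sum[OF matrix_vector_mul_linear])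
  qed
  have S_le: "norm (S n t) \<le> norm x0 * exp (L * T)" if "t \<in> {0..T}" for n t T
  proof -
    have t: "0 \<le> t" and L: "0 \<le> L" using that A bounded_control_nonneg by auto
    have "norm (S n t) \<le> (\<Sum>k<n. norm x0 * ((L * t) ^ k / fact k))"
      unfolding S_def by (intro order_trans[OF norm_sum] sum_mono picard_norm_le[OF A t])
    also have "\<dots> = norm x0 * (\<Sum>k<n. (L * t) ^ k /\<^sub>R fact k)" by (simp add: sum_distrib_left field_simps)
    also have "\<dots> \<le> norm x0 * exp (L * t)"
      using t L unfolding exp_def
      by (intro mult_left_mono sum_le_suminf summable_exp_generic) auto
    also have "\<dots> \<le> norm x0 * exp (L * T)"
      using that L by (auto intro!: mult_left_mono)
    finally show ?thesis .
  qed
  \<comment> \<open>Continuity of the limit is not known yet, so integrability comes from dominated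
    convergence; continuity then follows from the integral equation.\<close>
  have *: "(\<lambda>s. A s *v flow A s x0) integrable_on {0..t}" 
    "(\<lambda>n. integral {0..t} (\<lambda>s. A s *v S n s)) \<longlonglongrightarrow> integral {0..t} (\<lambda>s. A s *v flow A s x0)" if "0 \<le> t" for t
  proof -
    have 1: "(\<lambda>s. A s *v S n s) integrable_on {0..t}" for n by (intro control_integrable'[OF A] S_cont) auto
    have 2: "norm (A s *v S n s) \<le> L * (norm x0 * exp (L * t))" if "s \<in> {0..t}" for n s
      using bounded_control_norm_le[OF A, of s "S n s"] S_le[OF that, of n] bounded_control_nonneg[OF A] that
      by (meson atLeastAtMost_iff mult_left_mono order_trans)
    have 3: "(\<lambda>n. A s *v S n s) \<longlonglongrightarrow> A s *v flow A s x0" if "s \<in> {0..t}" for s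
      using that by (intro bounded_linear.tendsto[OF matrix_vector_mul_bounded_linear] S_lim) auto
    show "(\<lambda>s. A s *v flow A s x0) integrable_on {0..t}" 
      by (rule dominated_convergence(1)[where h = "\<lambda>_. L * (norm x0 * exp (L * t))", OF 1 _ 2 3]) auto
    show "(\<lambda>n. integral {0..t} (\<lambda>s. A s *v S n s)) \<longlonglongrightarrow> integral {0..t} (\<lambda>s. A s *v flow A s x0)"
      by (rule dominated_convergence(2)[where h = "\<lambda>_. L * (norm x0 * exp (L * t))", OF 1 _ 2 3]) auto
  qed
  have eq: "flow A t x0 = x0 + integral {0..t} (\<lambda>s. A s *v flow A s x0)" if t: "0 \<le> t" for t
  proof (rule LIMSEQ_unique)
    show "(\<lambda>n. S (Suc n) t) \<longlonglongrightarrow> flow A t x0" by (rule LIMSEQ_Suc[OF S_lim[OF t]])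
    show "(\<lambda>n. S (Suc n) t) \<longlonglongrightarrow> x0 + integral {0..t} (\<lambda>s. A s *v flow A s x0)"
      unfolding S_Suc by (intro tendsto_intros * t)
  qed
  show ?thesis
  proof (rule solvesI[OF A])
    show "continuous_on {0..T} (\<lambda>t. flow A t x0)" for T
    proof (cases "0 \<le> T")
      case True
      show ?thesis
        by (rule continuous_on_eq[OF continuous_on_add[OF continuous_on_const indefinite_integral_continuous_1[OF *(1)[OF True]]]])
           (use eq in auto)
    qed auto
    show "flow A t x0 = flow A 0 x0 + integral {0..t} (\<lambda>s. A s *v flow A s x0)" if "0 \<le> t" for t
      using eq[OF that] by simp
  qed
qed

section \<open>Shifted, concatenated and periodic controls\<close>

lemma flow_eq:
  assumes "bounded_control L A" "solves_linear_ode A x" "0 \<le> t"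
  shows "x t = flow A t (x 0)"
  using solves_unique[OF assms(1,2) flow_solves[OF assms(1)] _ assms(3)] by simp

lemma linear_flow:
  assumes A: "bounded_control L A" and t: "0 \<le> t"
  shows "linear (flow A t)"
proof -
  have *: "a *\<^sub>R flow A t x + b *\<^sub>R flow A t y = flow A t (a *\<^sub>R x + b *\<^sub>R y)" for a b x y
    using flow_eq[OF A solves_linear_combination[OF A flow_solves[OF A] flow_solves[OF A]] t, of a x b y] by simp
  show ?thesis
    using *[of 1 _ 1] *[of _ _ 0] by (intro linearI) auto
qed

lemma flow_norm_le:
  "bounded_control L A \<Longrightarrow> 0 \<le> t \<Longrightarrow> norm (flow A t x) \<le> norm x * exp (L * t)"
  using solves_norm_le[OF _ flow_solves] by fastforce

lemma flow_norm_ge: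
  "bounded_control L A \<Longrightarrow> 0 \<le> t \<Longrightarrow> norm x \<le> norm (flow A t x) * exp (L * t)"
  using solves_norm_ge[OF _ flow_solves] by fastforce

lemma inj_flow:
  assumes A: "bounded_control L A" and t: "0 \<le> t"
  shows "inj (flow A t)"
  unfolding linear_injective_0[OF linear_flow[OF A t]]
proof (intro allI impI)
  fix x assume "flow A t x = 0"
  with flow_norm_ge[OF A t, of x] show "x = 0" by simp
qed

text \<open>Agreement on the half-open interval is what concatenated and periodic controls offer: at
  the switching time they already take the next value, and a single time is negligible.\<close>

lemma flow_cong:
  assumes A: "bounded_control L A" and B: "bounded_control L' B"
    and eq: "\<And>t. 0 \<le> t \<Longrightarrow> t < T \<Longrightarrow> A t = B t" and t: "0 \<le> t" "t \<le> T"
  shows "flow A t x = flow B t x"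
proof -
  let ?d = "\<lambda>t. flow A t x - flow B t x"
  have cA: "continuous_on {0..T} (\<lambda>t. flow A t x)" and cB: "continuous_on {0..T} (\<lambda>t. flow B t x)" for T
    using solves_continuous flow_solves A B by blast+
  have "norm (?d t) \<le> 0 * exp (L * t)"
  proof (rule perturbed_solution_bound[OF A, where T = T])
    fix s assume s: "s \<in> {0..T}"
    have "integral {0..s} (\<lambda>r. A r *v ?d r) = integral {0..s} (\<lambda>r. A r *v flow A r x) - integral {0..s} (\<lambda>r. A r *v flow B r x)"
      by (simp add: matrix_vector_mult_diff_distrib integral_diff control_integrable'[OF A] cA cB)
    also have "integral {0..s} (\<lambda>r. A r *v flow B r x) = integral {0..s} (\<lambda>r. B r *v flow B r x)"
      by (rule integral_spike[of "{s}"]) (use s in \<open>auto simp: eq\<close>)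
    finally have "integral {0..s} (\<lambda>r. A r *v ?d r) = ?d s"
      using solves_eq[OF flow_solves[OF A], of s x] solves_eq[OF flow_solves[OF B], of s x] s by simp
    then show "norm (?d s - integral {0..s} (\<lambda>r. A r *v ?d r)) \<le> 0" by simp
  qed (use t in \<open>auto intro!: continuous_intros cA cB\<close>)
  then show ?thesis by simp
qed

definition shift_control :: "real \<Rightarrow> (real \<Rightarrow> real^'n^'n) \<Rightarrow> real \<Rightarrow> real^'n^'n" where
  "shift_control s A t = A (s + t)"

definition concat_control :: "real \<Rightarrow> (real \<Rightarrow> real^'n^'n) \<Rightarrow> (real \<Rightarrow> real^'n^'n) \<Rightarrow> real \<Rightarrow> real^'n^'n" where
  "concat_control s A B t = (if t < s then A t else B (t - s))"

definition periodic_control :: "real \<Rightarrow> (real \<Rightarrow> real^'n^'n) \<Rightarrow> real \<Rightarrow> real^'n^'n" where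
  "periodic_control T A t = A (t - T * of_int \<lfloor>t / T\<rfloor>)"

text \<open>Extension by zero to the whole line lets a translation act on Lebesgue measurable
  functions, which is awkward on a half-line that the translation moves.\<close>

lemma measurable_extended_shift:
  fixes A :: "real \<Rightarrow> real^'n^'n"
  assumes "A \<in> borel_measurable (lebesgue_on {0..})"
  shows "(\<lambda>t. if s + t \<in> {0..} then A (s + t) else 0) \<in> borel_measurable lebesgue"
proof -
  have "{0::real..} \<in> sets lebesgue" by simp
  from borel_measurable_affine[OF borel_measurable_if_I[OF assms this], of 1 s] show ?thesis
    by (simp cong: if_cong)
qed

lemma measurable_shift_control:
  assumes "A \<in> borel_measurable (lebesgue_on {0..})" "0 \<le> s"
  shows "shift_control s A \<in> borel_measurable (lebesgue_on {0..})"
proof -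
  have "(\<lambda>t. if s + t \<in> {0..} then A (s + t) else 0) \<in> borel_measurable (lebesgue_on {0..})"
    by (intro measurable_restrict_space1 measurable_extended_shift assms)
  then show ?thesis
    by (rule measurable_cong[THEN iffD1, rotated]) (use assms in \<open>auto simp: shift_control_def\<close>)
qed

lemma measurable_concat_control:
  assumes "A \<in> borel_measurable (lebesgue_on {0..})" "B \<in> borel_measurable (lebesgue_on {0..})"
  shows "concat_control s A B \<in> borel_measurable (lebesgue_on {0..})"
proof -
  have *: "(\<lambda>t. if s + t \<in> {0..} then C (s + t) else 0) \<in> borel_measurable (lebesgue_on {0..})"
    if "C \<in> borel_measurable (lebesgue_on {0..})" for s and C :: "real \<Rightarrow> real^'n^'n"
    by (intro measurable_restrict_space1 measurable_extended_shift that)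
  have "(\<lambda>t. if t \<in> {..<s} then (if 0 + t \<in> {0..} then A (0 + t) else 0) else (if -s + t \<in> {0..} then B (-s + t) else 0))
     \<in> borel_measurable (lebesgue_on {0..})"
    by (intro measurable_If_set * assms) (auto simp: space_restrict_space sets_restrict_space_iff)
  then show ?thesis
    by (rule measurable_cong[THEN iffD1, rotated]) (auto simp: concat_control_def)
qed

lemma floor_mult_le: 
  assumes "0 < T" shows "0 \<le> t - T * of_int \<lfloor>t / T\<rfloor>" "t - T * of_int \<lfloor>t / T\<rfloor> < T"
proof -
  have "of_int \<lfloor>t / T\<rfloor> * T \<le> t" "t < (of_int \<lfloor>t / T\<rfloor> + 1) * T"
    using assms floor_correct[of "t / T"] by (simp_all add: pos_le_divide_eq[symmetric] pos_divide_less_eq[symmetric])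
  then show "0 \<le> t - T * of_int \<lfloor>t / T\<rfloor>" "t - T * of_int \<lfloor>t / T\<rfloor> < T"
    by (auto simp: algebra_simps)
qed

lemma measurable_periodic_control:
  assumes "A \<in> borel_measurable (lebesgue_on {0..})" "0 < T"
  shows "periodic_control T A \<in> borel_measurable (lebesgue_on {0..})"
proof -
  \<comment> \<open>One translate for each value of the floor function, which afterwards selects
    among these countably many pieces.\<close>
  have 1: "(\<lambda>t. if - (T * of_int i) + t \<in> {0..} then A (- (T * of_int i) + t) else 0) \<in> borel_measurable (lebesgue_on {0..})"
    for i :: int
    by (intro measurable_restrict_space1 measurable_extended_shift assms)
  have 2: "(\<lambda>t. \<lfloor>t / T\<rfloor>) \<in> measurable (lebesgue_on {0..}) (count_space UNIV)"
    by (intro measurable_restrict_space1 measurable_completion) simp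
  show ?thesis
    using measurable_compose_countable[OF 1 2]
    by (rule measurable_cong[THEN iffD1, rotated])
       (use floor_mult_le[OF assms(2)] in \<open>auto simp: periodic_control_def\<close>)
qed

lemma control_function_shift:
  "control_function \<A> A \<Longrightarrow> 0 \<le> s \<Longrightarrow> control_function \<A> (shift_control s A)"
  by (auto simp: control_function_def measurable_shift_control) (simp add: shift_control_def)

lemma control_function_concat:
  "control_function \<A> A \<Longrightarrow> control_function \<A> B \<Longrightarrow> control_function \<A> (concat_control s A B)"
  by (auto simp: control_function_def measurable_concat_control) (auto simp: concat_control_def)

lemma control_function_periodic:
  "control_function \<A> A \<Longrightarrow> 0 < T \<Longrightarrow> control_function \<A> (periodic_control T A)"
  using floor_mult_le[of T]
  by (auto simp: control_function_def measurable_periodic_control) (auto simp: periodic_control_def)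

lemma bounded_control_shift:
  "bounded_control L A \<Longrightarrow> 0 \<le> s \<Longrightarrow> bounded_control L (shift_control s A)"
  by (auto simp: bounded_control_def measurable_shift_control) (simp add: shift_control_def)

lemma flow_shift:
  assumes A: "bounded_control L A" and s: "0 \<le> s" and t: "0 \<le> t"
  shows "flow A (s + t) x = flow (shift_control s A) t (flow A s x)"
proof -
  note sA = bounded_control_shift[OF A s]
  have c: "continuous_on {0..T} (\<lambda>t. flow A (s + t) x)" for T
    by (rule continuous_on_compose2[OF solves_continuous[OF flow_solves[OF A], of "s + T"]])
       (use s in \<open>auto intro!: continuous_intros\<close>)
  have "solves_linear_ode (shift_control s A) (\<lambda>t. flow A (s + t) x)"
  proof (rule solvesI[OF sA c])
    fix t :: real assume t: "0 \<le> t"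
    have "((\<lambda>r. A r *v flow A r x) has_integral integral {s..s+t} (\<lambda>r. A r *v flow A r x)) (cbox s (s + t))"
      unfolding box_real
      by (intro integrable_integral control_integrable'[OF A] solves_continuous_on[OF flow_solves[OF A]] s)
    from has_integral_affinity[OF this, of 1 s]
    have "((\<lambda>r. A (s + r) *v flow A (s + r) x) has_integral integral {s..s+t} (\<lambda>r. A r *v flow A r x)) ((+) (-s) ` {s..s+t})"
      by (simp add: add.commute)
    then have "integral {s..s+t} (\<lambda>r. A r *v flow A r x) = integral {0..t} (\<lambda>r. shift_control s A r *v flow A (s + r) x)"
      by (simp add: shift_control_def integral_unique)
    with solves_increment[OF A flow_solves[OF A] s, of "s + t" x] t
    show "flow A (s + t) x = flow A (s + 0) x + integral {0..t} (\<lambda>r. shift_control s A r *v flow A (s + r) x)"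
      by simp
  qed
  from flow_eq[OF sA this t] show ?thesis by simp
qed

lemma flow_concat:
  assumes A: "bounded_control L A" and B: "bounded_control L B" and AB: "bounded_control L (concat_control s A B)"
    and s: "0 \<le> s"
  shows "0 \<le> t \<Longrightarrow> t \<le> s \<Longrightarrow> flow (concat_control s A B) t x = flow A t x"
    and "0 \<le> t \<Longrightarrow> flow (concat_control s A B) (s + t) x = flow B t (flow A s x)"
proof -
  show *: "0 \<le> t \<Longrightarrow> t \<le> s \<Longrightarrow> flow (concat_control s A B) t x = flow A t x" for t
    by (rule flow_cong[OF AB A]) (auto simp: concat_control_def)
  have "shift_control s (concat_control s A B) t = B t" if "0 \<le> t" for t
    using that by (simp add: shift_control_def concat_control_def)
  then have "flow (shift_control s (concat_control s A B)) t y = flow B t y" if "0 \<le> t" for t y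
    using that by (intro flow_cong[OF bounded_control_shift[OF AB s] B]) auto
  then show "0 \<le> t \<Longrightarrow> flow (concat_control s A B) (s + t) x = flow B t (flow A s x)"
    using flow_shift[OF AB s, of t x] *[of s] s by simp
qed

text \<open>A periodic control equals its own shift by one period, so the semigroup law turns
  \<open>k\<close> periods into the \<open>k\<close>-th iterate of the period map.\<close>

lemma flow_periodic:
  assumes A: "bounded_control L A" and P: "bounded_control L (periodic_control T A)" and T: "0 < T"
  shows "flow (periodic_control T A) (real k * T) x = (flow A T ^^ k) x"
proof (induction k arbitrary: x)
  case (Suc k)
  have "shift_control T (periodic_control T A) = periodic_control T A"
    using T by (auto simp: shift_control_def periodic_control_def add_divide_distrib fun_eq_iff algebra_simps)
  moreover have "flow (periodic_control T A) T x = flow A T x"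
  proof (rule flow_cong[OF P A])
    fix t assume "0 \<le> t" "t < T"
    then have "\<lfloor>t / T\<rfloor> = 0" by (simp add: floor_eq_iff)
    then show "periodic_control T A t = A t" by (simp add: periodic_control_def)
  qed (use T in auto)
  ultimately have "flow (periodic_control T A) (T + real k * T) x = flow (periodic_control T A) (real k * T) (flow A T x)"
    using flow_shift[OF P, of T "real k * T" x] T by simp
  then show ?case using Suc.IH by (simp add: algebra_simps funpow_swap1)
qed simp

lemma continuous_on_flow:
  assumes "bounded_control L A" "0 \<le> a"
  shows "continuous_on {a..b} (\<lambda>t. flow A t x)"
  using solves_continuous_on[OF flow_solves[OF assms(1)] assms(2)] .

section \<open>Flows preserving a cone\<close>

text \<open>Cutting the interval into \<open>n\<close> equal pieces leaves a total increment of at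
  most \<open>C * (b - a)\<^sup>2 / n\<close>. This stands in for monotonicity from the sign of a
  derivative when derivatives exist only almost everywhere.\<close>

lemma le_if_quadratic_increments:
  fixes f :: "real \<Rightarrow> real"
  assumes "a \<le> b" and q: "\<And>s t. a \<le> s \<Longrightarrow> s \<le> t \<Longrightarrow> t \<le> b \<Longrightarrow> f t - f s \<le> C * (t - s)\<^sup>2"
  shows "f b \<le> f a"
proof -
  have "f b - f a \<le> C * (b - a)\<^sup>2 * inverse (real (Suc n))" for n
  proof -
    define d where "d = (b - a) / real (Suc n)"
    have d: "0 \<le> d" "real (Suc n) * d = b - a" using assms(1) by (auto simp: d_def)
    have "(\<Sum>k<Suc n. f (a + real (Suc k) * d) - f (a + real k * d)) \<le> (\<Sum>k<Suc n. C * d\<^sup>2)"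
    proof (rule sum_mono)
      fix k assume "k \<in> {..<Suc n}"
      then have "real (Suc k) * d \<le> real (Suc n) * d" using d(1) by (intro mult_right_mono) auto
      then have "a + real (Suc k) * d \<le> b" using d(2) by simp
      with q[of "a + real k * d" "a + real (Suc k) * d"] d(1)
      show "f (a + real (Suc k) * d) - f (a + real k * d) \<le> C * d\<^sup>2" by (simp add: algebra_simps)
    qed
    also have "(\<Sum>k<Suc n. f (a + real (Suc k) * d) - f (a + real k * d)) = f (a + real (Suc n) * d) - f a"
      using sum_lessThan_telescope[of "\<lambda>k. f (a + real k * d)" "Suc n"] by simp
    also have "a + real (Suc n) * d = b" using d(2) by simp
    finally have "f b - f a \<le> (real (Suc n) * d) * (C * d)" by (simp add: power2_eq_square mult_ac)
    also have "\<dots> = (b - a) * (C * d)" unfolding d(2) ..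
    also have "\<dots> = C * (b - a)\<^sup>2 * inverse (real (Suc n))" by (simp add: d_def power2_eq_square divide_inverse)
    finally show ?thesis .
  qed
  moreover have "(\<lambda>n. C * (b - a)\<^sup>2 * inverse (real (Suc n))) \<longlonglongrightarrow> C * (b - a)\<^sup>2 * 0"
    by (intro tendsto_intros LIMSEQ_inverse_real_of_nat)
  ultimately have "f b - f a \<le> C * (b - a)\<^sup>2 * 0"
    by (intro LIMSEQ_le_const[where a = "f b - f a"]) auto
  then show ?thesis by simp
qed

lemma eq_if_quadratic_increments:
  fixes f :: "real \<Rightarrow> 'a::real_normed_vector"
  assumes "a \<le> b" and q: "\<And>s t. a \<le> s \<Longrightarrow> s \<le> t \<Longrightarrow> t \<le> b \<Longrightarrow> norm (f t - f s) \<le> C * (t - s)\<^sup>2"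
  shows "f b = f a"
proof -
  have "norm (f b - f a) \<le> norm (f a - f a)"
  proof (rule le_if_quadratic_increments[OF assms(1)])
    fix s t assume "a \<le> s" "s \<le> t" "t \<le> b"
    from q[OF this] norm_triangle_ineq2[of "f t - f a" "f s - f a"]
    show "norm (f t - f a) - norm (f s - f a) \<le> C * (t - s)\<^sup>2" by simp
  qed
  then show ?thesis by simp
qed

lemma integral_norm_le_const:
  fixes f :: "real \<Rightarrow> 'a::euclidean_space"
  assumes "s \<le> t" "f integrable_on {s..t}" "\<And>r. s \<le> r \<Longrightarrow> r \<le> t \<Longrightarrow> norm (f r) \<le> C"
  shows "norm (integral {s..t} f) \<le> C * (t - s)"
proof -
  have "norm (integral {s..t} f) \<le> integral {s..t} (\<lambda>_. C)"
    using assms by (intro integral_norm_bound_integral) auto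
  then show ?thesis using assms(1) by (simp add: mult.commute)
qed

text \<open>Adding a multiple of the identity to the control rescales trajectories by a positive
  factor, which is harmless for cones. In place of a product rule, the defect of the rescaled
  function in its integral equation is shown to have quadratic increments, hence to be
  constant.\<close>

lemma solves_exp_shift:
  fixes A :: "real \<Rightarrow> real^'n^'n"
  assumes A: "bounded_control L A" and B: "bounded_control L' B"
    and AB: "\<And>t x. B t *v x = A t *v x + M *\<^sub>R x"
    and x: "solves_linear_ode A x"
  shows "solves_linear_ode B (\<lambda>t. exp (M * t) *\<^sub>R x t)"
proof (rule solvesI[OF B])
  let ?y = "\<lambda>t. exp (M * t) *\<^sub>R x t"
  show c: "continuous_on {0..T} ?y" for T by (intro continuous_intros solves_continuous[OF x])
  fix T :: real assume T: "0 \<le> T"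
  have L: "0 \<le> L" by (rule bounded_control_nonneg[OF A])
  define X where "X = norm (x 0) * exp (L * T)"
  define N where "N = exp (\<bar>M\<bar> * T)"
  have X: "norm (x t) \<le> X" if "0 \<le> t" "t \<le> T" for t
    unfolding X_def by (rule order_trans[OF solves_norm_le[OF A x that(1)]]) (use that L in \<open>auto intro!: mult_left_mono\<close>)
  have XL: "norm (x t - x s) \<le> L * X * (t - s)" if "0 \<le> s" "s \<le> t" "t \<le> T" for s t
    using solves_lipschitz[OF A x that] by (simp add: X_def mult_ac)
  have N: "exp (M * t) \<le> N" if "0 \<le> t" "t \<le> T" for t
  proof -
    have "M * t \<le> \<bar>M\<bar> * t" using that by (intro mult_right_mono) auto
    also have "\<dots> \<le> \<bar>M\<bar> * T" using that by (intro mult_left_mono) auto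
    finally show ?thesis by (simp add: N_def)
  qed
  have NL: "\<bar>exp (M * t) - exp (M * s)\<bar> \<le> \<bar>M\<bar> * N * (t - s)" if "0 \<le> s" "s \<le> t" "t \<le> T" for s t
  proof (cases "s = t")
    case False
    then have "s < t" using that by simp
    moreover have "((\<lambda>t. exp (M * t)) has_real_derivative M * exp (M * z)) (at z)" for z
      by (auto intro!: derivative_eq_intros)
    ultimately obtain z where z: "s < z" "z < t" "exp (M * t) - exp (M * s) = (t - s) * (M * exp (M * z))"
      using MVT2[of s t "\<lambda>t. exp (M * t)" "\<lambda>z. M * exp (M * z)"] by blast
    have "exp (M * z) \<le> N" using N[of z] z that by auto
    then have "\<bar>M\<bar> * exp (M * z) * (t - s) \<le> \<bar>M\<bar> * N * (t - s)"
      using that by (intro mult_right_mono mult_left_mono) auto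
    then show ?thesis using z that by (simp add: abs_mult mult_ac)
  qed auto
  let ?f = "\<lambda>t. ?y t - integral {0..t} (\<lambda>s. B s *v ?y s)"
  have "?f T = ?f 0"
  proof (rule eq_if_quadratic_increments[OF T])
    fix s t assume st: "0 \<le> s" "s \<le> t" "t \<le> T"
    have cx: "continuous_on {s..t} x" by (rule solves_continuous_on[OF x st(1)])
    have iA: "(\<lambda>r. A r *v x r) integrable_on {s..t}" by (rule control_integrable'[OF A cx st(1)])
    have iA': "(\<lambda>r. exp (M * t) *\<^sub>R (A r *v x r)) integrable_on {s..t}" by (rule integrable_cmul[OF iA])
    have iC: "(\<lambda>r. (M * exp (M * r)) *\<^sub>R x s) integrable_on {s..t}"
      by (intro integrable_continuous_interval continuous_intros)
    have cy: "continuous_on {s..t} ?y" by (intro continuous_intros cx)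
    have iB: "(\<lambda>r. B r *v ?y r) integrable_on {s..t}" by (rule control_integrable'[OF B cy st(1)])
    have "integral {0..s} (\<lambda>r. B r *v ?y r) + integral {s..t} (\<lambda>r. B r *v ?y r) = integral {0..t} (\<lambda>r. B r *v ?y r)"
      by (rule Henstock_Kurzweil_Integration.integral_combine) (use st in \<open>auto intro!: control_integrable'[OF B c]\<close>)
    then have "?f t - ?f s = exp (M * t) *\<^sub>R (x t - x s) + (exp (M * t) - exp (M * s)) *\<^sub>R x s - integral {s..t} (\<lambda>r. B r *v ?y r)"
      by (auto simp: algebra_simps)
    also have "x t - x s = integral {s..t} (\<lambda>r. A r *v x r)"
      using solves_increment[OF A x st(1,2)] by simp
    also have "exp (M * t) *\<^sub>R integral {s..t} (\<lambda>r. A r *v x r) = integral {s..t} (\<lambda>r. exp (M * t) *\<^sub>R (A r *v x r))"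
      by simp
    also have "(exp (M * t) - exp (M * s)) *\<^sub>R x s = integral {s..t} (\<lambda>r. (M * exp (M * r)) *\<^sub>R x s)"
    proof -
      have "((\<lambda>r. (M * exp (M * r))) has_integral exp (M * t) - exp (M * s)) {s..t}"
        by (rule fundamental_theorem_of_calculus[OF st(2)])
           (auto intro!: derivative_eq_intros simp: has_real_derivative_iff_has_vector_derivative[symmetric])
      from has_integral_scaleR_left[OF this, of "x s"] show ?thesis by (simp add: integral_unique)
    qed
    also have "integral {s..t} (\<lambda>r. exp (M * t) *\<^sub>R (A r *v x r)) + integral {s..t} (\<lambda>r. (M * exp (M * r)) *\<^sub>R x s)
       - integral {s..t} (\<lambda>r. B r *v ?y r) =
       integral {s..t} (\<lambda>r. exp (M * t) *\<^sub>R (A r *v x r) + (M * exp (M * r)) *\<^sub>R x s - B r *v ?y r)"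
      using integral_diff[OF integrable_add[OF iA' iC] iB] integral_add[OF iA' iC] by simp
    finally have eq: "?f t - ?f s = \<dots>" .
    have "norm (?f t - ?f s) \<le> (2 * \<bar>M\<bar> * N * L * X) * (t - s) * (t - s)"
      unfolding eq
    proof (rule integral_norm_le_const[OF st(2)])
      show "(\<lambda>r. exp (M * t) *\<^sub>R (A r *v x r) + (M * exp (M * r)) *\<^sub>R x s - B r *v ?y r) integrable_on {s..t}"
        by (intro integrable_diff integrable_add integrable_cmul iA iB integrable_continuous_interval continuous_intros)
      fix r assume r: "s \<le> r" "r \<le> t"
      \<comment> \<open>By \<open>AB\<close> the terms taken at time \<open>r\<close> cancel. What
        remains comes from freezing the exponential at \<open>t\<close> and the trajectory at
        \<open>s\<close>; both errors are of order \<open>t - s\<close>.\<close>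
      have "exp (M * t) *\<^sub>R (A r *v x r) + (M * exp (M * r)) *\<^sub>R x s - B r *v ?y r =
        (exp (M * t) - exp (M * r)) *\<^sub>R (A r *v x r) - (M * exp (M * r)) *\<^sub>R (x r - x s)"
        by (simp add: AB matrix_vector_mult_scaleR algebra_simps)
      also have "norm \<dots> \<le> \<bar>exp (M * t) - exp (M * r)\<bar> * norm (A r *v x r) + \<bar>M * exp (M * r)\<bar> * norm (x r - x s)"
        by (rule order_trans[OF norm_triangle_ineq4]) simp
      also have "\<dots> \<le> (\<bar>M\<bar> * N * (t - s)) * (L * X) + (\<bar>M\<bar> * N) * (L * X * (t - s))"
      proof (intro add_mono mult_mono)
        show "\<bar>exp (M * t) - exp (M * r)\<bar> \<le> \<bar>M\<bar> * N * (t - s)"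
          by (rule order_trans[OF NL]) (use r st N_def in \<open>auto intro!: mult_left_mono\<close>)
        show "norm (A r *v x r) \<le> L * X"
          using bounded_control_norm_le[OF A, of r "x r"] mult_left_mono[OF X[of r] L] r st by auto
        show "\<bar>M * exp (M * r)\<bar> \<le> \<bar>M\<bar> * N"
          using N[of r] r st by (auto simp: abs_mult intro!: mult_left_mono)
        show "norm (x r - x s) \<le> L * X * (t - s)"
          by (rule order_trans[OF XL]) (use r st L X_def in \<open>auto intro!: mult_left_mono\<close>)
      qed (use L st N_def X_def in auto)
      finally show "norm (exp (M * t) *\<^sub>R (A r *v x r) + (M * exp (M * r)) *\<^sub>R x s - B r *v ?y r)
         \<le> (2 * \<bar>M\<bar> * N * L * X) * (t - s)" by (simp add: algebra_simps)
    qed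
    then show "norm (?f t - ?f s) \<le> (2 * \<bar>M\<bar> * N * L * X) * (t - s)\<^sup>2" by (simp add: power2_eq_square mult.assoc)
  qed
  then show "?y T = ?y 0 + integral {0..T} (\<lambda>s. B s *v ?y s)" by (simp add: algebra_simps)
qed

section \<open>Cones preserved by the control pointwise\<close>

lemma mem_cone_iff_dual:
  fixes K :: "(real^'n) set"
  assumes K: "convex K" "closed K" "cone K" "0 \<in> K"
    and y: "\<And>a. (\<forall>x\<in>K. 0 \<le> a \<bullet> x) \<Longrightarrow> 0 \<le> a \<bullet> y"
  shows "y \<in> K"
proof (rule ccontr)
  assume "y \<notin> K"
  from separating_hyperplane_closed_point[OF K(1,2) this]
  obtain a b where ab: "a \<bullet> y < b" "\<And>x. x \<in> K \<Longrightarrow> b < a \<bullet> x" by blast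
  have b: "b < 0" using ab(2)[OF K(4)] by simp
  have "0 \<le> a \<bullet> x" if x: "x \<in> K" for x
  proof (rule ccontr)
    assume neg: "\<not> 0 \<le> a \<bullet> x"
    \<comment> \<open>This multiple lies exactly on the level \<open>b\<close>, contradicting the
      strict separation; the factor is positive because both numbers are negative.\<close>
    have "(b / (a \<bullet> x)) *\<^sub>R x \<in> K" using neg b K(3) x by (auto simp: cone_def divide_nonpos_nonpos)
    from ab(2)[OF this] neg show False by simp
  qed
  with y[of a] ab(1) b show False by auto
qed

lemma integral_mem_cone:
  fixes K :: "(real^'n) set" and f :: "real \<Rightarrow> real^'n"
  assumes K: "convex K" "closed K" "cone K" "0 \<in> K"
    and f: "f integrable_on {a..b}" "\<And>s. s \<in> {a..b} \<Longrightarrow> f s \<in> K"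
  shows "integral {a..b} f \<in> K"
proof (rule mem_cone_iff_dual[OF K])
  fix u assume u: "\<forall>x\<in>K. 0 \<le> u \<bullet> x"
  have "0 \<le> integral {a..b} (\<lambda>s. u \<bullet> f s)"
    using f u integrable_linear[OF f(1) bounded_linear_inner_right, of u] by (intro integral_nonneg) (auto simp: o_def)
  also have "\<dots> = u \<bullet> integral {a..b} f"
    using integral_linear[OF f(1) bounded_linear_inner_right, of u] by (simp add: o_def)
  finally show "0 \<le> u \<bullet> integral {a..b} f" .
qed

text \<open>Every term of the Peano-Baker series is an integral of vectors of \<open>K\<close>, so
  partial sums stay in \<open>K\<close> and so does their limit.\<close>

lemma flow_mem_cone_if_preserving:
  assumes K: "convex K" "closed K" "cone K" "0 \<in> K"
    and A: "bounded_control L A" and pres: "\<And>t x. 0 \<le> t \<Longrightarrow> x \<in> K \<Longrightarrow> A t *v x \<in> K"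
    and t: "0 \<le> t" and x: "x \<in> K"
  shows "flow A t x \<in> K"
proof -
  have p: "picard A x k t \<in> K" if "0 \<le> t" for k t
    using that
  proof (induction k arbitrary: t)
    case (Suc k)
    show ?case unfolding picard.simps
      by (intro integral_mem_cone[OF K] control_integrable'[OF A] picard_continuous[OF A] pres Suc.IH) auto
  qed (use x in auto)
  have "(\<Sum>k<n. picard A x k t) \<in> K" for n
  proof (induction n)
    case (Suc n)
    then show ?case using p[OF t, of n] convex_cone[of K] K by auto
  qed (use K in auto)
  moreover have "(\<lambda>n. \<Sum>k<n. picard A x k t) \<longlonglongrightarrow> flow A t x"
    unfolding flow_def by (rule summable_LIMSEQ[OF summable_norm_cancel[OF picard_summable[OF A t]]])
  ultimately show ?thesis by (rule closed_sequentially[OF K(2)])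
qed

text \<open>Quantitative witnesses: \<open>v\<close> and \<open>c\<close> for pointedness,
  \<open>e\<close> and \<open>r\<close> for solidity. All later constants are built from
  them.\<close>

locale proper_cone =
  fixes K :: "(real^'n) set" and v e :: "real^'n" and c r :: real
  assumes cone_K: "cone K" and convex_K: "convex K" and closed_K: "closed K" and zero_K: "0 \<in> K"
    and c_pos: "0 < c" and v_ge: "x \<in> K \<Longrightarrow> c * norm x \<le> v \<bullet> x"
    and r_pos: "0 < r" and ball_K: "cball e r \<subseteq> K"
begin

lemma add_K: "x \<in> K \<Longrightarrow> y \<in> K \<Longrightarrow> x + y \<in> K"
  using convex_cone[of K] cone_K convex_K by auto

lemma scale_K: "x \<in> K \<Longrightarrow> 0 \<le> a \<Longrightarrow> a *\<^sub>R x \<in> K"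
  using cone_K by (auto simp: cone_def)

lemma e_K: "e \<in> K"
  using ball_K r_pos by auto

text \<open>The standard way from norms to the order of the cone: a vector of norm at most
  \<open>r * a\<close> is dominated by \<open>a *\<^sub>R e\<close>.\<close>

lemma ball_scale_K:
  assumes "norm y \<le> r * a" "0 \<le> a"
  shows "a *\<^sub>R e + y \<in> K"
proof (cases "a = 0")
  case False
  then have "e + y /\<^sub>R a \<in> cball e r" using assms by (simp add: dist_norm field_simps)
  then have "a *\<^sub>R (e + y /\<^sub>R a) \<in> K" using ball_K assms by (intro scale_K) auto
  then show ?thesis using False by (simp add: algebra_simps)
qed (use assms zero_K in auto)

lemma v_nonneg: "x \<in> K \<Longrightarrow> 0 \<le> v \<bullet> x"
  using v_ge[of x] c_pos by (meson mult_nonneg_nonneg norm_ge_zero order_trans less_imp_le)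

lemma v_pos: "x \<in> K \<Longrightarrow> x \<noteq> 0 \<Longrightarrow> 0 < v \<bullet> x"
  using v_ge[of x] c_pos by (smt (verit) mult_pos_pos zero_less_norm_iff)

lemma norm_le_v: "x \<in> K \<Longrightarrow> norm x \<le> v \<bullet> x / c"
  using v_ge[of x] c_pos by (simp add: field_simps)

lemma e_nonzero: "e \<noteq> 0"
proof
  assume e: "e = 0"
  obtain b :: "real^'n" where b: "b \<in> Basis" using nonempty_Basis by blast
  have "r *\<^sub>R b \<in> K" "- (r *\<^sub>R b) \<in> K" using ball_K e b r_pos by (auto simp: subset_iff dist_norm)
  from v_pos[OF this(1)] v_pos[OF this(2)] b r_pos show False by (auto simp: nonzero_Basis)
qed

lemma v_e_pos: "0 < v \<bullet> e"
  by (rule v_pos[OF e_K e_nonzero])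

text \<open>
  The constant \<open>h\<close> in the Metzler property depends on the operator and need not be bounded below
  on a compact set of operators. Adding the operator \<open>\<epsilon> v(x) e\<close>, which maps
  \<open>K - {0}\<close> into the interior, makes it uniform.
\<close>

lemma Metzler_perturbation_uniform:
  fixes \<A> :: "(real^'n^'n) set"
  assumes comp: "compact \<A>" and M: "\<forall>A\<in>\<A>. Metzler_on K A" and eps: "0 < \<epsilon>"
  obtains M where "0 \<le> M" "\<And>A x. A \<in> \<A> \<Longrightarrow> x \<in> K \<Longrightarrow> A *v x + \<epsilon> *\<^sub>R (v \<bullet> x) *\<^sub>R e + M *\<^sub>R x \<in> K"
proof -
  obtain b where b: "b > 0" "\<And>(A::real^'n^'n) x. norm (A *v x) \<le> norm A * norm x * b"
    using bounded_bilinear.pos_bounded[OF bounded_bilinear_matrix_vector_mult] by blast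
  \<comment> \<open>Chosen so that replacing an operator by one at distance below \<delta> changes
    the image of \<open>x\<close> by at most \<open>r * \<epsilon> * (v \<bullet> x)\<close>, which
    the added multiple of \<open>e\<close> absorbs.\<close>
  define \<delta> where "\<delta> = r * \<epsilon> * c / b"
  have \<delta>: "0 < \<delta>" using r_pos eps c_pos b by (simp add: \<delta>_def)
  obtain h where h: "\<And>A. A \<in> \<A> \<Longrightarrow> 0 < h A" "\<And>A x. A \<in> \<A> \<Longrightarrow> x \<in> K \<Longrightarrow> x + h A *\<^sub>R (A *v x) \<in> K"
    using M unfolding Metzler_on_def by metis
  have near: "B *v x + \<epsilon> *\<^sub>R (v \<bullet> x) *\<^sub>R e + (1 / h A) *\<^sub>R x \<in> K"
    if "A \<in> \<A>" "B \<in> ball A \<delta>" "x \<in> K" for A B x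
  proof -
    have "norm ((B - A) *v x) \<le> norm (B - A) * norm x * b" by (rule b)
    also have "\<dots> \<le> \<delta> * norm x * b" using that b by (intro mult_right_mono) (auto simp: dist_norm norm_minus_commute)
    also have "\<dots> = r * (\<epsilon> * (c * norm x))" using b by (simp add: \<delta>_def)
    also have "\<dots> \<le> r * (\<epsilon> * (v \<bullet> x))" using r_pos eps v_ge[OF that(3)] by (intro mult_left_mono) auto
    finally have "(\<epsilon> * (v \<bullet> x)) *\<^sub>R e + (B - A) *v x \<in> K"
      using eps v_nonneg[OF that(3)] by (intro ball_scale_K) auto
    moreover have "(1 / h A) *\<^sub>R (x + h A *\<^sub>R (A *v x)) \<in> K"
      using h(1)[OF that(1)] h(2)[OF that(1,3)] by (intro scale_K) auto
    ultimately have "((\<epsilon> * (v \<bullet> x)) *\<^sub>R e + (B - A) *v x) + (1 / h A) *\<^sub>R (x + h A *\<^sub>R (A *v x)) \<in> K"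
      by (rule add_K)
    then show ?thesis using h(1)[OF that(1)] by (simp add: algebra_simps matrix_vector_mult_diff_rdistrib)
  qed
  obtain C where C: "C \<subseteq> \<A>" "finite C" "\<A> \<subseteq> (\<Union>A\<in>C. ball A \<delta>)"
    by (rule compactE_image[OF comp, of \<A> "\<lambda>A. ball A \<delta>"]) (use \<delta> in auto)
  show ?thesis
  \<comment> \<open>The sum over the finite subcover dominates each \<open>1 / h A\<close> and,
    unlike a maximum, makes sense for an empty subcover.\<close>
  proof (rule that[of "\<Sum>A\<in>C. 1 / h A"])
    have pos: "0 \<le> 1 / h A" if "A \<in> C" for A using h(1)[of A] that C by auto
    then show "0 \<le> (\<Sum>A\<in>C. 1 / h A)" by (rule sum_nonneg)
    fix B x assume B: "B \<in> \<A>" and x: "x \<in> K"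
    then obtain A where A: "A \<in> C" "B \<in> ball A \<delta>" using C by blast
    then have "1 / h A \<le> (\<Sum>A\<in>C. 1 / h A)" using pos C by (intro member_le_sum) auto
    then have "((\<Sum>A\<in>C. 1 / h A) - 1 / h A) *\<^sub>R x \<in> K" by (intro scale_K x) auto
    from add_K[OF near[OF _ A(2) x] this] A C
    show "B *v x + \<epsilon> *\<^sub>R (v \<bullet> x) *\<^sub>R e + (\<Sum>A\<in>C. 1 / h A) *\<^sub>R x \<in> K"
      by (auto simp: algebra_simps)
  qed
qed

lemma bounded_control_add_const:
  fixes A :: "real \<Rightarrow> real^'n^'n"
  assumes A: "bounded_control L A" and B: "\<And>x. norm (B *v x) \<le> L' * norm x" and L': "0 \<le> L'"
  shows "bounded_control (L + L') (\<lambda>t. A t + B)"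
proof -
  have "norm ((A t + B) *v x) \<le> (L + L') * norm x" if "0 \<le> t" for t x
    using bounded_control_norm_le[OF A that, of x] B[of x] norm_triangle_ineq[of "A t *v x" "B *v x"]
    by (simp add: matrix_vector_mult_add_rdistrib distrib_right)
  then show ?thesis using A L' by (auto simp: bounded_control_def)
qed

text \<open>After adding a small multiple of the rank one operator \<open>E\<close> and a multiple
  of the identity, the control preserves \<open>K\<close> pointwise. The identity part only
  rescales, the part with \<open>E\<close> tends to zero, and \<open>K\<close> is closed.\<close>

lemma flow_mem_K:
  assumes comp: "compact \<A>" and Metz: "\<forall>A\<in>\<A>. Metzler_on K A"
    and A: "control_function \<A> A" and t: "0 \<le> t" and x: "x \<in> K"
  shows "flow A t x \<in> K"
proof -
  obtain L where L: "bounded_control L A"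
    using exists_bounded_control[OF compact_imp_bounded[OF comp]] A by metis
  define E :: "real^'n^'n" where "E = (\<chi> i j. e $ i * v $ j)"
  have E: "E *v x = (v \<bullet> x) *\<^sub>R e" for x
    by (simp add: E_def matrix_vector_mult_def inner_vec_def vec_eq_iff sum_distrib_left mult_ac)
  define \<kappa> where "\<kappa> = norm v * norm e"
  have EK: "norm (E *v x) \<le> \<kappa> * norm x" for x
    using mult_right_mono[OF Cauchy_Schwarz_ineq2[of v x], of "norm e"] by (simp add: E \<kappa>_def mult_ac)
  define B where "B n t = A t + (1 / real (Suc n)) *\<^sub>R E" for n t
  have Bv: "B n t *v y = A t *v y + (1 / real (Suc n)) *\<^sub>R (v \<bullet> y) *\<^sub>R e" for n t y
    by (simp add: B_def matrix_vector_mult_add_rdistrib scaleR_matrix_vector_assoc[symmetric] E)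
  have bB: "bounded_control (L + \<kappa>) (B n)" for n
    unfolding B_def
  proof (rule bounded_control_add_const[OF L])
    show "norm ((1 / real (Suc n)) *\<^sub>R E *v x) \<le> \<kappa> * norm x" for x
    proof -
      have "norm ((1 / real (Suc n)) *\<^sub>R E *v x) = (1 / real (Suc n)) * norm (E *v x)"
        by (simp add: scaleR_matrix_vector_assoc[symmetric])
      also have "\<dots> \<le> 1 * norm (E *v x)" by (intro mult_right_mono) auto
      finally show ?thesis using EK[of x] by simp
    qed
  qed (simp add: \<kappa>_def)
  have memB: "flow (B n) t x \<in> K" for n
  proof -
    obtain M where M: "0 \<le> M" "\<And>A x. A \<in> \<A> \<Longrightarrow> x \<in> K \<Longrightarrow> A *v x + (1 / real (Suc n)) *\<^sub>R (v \<bullet> x) *\<^sub>R e + M *\<^sub>R x \<in> K"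
      using Metzler_perturbation_uniform[OF comp Metz, of "1 / real (Suc n)"] by auto
    \<comment> \<open>\<open>M\<close> may blow up with \<open>n\<close>: it is undone exactly by a
      scalar factor, so no bound uniform in \<open>n\<close> is required.\<close>
    define D where "D t = B n t + M *\<^sub>R mat 1" for t
    have Dv: "D t *v y = B n t *v y + M *\<^sub>R y" for t y
      by (simp add: D_def matrix_vector_mult_add_rdistrib scaleR_matrix_vector_assoc[symmetric])
    have bD: "bounded_control (L + \<kappa> + M) D"
      unfolding D_def using M(1) by (intro bounded_control_add_const[OF bB]) (auto simp: scaleR_matrix_vector_assoc[symmetric])
    have "flow D t x \<in> K"
    proof (rule flow_mem_cone_if_preserving[OF convex_K closed_K cone_K zero_K bD _ t x])
      show "D t *v x \<in> K" if "0 \<le> t" "x \<in> K" for t x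
        using M(2)[of "A t" x] that A by (simp add: Dv Bv control_function_def)
    qed
    moreover have "exp (M * t) *\<^sub>R flow (B n) t x = flow D t x"
      using flow_eq[OF bD solves_exp_shift[OF bB bD Dv flow_solves[OF bB]] t, of x] by simp
    ultimately have "exp (- (M * t)) *\<^sub>R exp (M * t) *\<^sub>R flow (B n) t x \<in> K" by (simp add: scale_K)
    then show ?thesis by (simp add: exp_minus)
  qed
  define X where "X = norm x * exp ((L + \<kappa>) * t)"
  have XB: "norm (flow (B n) s x) \<le> X" if "s \<in> {0..t}" for n s
    unfolding X_def
    by (rule order_trans[OF flow_norm_le[OF bB]])
       (use that bounded_control_nonneg[OF L] in \<open>auto intro!: mult_left_mono simp: \<kappa>_def\<close>)
  have diff: "norm (flow (B n) t x - flow A t x) \<le> inverse (real (Suc n)) * (\<kappa> * X * t * exp (L * t))" for n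
  proof -
    let ?d = "\<lambda>s. flow (B n) s x - flow A s x"
    have "norm (?d t) \<le> inverse (real (Suc n)) * (\<kappa> * X * t) * exp (L * t)"
    proof (rule perturbed_solution_bound[OF L, where T = t])
      show "continuous_on {0..t} ?d" by (intro continuous_intros continuous_on_flow[OF L] continuous_on_flow[OF bB]) auto
      fix s assume s: "s \<in> {0..t}"
      have c: "continuous_on {0..s} (\<lambda>s. flow (B n) s x)" "continuous_on {0..s} (\<lambda>s. flow A s x)"
        by (intro continuous_on_flow[OF L] continuous_on_flow[OF bB] order_refl)+
      have "?d s = integral {0..s} (\<lambda>s. B n s *v flow (B n) s x) - integral {0..s} (\<lambda>s. A s *v flow A s x)"
        using s by (simp add: solves_eq[OF flow_solves[OF L, of x], of s] solves_eq[OF flow_solves[OF bB, of n x], of s])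
      then have "?d s - integral {0..s} (\<lambda>s. A s *v ?d s) = integral {0..s} (\<lambda>s. B n s *v flow (B n) s x - A s *v flow (B n) s x)"
        using c by (simp add: matrix_vector_mult_diff_distrib integral_diff control_integrable'[OF L] control_integrable'[OF bB])
      also have "norm \<dots> \<le> (inverse (real (Suc n)) * (\<kappa> * X)) * (s - 0)"
      proof (rule integral_norm_le_const)
        show "(\<lambda>s. B n s *v flow (B n) s x - A s *v flow (B n) s x) integrable_on {0..s}"
          by (intro integrable_diff control_integrable'[OF L] control_integrable'[OF bB] c order_refl)
        fix q assume q: "0 \<le> q" "q \<le> s"
        have "B n q *v flow (B n) q x - A q *v flow (B n) q x = inverse (real (Suc n)) *\<^sub>R (E *v flow (B n) q x)"
          by (simp add: Bv E divide_inverse)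
        also have "norm \<dots> \<le> inverse (real (Suc n)) * (\<kappa> * X)"
          using order_trans[OF EK[of "flow (B n) q x"] mult_left_mono[OF XB[of q n]]] q s
          by (auto intro!: mult_left_mono simp: \<kappa>_def)
        finally show "norm (B n q *v flow (B n) q x - A q *v flow (B n) q x) \<le> inverse (real (Suc n)) * (\<kappa> * X)" .
      qed (use s in auto)
      also have "\<dots> \<le> inverse (real (Suc n)) * (\<kappa> * X) * t"
        using s by (intro mult_left_mono) (auto simp: \<kappa>_def X_def)
      finally show "norm (?d s - integral {0..s} (\<lambda>s. A s *v ?d s)) \<le> inverse (real (Suc n)) * (\<kappa> * X * t)"
        by (simp add: mult_ac)
    qed (use t in auto)
    then show ?thesis by (simp add: mult_ac)
  qed
  have "(\<lambda>n. flow (B n) t x - flow A t x) \<longlonglongrightarrow> 0"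
  proof (rule Lim_null_comparison)
    show "\<forall>\<^sub>F n in sequentially. norm (flow (B n) t x - flow A t x) \<le> inverse (real (Suc n)) * (\<kappa> * X * t * exp (L * t))"
      using diff by auto
    show "(\<lambda>n. inverse (real (Suc n)) * (\<kappa> * X * t * exp (L * t))) \<longlonglongrightarrow> 0"
      by (intro tendsto_mult_left_zero LIMSEQ_inverse_real_of_nat)
  qed
  then have "(\<lambda>n. flow (B n) t x) \<longlonglongrightarrow> flow A t x" by (simp add: LIM_zero_iff)
  with memB show ?thesis by (rule closed_sequentially[OF closed_K])
qed

end

text \<open>Pointedness makes \<open>K - {0}\<close> convex, so the convex hull of the unit vectors
  of \<open>K\<close> is a compact set missing the origin. Strict separation from the origin gives
  \<open>v\<close>, with the separating level as \<open>c\<close>.\<close>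

lemma exists_proper_cone:
  fixes K :: "(real^'n) set"
  assumes "solid_cone K"
  obtains v e c r where "proper_cone K v e c r"
proof -
  have K: "0 \<in> K" "cone K" "convex K" "closed K" "interior K \<noteq> {}" "K \<inter> uminus ` K = {0}"
    using assms by (auto simp: solid_cone_def)
  have pointed: "x = 0" if "x \<in> K" "- x \<in> K" for x
    using K(6) that by (metis IntI image_eqI minus_minus singletonD)
  have add: "x + y \<in> K" if "x \<in> K" "y \<in> K" for x y
    using convex_cone[of K] K that by auto
  obtain e where "e \<in> interior K" using K(5) by blast
  then obtain r where er: "r > 0" "cball e r \<subseteq> K" unfolding mem_interior_cball by blast
  let ?S = "K \<inter> sphere 0 1"
  have "convex (K - {0})"
  proof (rule convexI)
    fix x y and a b :: real assume xy: "x \<in> K - {0}" "y \<in> K - {0}" and ab: "0 \<le> a" "0 \<le> b" "a + b = 1"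
    have m: "a *\<^sub>R x \<in> K" "b *\<^sub>R y \<in> K" using xy ab K(2) by (auto simp: cone_def)
    have "a *\<^sub>R x + b *\<^sub>R y \<noteq> 0"
    proof
      assume "a *\<^sub>R x + b *\<^sub>R y = 0"
      then have "a *\<^sub>R x = - (b *\<^sub>R y)" "b *\<^sub>R y = - (a *\<^sub>R x)" by (simp_all add: eq_neg_iff_add_eq_0 add.commute)
      with m pointed have "a *\<^sub>R x = 0" "b *\<^sub>R y = 0" by metis+
      with xy ab show False by auto
    qed
    with add[OF m] show "a *\<^sub>R x + b *\<^sub>R y \<in> K - {0}" by auto
  qed
  then have "convex hull ?S \<subseteq> K - {0}" by (intro hull_minimal) auto
  moreover have "compact ?S" using K(4) by (intro closed_Int_compact) auto
  ultimately obtain a b where ab: "b > 0" "\<forall>x\<in>convex hull ?S. b < a \<bullet> x"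
    using separating_hyperplane_closed_0[of "convex hull ?S"] compact_imp_closed[OF compact_convex_hull] by blast
  have "b * norm x \<le> a \<bullet> x" if x: "x \<in> K" for x
  proof (cases "x = 0")
    case False
    then have "x /\<^sub>R norm x \<in> ?S" using x K(2) by (auto simp: cone_def)
    then have "b < a \<bullet> (x /\<^sub>R norm x)" using ab(2) hull_inc by metis
    then show ?thesis using False by (simp add: field_simps)
  qed auto
  then have "proper_cone K a e b r"
    using K er ab by unfold_locales auto
  then show ?thesis by (rule that)
qed

section \<open>An extremal antinorm\<close>

text \<open>Antinorms without the demand of being nonzero, which an infimum can destroy. For
  homogeneous functionals superadditivity amounts to concavity and is easier to combine.\<close>

definition superlinear_on :: "(real^'n) set \<Rightarrow> (real^'n \<Rightarrow> real) \<Rightarrow> bool" where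
  "superlinear_on K f \<longleftrightarrow> (\<forall>x\<in>K. 0 \<le> f x) \<and> (\<forall>x\<in>K. \<forall>a\<ge>0. f (a *\<^sub>R x) = a * f x) \<and>
     (\<forall>x\<in>K. \<forall>y\<in>K. f x + f y \<le> f (x + y))"

lemma superlinear_onD:
  assumes "superlinear_on K f"
  shows "x \<in> K \<Longrightarrow> 0 \<le> f x" "x \<in> K \<Longrightarrow> 0 \<le> a \<Longrightarrow> f (a *\<^sub>R x) = a * f x"
    "x \<in> K \<Longrightarrow> y \<in> K \<Longrightarrow> f x + f y \<le> f (x + y)"
  using assms by (auto simp: superlinear_on_def)

lemma superlinear_on_mono:
  assumes "superlinear_on K f" "x \<in> K" "y - x \<in> K"
  shows "f x \<le> f y"
  using superlinear_onD(1)[OF assms(1,3)] superlinear_onD(3)[OF assms] by simp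

lemma superlinear_on_compose:
  assumes f: "superlinear_on K f" and T: "linear T" "\<And>x. x \<in> K \<Longrightarrow> T x \<in> K" and s: "0 \<le> s"
  shows "superlinear_on K (\<lambda>x. s * f (T x))"
  unfolding superlinear_on_def
proof (intro conjI ballI allI impI)
  fix x assume x: "x \<in> K"
  show "0 \<le> s * f (T x)" using superlinear_onD(1)[OF f] T(2)[OF x] s by simp
  show "s * f (T (a *\<^sub>R x)) = a * (s * f (T x))" if "0 \<le> a" for a
    using superlinear_onD(2)[OF f T(2)[OF x] that] by (simp add: linear_cmul[OF T(1)])
  show "s * f (T x) + s * f (T y) \<le> s * f (T (x + y))" if "y \<in> K" for y
    using superlinear_onD(3)[OF f T(2)[OF x] T(2)[OF that]] s
    by (simp add: linear_add[OF T(1)] distrib_left[symmetric] mult_left_mono)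
qed

context proper_cone
begin

lemma superlinear_on_inner: "superlinear_on K (\<lambda>x. v \<bullet> x)"
  by (auto simp: superlinear_on_def v_nonneg inner_add_right)

lemma superlinear_imp_antinorm:
  assumes f: "superlinear_on K f" and x: "x \<in> K" "f x \<noteq> 0"
  shows "antinorm_on K f"
proof -
  have "concave_on K f"
    unfolding concave_on_iff
  proof (intro conjI ballI allI impI convex_K)
    fix x y and a b :: real assume "x \<in> K" "y \<in> K" "0 \<le> a" "0 \<le> b" "a + b = 1"
    then show "a * f x + b * f y \<le> f (a *\<^sub>R x + b *\<^sub>R y)"
      using superlinear_onD(3)[OF f, of "a *\<^sub>R x" "b *\<^sub>R y"] superlinear_onD(2)[OF f] scale_K by simp
  qed
  then show ?thesis using superlinear_onD(1,2)[OF f] x unfolding antinorm_on_def by blast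
qed

lemma superlinear_on_INF:
  assumes I: "I \<noteq> {}" and g: "\<And>i. i \<in> I \<Longrightarrow> superlinear_on K (g i)"
  shows "superlinear_on K (\<lambda>x. INF i\<in>I. g i x)"
proof -
  have bdd: "bdd_below ((\<lambda>i. g i x) ` I)" if "x \<in> K" for x
    using superlinear_onD(1)[OF g that] by (intro bdd_belowI2[where m = 0])
  let ?f = "\<lambda>x. INF i\<in>I. g i x"
  have scale: "a * ?f x \<le> ?f (a *\<^sub>R x)" if "x \<in> K" "0 \<le> a" for a x
  proof (rule cINF_greatest[OF I])
    fix i assume "i \<in> I"
    then show "a * ?f x \<le> g i (a *\<^sub>R x)"
      using superlinear_onD(2)[OF g that] cINF_lower[OF bdd[OF that(1)]] that(2) by (simp add: mult_left_mono)
  qed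
  have "?f (a *\<^sub>R x) = a * ?f x" if x: "x \<in> K" and a: "0 \<le> a" for a x
  proof (cases "a = 0")
    case True
    have "g i 0 = 0" if "i \<in> I" for i using superlinear_onD(2)[OF g[OF that] x, of 0] by simp
    then have "?f 0 = (INF i\<in>I. 0)" by (intro INF_cong) auto
    with True I show ?thesis by simp
  next
    case False
    with scale[OF scale_K[OF x a], of "1 / a"] a have "?f (a *\<^sub>R x) \<le> a * ?f x" by (simp add: field_simps)
    with scale[OF x a] show ?thesis by simp
  qed
  moreover have "?f x + ?f y \<le> ?f (x + y)" if "x \<in> K" "y \<in> K" for x y
  proof (rule cINF_greatest[OF I])
    fix i assume i: "i \<in> I"
    show "?f x + ?f y \<le> g i (x + y)"
      using superlinear_onD(3)[OF g[OF i] that] cINF_lower[OF bdd i, of x] cINF_lower[OF bdd i, of y] that by simp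
  qed
  moreover have "0 \<le> ?f x" if "x \<in> K" for x
    by (rule cINF_greatest[OF I]) (rule superlinear_onD(1)[OF g that])
  ultimately show ?thesis by (auto simp: superlinear_on_def)
qed

end

text \<open>Nonemptiness provides controls, so that infima over controls range over nonempty sets;
  the empty case is left to the final theorem.\<close>

locale Metzler_system = proper_cone K v e c r
  for K :: "(real^'n) set" and v e :: "real^'n" and c r :: real +
  fixes \<A> :: "(real^'n^'n) set" and L :: real
  assumes compact_A: "compact \<A>" and nonempty_A: "\<A> \<noteq> {}"
    and Metzler_A: "\<forall>A\<in>\<A>. Metzler_on K A"
    and L_pos: "0 < L" and norm_A_le: "A \<in> \<A> \<Longrightarrow> norm (A *v x) \<le> L * norm x"
begin

abbreviation \<sigma> :: real where "\<sigma> \<equiv> lower_Lyapunov_exponent \<A>"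

lemma bounded_control: "control_function \<A> A \<Longrightarrow> bounded_control L A"
  using norm_A_le L_pos by (auto simp: bounded_control_def control_function_def)

lemma flow_K: "control_function \<A> A \<Longrightarrow> 0 \<le> t \<Longrightarrow> x \<in> K \<Longrightarrow> flow A t x \<in> K"
  by (rule flow_mem_K[OF compact_A Metzler_A])

lemma exists_control: obtains A where "control_function \<A> A"
proof -
  obtain B where "B \<in> \<A>" using nonempty_A by blast
  then have "control_function \<A> (\<lambda>_. B)" by (simp add: control_function_def)
  then show ?thesis by (rule that)
qed

lemma flow_concat_control:
  assumes "control_function \<A> A" "control_function \<A> B" "0 \<le> s" "0 \<le> t"
  shows "flow (concat_control s A B) (s + t) x = flow B t (flow A s x)"
  using flow_concat(2)[OF bounded_control bounded_control bounded_control] assms control_function_concat by blast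

text \<open>With \<open>a = norm x / r\<close>, both \<open>x\<close> and \<open>- x\<close> are
  dominated by \<open>a *\<^sub>R e\<close>, and flows preserve this order. Of the factor 3, two
  units bound the shifted vector \<open>a *\<^sub>R flow A t e + flow A t x\<close> and one removes
  the shift.\<close>

lemma norm_flow_le_v:
  assumes A: "control_function \<A> A" and t: "0 \<le> t"
  shows "norm (flow A t x) \<le> 3 / (c * r) * (v \<bullet> flow A t e) * norm x"
proof -
  note lin = linear_flow[OF bounded_control[OF A] t]
  define a where "a = norm x / r"
  have a: "0 \<le> a" "norm x \<le> r * a" using r_pos by (auto simp: a_def)
  have "a *\<^sub>R e + x \<in> K" "a *\<^sub>R e + - x \<in> K" using a by (auto intro!: ball_scale_K simp del: add_uminus_conv_diff)
  then have "flow A t (a *\<^sub>R e + x) \<in> K" "flow A t (a *\<^sub>R e + - x) \<in> K" by (simp_all only: flow_K[OF A t])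
  then have m: "a *\<^sub>R flow A t e + flow A t x \<in> K" "a *\<^sub>R flow A t e - flow A t x \<in> K"
    by (simp_all add: linear_add[OF lin] linear_diff[OF lin] linear_cmul[OF lin])
  have m': "a *\<^sub>R flow A t e \<in> K" by (intro scale_K flow_K A t e_K a)
  have "norm (flow A t x) \<le> norm (a *\<^sub>R flow A t e + flow A t x) + norm (a *\<^sub>R flow A t e)"
    using norm_triangle_ineq4[of "a *\<^sub>R flow A t e + flow A t x" "a *\<^sub>R flow A t e"] by simp
  also have "\<dots> \<le> v \<bullet> (a *\<^sub>R flow A t e + flow A t x) / c + v \<bullet> (a *\<^sub>R flow A t e) / c"
    by (intro add_mono norm_le_v m m')
  also have "\<dots> \<le> 3 * (a * (v \<bullet> flow A t e)) / c"
    using v_nonneg[OF m(2)] c_pos by (simp add: inner_diff_right inner_add_right field_simps)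
  finally show ?thesis by (simp add: a_def mult_ac)
qed

section \<open>Exponents and periodic repetition of a control\<close>

definition exponents :: "real set" where
  "exponents = {\<alpha>. \<exists>A. control_function \<A> A \<and>
     (\<forall>x. solves_linear_ode A x \<longrightarrow> (\<exists>C. \<forall>t\<ge>0. norm (x t) \<le> C * exp (\<alpha> * t)))}"

text \<open>By the backward estimate no nonzero trajectory decays faster than
  \<open>exp (- L * t)\<close>. This bound makes the real infimum \<sigma> a genuine one.\<close>

lemma exponents_ge: assumes "\<alpha> \<in> exponents" shows "- L \<le> \<alpha>"
proof (rule ccontr)
  assume "\<not> - L \<le> \<alpha>"
  then have neg: "\<alpha> + L < 0" by simp
  obtain A where A: "control_function \<A> A" "\<And>x. solves_linear_ode A x \<Longrightarrow> \<exists>C. \<forall>t\<ge>0. norm (x t) \<le> C * exp (\<alpha> * t)"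
    using assms unfolding exponents_def by blast
  obtain C where C: "\<And>t. 0 \<le> t \<Longrightarrow> norm (flow A t e) \<le> C * exp (\<alpha> * t)"
    using A(2)[OF flow_solves[OF bounded_control[OF A(1)], of e]] by blast
  have le: "norm e \<le> C * exp ((\<alpha> + L) * t)" if "0 \<le> t" for t
  proof -
    have "norm e \<le> norm (flow A t e) * exp (L * t)" by (rule flow_norm_ge[OF bounded_control[OF A(1)] that])
    also have "\<dots> \<le> C * exp (\<alpha> * t) * exp (L * t)" by (intro mult_right_mono C that) auto
    finally show ?thesis by (simp add: algebra_simps exp_add)
  qed
  have "((\<lambda>t. C * exp ((\<alpha> + L) * t)) \<longlongrightarrow> C * 0) at_top"
    using neg by (intro tendsto_intros filterlim_compose[OF exp_at_bot] filterlim_tendsto_neg_mult_at_bot[OF tendsto_const _ filterlim_ident])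
  moreover have "\<forall>\<^sub>F t in at_top. norm e \<le> C * exp ((\<alpha> + L) * t)"
    using eventually_ge_at_top[of 0] by eventually_elim (rule le)
  ultimately have "norm e \<le> C * 0" by (intro tendsto_lowerbound) auto
  then show False using e_nonzero by simp
qed

lemma exponents_nonempty: "exponents \<noteq> {}"
proof -
  obtain A where A: "control_function \<A> A" by (rule exists_control)
  have "\<exists>C. \<forall>t\<ge>0. norm (x t) \<le> C * exp (L * t)" if "solves_linear_ode A x" for x
    using solves_norm_le[OF bounded_control[OF A] that] by blast
  with A have "L \<in> exponents" unfolding exponents_def by blast
  then show ?thesis by blast
qed

lemma exponent_le: "\<alpha> \<in> exponents \<Longrightarrow> \<sigma> \<le> \<alpha>"
  unfolding lower_Lyapunov_exponent_def exponents_def[symmetric]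
  by (rule cInf_lower) (auto intro: bdd_belowI[of _ "- L"] exponents_ge)

lemma exponent_lessD: "\<sigma> < \<beta> \<Longrightarrow> \<exists>\<alpha>\<in>exponents. \<alpha> < \<beta>"
  unfolding lower_Lyapunov_exponent_def exponents_def[symmetric]
  by (rule cInf_lessD[OF exponents_nonempty])

text \<open>Under periodic repetition the norm after \<open>k\<close> periods is at most
  \<open>q ^ k\<close> times the initial one, so \<open>ln q / T\<close> is an admissible
  exponent.\<close>

lemma exponent_periodic:
  assumes A: "control_function \<A> A" and T: "0 < T" and q: "0 < q" "\<And>x. norm (flow A T x) \<le> q * norm x"
  shows "exp (\<sigma> * T) \<le> q"
proof -
  define P where "P = periodic_control T A"
  have P: "control_function \<A> P" using control_function_periodic[OF A T] by (simp add: P_def)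
  note bP = bounded_control[OF P] and bA = bounded_control[OF A]
  define \<alpha> where "\<alpha> = ln q / T"
  have q_eq: "q = exp (\<alpha> * T)" using q T by (simp add: \<alpha>_def)
  have iter: "norm ((flow A T ^^ k) x) \<le> q ^ k * norm x" for k x
  proof (induction k)
    case (Suc k)
    show ?case using order_trans[OF q(2) mult_left_mono[OF Suc.IH, of q]] q(1) by (simp add: mult.assoc)
  qed auto
  \<comment> \<open>\<open>exp (L * T)\<close> pays for the growth during the unfinished period, the
    factor with the absolute value of \<alpha> for replacing \<open>k * T\<close> by
    \<open>t\<close>; \<alpha> may have either sign.\<close>
  have "norm (x t) \<le> (norm (x 0) * exp (L * T) * exp (\<bar>\<alpha>\<bar> * T)) * exp (\<alpha> * t)"
    if x: "solves_linear_ode P x" and t: "0 \<le> t" for x t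
  proof -
    define k where "k = nat \<lfloor>t / T\<rfloor>"
    define s where "s = t - T * real k"
    have k: "real_of_int \<lfloor>t / T\<rfloor> = real k" using t T by (simp add: k_def)
    have s: "0 \<le> s" "s < T" "t = real k * T + s"
      using floor_mult_le[OF T, of t] unfolding s_def k by (auto simp: algebra_simps)
    have kT: "0 \<le> real k * T" using T by simp
    have "x t = flow P t (x 0)" by (rule flow_eq[OF bP x t])
    also have "\<dots> = flow (shift_control (real k * T) P) s ((flow A T ^^ k) (x 0))"
      using flow_shift[OF bP kT s(1)] flow_periodic[OF bA bP[unfolded P_def] T] s(3) by (simp add: P_def)
    finally have "norm (x t) \<le> norm ((flow A T ^^ k) (x 0)) * exp (L * s)"
      using flow_norm_le[OF bounded_control_shift[OF bP kT] s(1)] by simp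
    also have "\<dots> \<le> (q ^ k * norm (x 0)) * exp (L * T)"
      using s L_pos iter[of k "x 0"] q by (intro mult_mono) auto
    also have "q ^ k = exp (\<alpha> * t - \<alpha> * s)"
      using s(3) by (simp add: q_eq exp_of_nat_mult[symmetric] algebra_simps)
    also have "exp (\<alpha> * t - \<alpha> * s) \<le> exp (\<alpha> * t + \<bar>\<alpha>\<bar> * T)"
    proof -
      have "- (\<alpha> * s) \<le> \<bar>\<alpha>\<bar> * s" using s by (simp add: abs_if)
      also have "\<dots> \<le> \<bar>\<alpha>\<bar> * T" using s by (intro mult_left_mono) auto
      finally show ?thesis by simp
    qed
    finally show ?thesis by (simp add: exp_add mult_ac mult_right_mono)
  qed
  then have "\<alpha> \<in> exponents" unfolding exponents_def using P by blast
  then have "\<sigma> * T \<le> \<alpha> * T" using exponent_le T by simp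
  then show ?thesis by (simp add: q_eq)
qed

lemma v_flow_e_ge:
  assumes A: "control_function \<A> A" and t: "0 \<le> t"
  shows "c * r / 3 * exp (\<sigma> * t) \<le> v \<bullet> flow A t e"
proof -
  have D: "0 < 3 / (c * r)" using c_pos r_pos by simp
  have f: "flow A t e \<in> K" "flow A t e \<noteq> 0"
    using flow_K[OF A t e_K] flow_norm_ge[OF bounded_control[OF A] t, of e] e_nonzero by auto
  have "exp (\<sigma> * t) \<le> 3 / (c * r) * (v \<bullet> flow A t e)"
  proof (cases "t = 0")
    \<comment> \<open>A period of length zero cannot be repeated, so here the estimate of the flow
      is applied to \<open>e\<close> itself.\<close>
    case True
    have "1 * norm e \<le> (3 / (c * r) * (v \<bullet> flow A t e)) * norm e" using norm_flow_le_v[OF A t, of e] True by simp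
    then have "1 \<le> 3 / (c * r) * (v \<bullet> flow A t e)" by (rule mult_right_le_imp_le) (simp add: e_nonzero)
    then show ?thesis by (simp add: True)
  next
    case False
    with t v_pos[OF f] D show ?thesis by (intro exponent_periodic[OF A] norm_flow_le_v[OF A t] mult_pos_pos) auto
  qed
  then show ?thesis using c_pos r_pos by (simp add: field_simps)
qed

section \<open>The infimum over controls and times\<close>

abbreviation controls :: "(real \<Rightarrow> real^'n^'n) set" where "controls \<equiv> {A. control_function \<A> A}"

definition inf_antinorm :: "real^'n \<Rightarrow> real" where
  "inf_antinorm x = (INF p\<in>{0..} \<times> controls. exp (- \<sigma> * fst p) * (v \<bullet> flow (snd p) (fst p) x))"

lemma controls_nonempty: "controls \<noteq> {}"
  using exists_control by blast

lemma superlinear_flow: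
  "superlinear_on K f \<Longrightarrow> control_function \<A> A \<Longrightarrow> 0 \<le> t \<Longrightarrow> superlinear_on K (\<lambda>x. exp (- \<sigma> * t) * f (flow A t x))"
  by (rule superlinear_on_compose) (auto intro: linear_flow[OF bounded_control] flow_K)

lemma superlinear_inf_antinorm: "superlinear_on K inf_antinorm"
  unfolding inf_antinorm_def
proof (rule superlinear_on_INF)
  show "superlinear_on K (\<lambda>x. exp (- \<sigma> * fst p) * (v \<bullet> flow (snd p) (fst p) x))" if "p \<in> {0..} \<times> controls" for p
    using that by (intro superlinear_flow[OF superlinear_on_inner]) auto
qed (use controls_nonempty in auto)

lemma inf_antinorm_le:
  assumes "control_function \<A> A" "0 \<le> t" "x \<in> K"
  shows "inf_antinorm x \<le> exp (- \<sigma> * t) * (v \<bullet> flow A t x)"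
proof -
  have "bdd_below ((\<lambda>p. exp (- \<sigma> * fst p) * (v \<bullet> flow (snd p) (fst p) x)) ` ({0..} \<times> controls))"
    using assms by (intro bdd_belowI2[where m = 0]) (auto intro!: mult_nonneg_nonneg v_nonneg flow_K)
  from cINF_lower[OF this, of "(t, A)"] assms show ?thesis unfolding inf_antinorm_def by simp
qed

lemma inf_antinorm_ge:
  assumes "\<And>A t. control_function \<A> A \<Longrightarrow> 0 \<le> t \<Longrightarrow> a \<le> exp (- \<sigma> * t) * (v \<bullet> flow A t x)"
  shows "a \<le> inf_antinorm x"
  unfolding inf_antinorm_def using controls_nonempty assms by (intro cINF_greatest) auto

text \<open>Following \<open>A\<close> up to time \<open>t\<close> and any \<open>B\<close>
  afterwards is one of the competitors for \<open>x\<close>, so the infimum at the later point runs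
  over fewer possibilities.\<close>

lemma inf_antinorm_flow:
  assumes A: "control_function \<A> A" and t: "0 \<le> t" and x: "x \<in> K"
  shows "inf_antinorm x \<le> exp (- \<sigma> * t) * inf_antinorm (flow A t x)"
proof -
  have "exp (\<sigma> * t) * inf_antinorm x \<le> inf_antinorm (flow A t x)"
  proof (rule inf_antinorm_ge)
    fix B s assume B: "control_function \<A> B" and s: "0 \<le> (s::real)"
    have "inf_antinorm x \<le> exp (- \<sigma> * (t + s)) * (v \<bullet> flow B s (flow A t x))"
      using inf_antinorm_le[OF control_function_concat[OF A B] _ x, of "t + s" t] t s
      by (simp add: flow_concat_control[OF A B t s])
    then have "exp (\<sigma> * t) * inf_antinorm x \<le> exp (\<sigma> * t) * (exp (- \<sigma> * (t + s)) * (v \<bullet> flow B s (flow A t x)))"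
      by (intro mult_left_mono) auto
    then show "exp (\<sigma> * t) * inf_antinorm x \<le> exp (- \<sigma> * s) * (v \<bullet> flow B s (flow A t x))"
      by (simp add: mult.assoc[symmetric] exp_add[symmetric] algebra_simps)
  qed
  then show ?thesis by (simp add: exp_minus field_simps)
qed

lemma inf_antinorm_e: "c * r / 3 \<le> inf_antinorm e"
proof (rule inf_antinorm_ge)
  fix A t assume "control_function \<A> A" "0 \<le> (t::real)"
  from v_flow_e_ge[OF this] show "c * r / 3 \<le> exp (- \<sigma> * t) * (v \<bullet> flow A t e)"
    by (simp add: exp_minus field_simps)
qed

lemma extremal_antinormI:
  assumes f: "antinorm_on K f"
    and flow: "\<And>A t x. control_function \<A> A \<Longrightarrow> 0 \<le> t \<Longrightarrow> x \<in> K \<Longrightarrow> f x \<le> exp (- \<sigma> * t) * f (flow A t x)"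
  shows "extremal_antinorm K \<A> f"
  unfolding extremal_antinorm_def trajectory_def
proof (intro conjI f allI impI; elim conjE exE)
  fix x A and t :: real assume x: "x 0 \<in> K" and A: "control_function \<A> A" "solves_linear_ode A x" and t: "0 \<le> t"
  have "f (x 0) \<le> exp (- \<sigma> * t) * f (x t)"
    using flow[OF A(1) t x] flow_eq[OF bounded_control[OF A(1)] A(2) t] by simp
  then show "exp (\<sigma> * t) * f (x 0) \<le> f (x t)" by (simp add: exp_minus field_simps)
qed

lemma exists_extremal_antinorm: "\<exists>f. extremal_antinorm K \<A> f"
proof -
  have "inf_antinorm e \<noteq> 0" using inf_antinorm_e c_pos r_pos by (smt (verit) divide_pos_pos mult_pos_pos)
  then show ?thesis
    using extremal_antinormI[OF superlinear_imp_antinorm[OF superlinear_inf_antinorm e_K] inf_antinorm_flow] by blast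
qed

end

section \<open>Almost everywhere convergent convex combinations\<close>

text \<open>Convex weights supported in the tail from \<open>n\<close>: averages along tails keep
  the limit of a convergent sequence. Total functions of finite support spare index sets when two
  averages are combined.\<close>

definition averaging :: "nat \<Rightarrow> (nat \<Rightarrow> real) \<Rightarrow> bool" where
  "averaging n w \<longleftrightarrow> (\<forall>j. 0 \<le> w j) \<and> (\<forall>j<n. w j = 0) \<and> finite {j. w j \<noteq> 0} \<and> (\<Sum>j | w j \<noteq> 0. w j) = 1"

definition avg :: "(nat \<Rightarrow> real) \<Rightarrow> (nat \<Rightarrow> 'a::real_vector) \<Rightarrow> 'a" where
  "avg w u = (\<Sum>j | w j \<noteq> 0. w j *\<^sub>R u j)"

lemma avg_superset:
  "finite F \<Longrightarrow> {j. w j \<noteq> 0} \<subseteq> F \<Longrightarrow> avg w u = (\<Sum>j\<in>F. w j *\<^sub>R u j)"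
  unfolding avg_def by (rule sum.mono_neutral_left) auto

lemma averaging_mono: "averaging n w \<Longrightarrow> m \<le> n \<Longrightarrow> averaging m w"
  by (auto simp: averaging_def)

lemma averaging_midpoint:
  assumes "averaging n w" "averaging m w'"
  shows "averaging (min n m) (\<lambda>j. (w j + w' j) / 2)"
    and "avg (\<lambda>j. (w j + w' j) / 2) u = (1 / 2) *\<^sub>R (avg w u + avg w' u)"
proof -
  let ?F = "{j. w j \<noteq> 0} \<union> {j. w' j \<noteq> 0}" and ?w = "\<lambda>j. (w j + w' j) / 2"
  have F: "finite ?F" using assms by (auto simp: averaging_def)
  have sub: "{j. ?w j \<noteq> 0} \<subseteq> ?F" by auto
  have *: "avg ?w u = (1 / 2) *\<^sub>R (avg w u + avg w' u)" for u :: "nat \<Rightarrow> 'z::real_vector"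
    unfolding avg_superset[OF F sub] avg_superset[OF F Un_upper1] avg_superset[OF F Un_upper2] 
    by (simp add: sum.distrib[symmetric] scaleR_sum_right scaleR_add_left[symmetric] add_divide_distrib)
  show "avg ?w u = (1 / 2) *\<^sub>R (avg w u + avg w' u)" by (rule *)
  have "(\<Sum>j | ?w j \<noteq> 0. ?w j) = 1"
    using *[of "\<lambda>_. 1::real"] assms by (simp add: avg_def averaging_def)
  then show "averaging (min n m) ?w"
    using assms finite_subset[OF sub F] by (auto simp: averaging_def)
qed

lemma avg_mem_convex:
  assumes "averaging n w" "convex S" "\<And>j. n \<le> j \<Longrightarrow> u j \<in> S"
  shows "avg w u \<in> S"
  unfolding avg_def using assms
  by (intro convex_sum) (auto simp: averaging_def, meson not_le_imp_less)

lemma averaging_norm_le: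
  assumes "averaging n w" "\<And>j. n \<le> j \<Longrightarrow> norm (u j) \<le> B"
  shows "norm (avg w u) \<le> B"
  using avg_mem_convex[OF assms(1) convex_cball[of 0 B], of u] assms(2) by auto

lemma avg_diff: "avg w u - avg w u' = avg w (\<lambda>j. u j - u' j)"
  by (simp add: avg_def sum_subtractf[symmetric] scaleR_diff_right)

lemma avg_add: "avg w u + avg w u' = avg w (\<lambda>j. u j + u' j)"
  by (simp add: avg_def sum.distrib[symmetric] scaleR_add_right)

lemma avg_const: "averaging n w \<Longrightarrow> avg w (\<lambda>_. l) = l"
  by (simp add: avg_def averaging_def scaleR_sum_left[symmetric])

lemma averages_tendsto:
  fixes u :: "nat \<Rightarrow> 'a::real_normed_vector"
  assumes w: "\<And>i. averaging i (w i)" and u: "u \<longlonglongrightarrow> l"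
  shows "(\<lambda>i. avg (w i) u) \<longlonglongrightarrow> l"
proof (rule LIMSEQ_I)
  fix \<epsilon> :: real assume "0 < \<epsilon>"
  then obtain N where N: "\<And>j. N \<le> j \<Longrightarrow> norm (u j - l) < \<epsilon> / 2"
    using LIMSEQ_D[OF u, of "\<epsilon> / 2"] by auto
  have "norm (avg (w i) u - l) < \<epsilon>" if "N \<le> i" for i
  proof -
    have "avg (w i) u - l = avg (w i) (\<lambda>j. u j - l)"
      unfolding avg_diff[symmetric] avg_const[OF w] ..
    also have "norm \<dots> \<le> \<epsilon> / 2"
      by (rule averaging_norm_le[OF w]) (use N that in \<open>force intro: less_imp_le\<close>)
    finally show ?thesis using \<open>0 < \<epsilon>\<close> by simp
  qed
  then show "\<exists>no. \<forall>n\<ge>no. norm (avg (w n) u - l) < \<epsilon>" by blast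
qed

text \<open>The norms of the increments have a finite integral in total, so their sum is finite
  almost everywhere and the telescoping series converges absolutely there.\<close>

lemma AE_convergent_if_summable_L1_increments:
  fixes g :: "nat \<Rightarrow> 'a \<Rightarrow> 'b::euclidean_space"
  assumes g: "\<And>i. integrable M (\<lambda>t. g (Suc i) t - g i t)"
    and s: "summable (\<lambda>i. LINT t|M. norm (g (Suc i) t - g i t))"
  shows "AE t in M. convergent (\<lambda>i. g i t)"
proof -
  let ?u = "\<lambda>i t. g (Suc i) t - g i t"
  have m: "(\<lambda>t. ennreal (norm (?u i t))) \<in> borel_measurable M" for i
    using borel_measurable_integrable[OF g[of i]] by measurable
  have "(\<integral>\<^sup>+t. (\<Sum>i. ennreal (norm (?u i t))) \<partial>M) = (\<Sum>i. \<integral>\<^sup>+t. ennreal (norm (?u i t)) \<partial>M)"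
    by (rule nn_integral_suminf[OF m])
  also have "\<dots> = (\<Sum>i. ennreal (LINT t|M. norm (?u i t)))"
    by (intro suminf_cong nn_integral_eq_integral integrable_norm g) auto
  also have "\<dots> = ennreal (\<Sum>i. LINT t|M. norm (?u i t))"
    by (intro suminf_ennreal2 s) auto
  finally have "(\<integral>\<^sup>+t. (\<Sum>i. ennreal (norm (?u i t))) \<partial>M) \<noteq> \<infinity>" by simp
  then have "AE t in M. (\<Sum>i. ennreal (norm (?u i t))) \<noteq> \<infinity>"
    by (intro nn_integral_PInf_AE borel_measurable_suminf_order m)
  then show ?thesis
  proof eventually_elim
    fix t assume "(\<Sum>i. ennreal (norm (?u i t))) \<noteq> \<infinity>"
    then have "summable (\<lambda>i. norm (?u i t))" by (intro summable_suminf_not_top) auto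
    then have "summable (\<lambda>i. ?u i t)" by (rule summable_norm_cancel)
    then have "convergent (\<lambda>n. g 0 t + (\<Sum>i<n. ?u i t))"
      by (simp add: convergent_add_const_iff summable_iff_convergent)
    then show "convergent (\<lambda>i. g i t)"
      using sum_lessThan_telescope[of "\<lambda>i. g i t"] by simp
  qed
qed

text \<open>Integrated over a finite measure, this turns a bound on squares into one on first
  moments, in place of the Cauchy-Schwarz inequality.\<close>

lemma norm_le_delta:
  assumes "0 < \<delta>" shows "norm (x::'a::real_normed_vector) \<le> \<delta> + (norm x)\<^sup>2 / \<delta>"
proof (cases "norm x \<le> \<delta>")
  case False
  then have "norm x * \<delta> \<le> norm x * norm x" by (intro mult_left_mono) auto
  then have "norm x \<le> (norm x)\<^sup>2 / \<delta>" using assms by (simp add: power2_eq_square field_simps)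
  then show ?thesis using assms by simp
qed (use assms in \<open>simp add: add_increasing2\<close>)

text \<open>
  Averages over the tails whose quadratic mean is nearly minimal form a Cauchy sequence in
  \<open>L\<^sup>2\<close>, by the parallelogram identity. This replaces weak compactness: the limit of averages of
  controls takes its values in the closed convex hull.
\<close>

lemma (in finite_measure) averages_AE_convergent:
  fixes a :: "nat \<Rightarrow> 'a \<Rightarrow> 'b::euclidean_space"
  assumes a[measurable]: "\<And>n. a n \<in> borel_measurable M" and B: "\<And>n t. t \<in> space M \<Longrightarrow> norm (a n t) \<le> B"
  obtains w where "\<And>i::nat. averaging i (w i)" "AE t in M. convergent (\<lambda>i. avg (w i) (\<lambda>j. a j t))"
proof -
  define g where "g w t = avg w (\<lambda>j. a j t)" for w t
  have gm[measurable]: "g w \<in> borel_measurable M" for w unfolding g_def avg_def by measurable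
  have gB: "norm (g w t) \<le> B" if "averaging n w" "t \<in> space M" for n w t
    unfolding g_def by (rule averaging_norm_le[OF that(1) B[OF that(2)]])
  have gd: "integrable M (\<lambda>t. (norm (g w t - g w' t))\<^sup>2)" "integrable M (\<lambda>t. g w t - g w' t)"
    "integrable M (\<lambda>t. (norm (g w t))\<^sup>2)" if "averaging n w" "averaging m w'" for w w' n m
  proof -
    have *: "norm (g w t - g w' t) \<le> 2 * B" if "t \<in> space M" for t
      using norm_triangle_ineq4[of "g w t" "g w' t"] gB[OF \<open>averaging n w\<close> that] gB[OF \<open>averaging m w'\<close> that] by simp
    have "(norm (g w t - g w' t))\<^sup>2 \<le> (2 * B)\<^sup>2" if "t \<in> space M" for t
      by (rule power_mono[OF *[OF that]]) simp
    then show "integrable M (\<lambda>t. (norm (g w t - g w' t))\<^sup>2)"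
      by (intro integrable_const_bound[where B = "(2 * B)\<^sup>2"]) (auto intro!: AE_I2)
    show "integrable M (\<lambda>t. g w t - g w' t)"
      by (rule integrable_const_bound[where B = "2 * B"]) (auto intro!: AE_I2 *)
    show "integrable M (\<lambda>t. (norm (g w t))\<^sup>2)"
      by (rule integrable_const_bound[where B = "B\<^sup>2"]) (auto intro!: AE_I2 power_mono gB[OF \<open>averaging n w\<close>])
  qed
  define q where "q w = (LINT t|M. (norm (g w t))\<^sup>2)" for w
  \<comment> \<open>The infimum of the quadratic means over the tail from \<open>n\<close>. It
    increases, since later tails allow fewer averages, and it is bounded, so it converges.\<close>
  define d where "d n = (INF w\<in>Collect (averaging n). q w)" for n
  have q0: "0 \<le> q w" for w unfolding q_def by simp
  have bdd: "bdd_below (q ` Collect (averaging n))" for n using q0 by (intro bdd_belowI2[where m = 0])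
  have ne: "(\<lambda>j. if j = n then 1 else 0) \<in> Collect (averaging n)" for n
    by (auto simp: averaging_def)
  have d_le: "d n \<le> q w" if "averaging n w" for n w
    unfolding d_def by (rule cINF_lower[OF bdd]) (use that in auto)
  have d_mono: "d n \<le> d m" if "n \<le> m" for n m
    unfolding d_def using ne averaging_mono[OF _ that] by (intro cINF_superset_mono bdd) auto
  have qB: "q w \<le> B\<^sup>2 * measure M (space M)" if "averaging n w" for n w
  proof -
    have "q w \<le> (LINT t|M. B\<^sup>2)"
      unfolding q_def by (intro integral_mono gd[OF that that] power_mono gB[OF that]) auto
    then show ?thesis by (simp add: mult.commute)
  qed
  have "\<exists>w. averaging n w \<and> q w < d n + inverse (real (Suc n))" for n
    using cInf_lessD[of "q ` Collect (averaging n)" "d n + inverse (real (Suc n))"] ne[of n] unfolding d_def by auto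
  then obtain W where W: "\<And>n. averaging n (W n)" "\<And>n. q (W n) < d n + inverse (real (Suc n))" by metis
  have "d n \<le> B\<^sup>2 * measure M (space M)" for n using d_le[OF W(1)] qB[OF W(1)] order_trans by blast
  then obtain D where D: "d \<longlonglongrightarrow> D" "\<And>n. d n \<le> D"
    using incseq_convergent[of d "B\<^sup>2 * measure M (space M)"] d_mono by (auto simp: incseq_def)
  \<comment> \<open>What the parallelogram identity leaves for two nearly minimal averages when
    \<open>d m\<close> is replaced by its limit \<open>D\<close> and both slacks by the larger
    one.\<close>
  define \<eta> where "\<eta> n = 2 * (D - d n) + 4 * inverse (real (Suc n))" for n
  have "\<eta> \<longlonglongrightarrow> 2 * (D - D) + 4 * 0"
    unfolding \<eta>_def by (intro tendsto_intros D(1) LIMSEQ_inverse_real_of_nat)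
  then have \<eta>: "\<eta> \<longlonglongrightarrow> 0" by simp
  have close: "(LINT t|M. (norm (g (W m) t - g (W n) t))\<^sup>2) \<le> \<eta> n" if "n \<le> m" for n m
  proof -
    let ?mid = "\<lambda>j. (W n j + W m j) / 2"
    \<comment> \<open>The midpoint still averages the tail from \<open>n\<close>, so its quadratic
      mean is at least \<open>d n\<close>; this is the negative term of the identity.\<close>
    have av: "averaging n ?mid" using averaging_midpoint(1)[OF W(1)[of n] W(1)[of m]] that by (simp add: min_absorb1)
    have "(norm (g (W m) t - g (W n) t))\<^sup>2 = 2 * (norm (g (W m) t))\<^sup>2 + 2 * (norm (g (W n) t))\<^sup>2 - 4 * (norm (g ?mid t))\<^sup>2" for t
    proof -
      have "g ?mid t = (1 / 2) *\<^sub>R (g (W n) t + g (W m) t)"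
        unfolding g_def by (rule averaging_midpoint(2)[OF W(1)[of n] W(1)[of m]])
      then show ?thesis
        by (simp add: power_divide add_divide_distrib power2_norm_eq_inner inner_add_left inner_add_right inner_diff_left inner_diff_right inner_commute)
    qed
    then have "(LINT t|M. (norm (g (W m) t - g (W n) t))\<^sup>2) = 2 * q (W m) + 2 * q (W n) - 4 * q ?mid"
      using gd(3)[OF W(1) W(1)] gd(3)[OF av av] by (simp add: q_def)
    also have "\<dots> \<le> 2 * (d m + inverse (real (Suc m))) + 2 * (d n + inverse (real (Suc n))) - 4 * d n"
      by (intro diff_mono add_mono mult_left_mono less_imp_le[OF W(2)] d_le[OF av]) simp_all
    also have "\<dots> \<le> \<eta> n"
    proof -
      have "inverse (real (Suc m)) \<le> inverse (real (Suc n))" using that by simp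
      then show ?thesis using D(2)[of m] unfolding \<eta>_def by argo
    qed
    finally show ?thesis .
  qed
  have "\<exists>n0. \<forall>n\<ge>n0. \<eta> n < (1 / 4) ^ i" for i :: nat
    using LIMSEQ_D[OF \<eta>, of "(1 / 4) ^ i"] by fastforce
  then obtain R where R: "\<And>i n. R i \<le> n \<Longrightarrow> \<eta> n < (1 / 4) ^ i" by metis
  \<comment> \<open>Summing the thresholds makes the indices monotone while keeping each at least
    \<open>R i\<close> and at least \<open>i\<close>.\<close>
  define r where "r i = i + (\<Sum>k\<le>i. R k)" for i
  have r: "i \<le> r i" "R i \<le> r i" "r i \<le> r (Suc i)" for i
    using member_le_sum[of i "{..i}" R] by (auto simp: r_def)
  have L1: "(LINT t|M. norm (g (W (r (Suc i))) t - g (W (r i)) t)) \<le> (measure M (space M) + 1) * (1 / 2) ^ i" for i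
  proof -
    let ?\<delta> = "(1 / 2) ^ i :: real"
    let ?u = "\<lambda>t. g (W (r (Suc i))) t - g (W (r i)) t"
    \<comment> \<open>The squared distance is below \<open>(1 / 4) ^ i\<close>; splitting at its
      root \<open>(1 / 2) ^ i\<close> balances both terms.\<close>
    have "(LINT t|M. norm (?u t)) \<le> (LINT t|M. ?\<delta> + (norm (?u t))\<^sup>2 / ?\<delta>)"
    proof (rule integral_mono)
      show "integrable M (\<lambda>t. norm (?u t))" by (intro integrable_norm gd(2)[OF W(1) W(1)])
      show "integrable M (\<lambda>t. ?\<delta> + (norm (?u t))\<^sup>2 / ?\<delta>)"
        by (intro Bochner_Integration.integrable_add integrable_divide gd(1)[OF W(1) W(1)] integrable_const)
    qed (rule norm_le_delta, simp)
    also have "\<dots> = measure M (space M) * ?\<delta> + (LINT t|M. (norm (?u t))\<^sup>2) / ?\<delta>"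
      using gd(1)[OF W(1) W(1)] by simp
    also have "\<dots> \<le> measure M (space M) * ?\<delta> + (1 / 4) ^ i / ?\<delta>"
      by (intro add_left_mono divide_right_mono order_trans[OF close[OF r(3)] less_imp_le[OF R[OF r(2)]]]) simp
    also have "(1 / 4) ^ i / ?\<delta> = ?\<delta>"
      by (simp add: power_divide power_mult_distrib[symmetric] field_simps)
    finally show ?thesis by (simp add: algebra_simps)
  qed
  have "AE t in M. convergent (\<lambda>i. g (W (r i)) t)"
  proof (rule AE_convergent_if_summable_L1_increments)
    show "integrable M (\<lambda>t. g (W (r (Suc i))) t - g (W (r i)) t)" for i by (rule gd(2)[OF W(1) W(1)])
    show "summable (\<lambda>i. LINT t|M. norm (g (W (r (Suc i))) t - g (W (r i)) t))"
    proof (rule summable_comparison_test')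
      show "summable (\<lambda>i. (measure M (space M) + 1) * (1 / 2) ^ i)"
        by (intro summable_mult summable_geometric) simp
      show "norm (LINT t|M. norm (g (W (r (Suc i))) t - g (W (r i)) t)) \<le> (measure M (space M) + 1) * (1 / 2) ^ i" if "0 \<le> i" for i
        using L1[of i] by simp
    qed
  qed
  then show ?thesis
    by (intro that[of "\<lambda>i. W (r i)"] averaging_mono[OF W(1) r(1)]) (simp add: g_def)
qed

section \<open>Limits of trajectories\<close>

text \<open>A finite measure on the half-line with the same null sets as Lebesgue measure: one
  choice of averages then serves all times simultaneously.\<close>

lemma finite_measure_exp_density:
  "finite_measure (density (lebesgue_on {0..}) (\<lambda>t. ennreal (exp (- t))))"
proof (rule finite_measureI)
  let ?M = "lebesgue_on {0::real..}" and ?h = "\<lambda>t::real. ennreal (exp (- t))"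
  have "(\<lambda>t::real. exp (- t)) absolutely_integrable_on {0..}"
    using integrable_on_exp_minus_to_infinity[of 1 0] by (intro nonnegative_absolutely_integrable_1) auto
  then have "integrable ?M (\<lambda>t. exp (- t))"
    by (rule absolutely_integrable_imp_integrable) simp
  then have fin: "(\<integral>\<^sup>+t. ?h t \<partial>?M) = ennreal (LINT t|?M. exp (- t))"
    by (intro nn_integral_eq_integral) auto
  have "?h \<in> borel_measurable ?M"
    by (intro measurable_restrict_space1 measurable_completion) simp
  then have "emeasure (density ?M ?h) (space ?M) = (\<integral>\<^sup>+t. ?h t * indicator (space ?M) t \<partial>?M)"
    by (rule emeasure_density) (rule sets.top)
  also have "\<dots> = (\<integral>\<^sup>+t. ?h t \<partial>?M)"
    by (rule nn_integral_cong) auto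
  finally show "emeasure (density ?M ?h) (space (density ?M ?h)) \<noteq> \<infinity>" using fin by simp
qed

lemma avg_matrix_vector_mult:
  fixes a :: "nat \<Rightarrow> real^'n^'n"
  shows "avg w a *v x = avg w (\<lambda>j. a j *v x)"
  unfolding avg_def bounded_bilinear.sum_left[OF bounded_bilinear_matrix_vector_mult]
  by (simp add: scaleR_matrix_vector_assoc)

lemma control_averages_convergent:
  fixes \<A> :: "(real^'n^'n) set"
  assumes comp: "compact \<A>" and A: "\<And>n. control_function \<A> (A n)"
  obtains w B N where "\<And>i. averaging i (w i)" "control_function (convex hull \<A>) B" "negligible N"
    "\<And>t. 0 \<le> t \<Longrightarrow> t \<notin> N \<Longrightarrow> (\<lambda>i. avg (w i) (\<lambda>j. A j t)) \<longlonglongrightarrow> B t"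
proof -
  let ?h = "\<lambda>t::real. ennreal (exp (- t))"
  let ?M = "density (lebesgue_on {0..}) ?h"
  interpret finite_measure ?M by (rule finite_measure_exp_density)
  have h: "?h \<in> borel_measurable (lebesgue_on {0..})"
    by (intro measurable_restrict_space1 measurable_completion) simp
  have Am: "A n \<in> borel_measurable (lebesgue_on {0..})" and AA: "0 \<le> t \<Longrightarrow> A n t \<in> \<A>" for n t
    using A by (auto simp: control_function_def)
  obtain C where C: "\<And>A. A \<in> \<A> \<Longrightarrow> norm A \<le> C"
    using compact_imp_bounded[OF comp] unfolding bounded_iff by blast
  have m: "A n \<in> borel_measurable ?M" for n using Am by simp
  have b: "norm (A n t) \<le> C" if "t \<in> space ?M" for n t
    using that by (intro C AA) (simp add: space_restrict_space)
  obtain w where w: "\<And>i::nat. averaging i (w i)" "AE t in ?M. convergent (\<lambda>i. avg (w i) (\<lambda>j. A j t))"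
    by (rule averages_AE_convergent[of A, OF m b]) blast+
  have "AE t in lebesgue_on {0..}. convergent (\<lambda>i. avg (w i) (\<lambda>j. A j t))"
    using w(2) unfolding AE_density[OF h] by simp
  then have "AE t in lebesgue. t \<in> {0..} \<longrightarrow> convergent (\<lambda>i. avg (w i) (\<lambda>j. A j t))"
    by (subst (asm) AE_restrict_space_iff) auto
  then obtain N where N: "negligible N" "{t. \<not> (t \<in> {0..} \<longrightarrow> convergent (\<lambda>i. avg (w i) (\<lambda>j. A j t)))} \<subseteq> N"
    unfolding eventually_ae_filter_negligible by blast
  define l where "l t = lim (\<lambda>i. avg (w i) (\<lambda>j. A j t))" for t
  \<comment> \<open>Where the limit is missing or \<open>lim\<close> returns a value outside the
    hull, an arbitrary admissible matrix is inserted, since a control must take its values in the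
    hull at every time.\<close>
  define B where "B t = (if l t \<in> convex hull \<A> then l t else A 0 0)" for t
  have lm: "l \<in> borel_measurable (lebesgue_on {0..})"
    unfolding l_def avg_def
    by (intro borel_measurable_lim_metric borel_measurable_sum borel_measurable_scaleR Am) auto
  have "closed (convex hull \<A>)" using comp by (intro compact_imp_closed compact_convex_hull)
  then have "l -` (convex hull \<A>) \<inter> space (lebesgue_on {0..}) \<in> sets (lebesgue_on {0..})"
    by (intro measurable_sets[OF lm] borel_closed)
  moreover have "l -` (convex hull \<A>) \<inter> space (lebesgue_on {0..}) = {t \<in> space (lebesgue_on {0..}). l t \<in> convex hull \<A>}"
    by blast
  ultimately have "B \<in> borel_measurable (lebesgue_on {0..})"
    unfolding B_def by (intro measurable_If lm) auto
  moreover have "B t \<in> convex hull \<A>" for t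
    unfolding B_def using hull_inc[OF AA[of 0 0]] by auto
  ultimately have "control_function (convex hull \<A>) B" by (simp add: control_function_def)
  moreover have "(\<lambda>i. avg (w i) (\<lambda>j. A j t)) \<longlonglongrightarrow> B t" if t: "0 \<le> t" "t \<notin> N" for t
  proof -
    have lim: "(\<lambda>i. avg (w i) (\<lambda>j. A j t)) \<longlonglongrightarrow> l t"
      using N(2) t unfolding l_def convergent_LIMSEQ_iff[symmetric] by auto
    have "avg (w i) (\<lambda>j. A j t) \<in> convex hull \<A>" for i
      by (rule avg_mem_convex[OF w(1)]) (auto intro!: hull_inc AA t)
    then have "l t \<in> convex hull \<A>"
      using closed_sequentially[OF _ _ lim] comp by (metis compact_convex_hull compact_imp_closed)
    then show ?thesis using lim by (simp add: B_def)
  qed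
  ultimately show ?thesis using that[OF w(1) _ N(1)] by blast
qed

text \<open>A diagonal choice gives convergence at the nonnegative rational times, and the common
  Lipschitz bounds carry it to all nonnegative times.\<close>

lemma locally_lipschitz_subsequence:
  fixes x :: "nat \<Rightarrow> real \<Rightarrow> 'b::euclidean_space"
  assumes bound: "\<And>n t. 0 \<le> t \<Longrightarrow> norm (x n t) \<le> R * exp (L * t)"
    and lip: "\<And>n s t T. 0 \<le> s \<Longrightarrow> s \<le> t \<Longrightarrow> t \<le> T \<Longrightarrow> norm (x n t - x n s) \<le> C T * (t - s)"
  obtains k y where "strict_mono (k :: nat \<Rightarrow> nat)" "\<And>t. 0 \<le> t \<Longrightarrow> (\<lambda>n. x (k n) t) \<longlonglongrightarrow> y t"
proof -
  \<comment> \<open>Rescaling makes the bound independent of time, as the diagonal argument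
    demands.\<close>
  have "norm (exp (- L * q) *\<^sub>R x n q) \<le> R" if "q \<in> \<rat> \<inter> {0..}" for n q
    using bound[of q n] that by (simp add: exp_minus field_simps)
  then obtain k where k: "strict_mono k" "\<And>q. q \<in> \<rat> \<inter> {0..} \<Longrightarrow> \<exists>l. (\<lambda>n. exp (- L * q) *\<^sub>R x (k n) q) \<longlonglongrightarrow> l"
    by (rule function_convergent_subsequence[of "\<rat> \<inter> {0..}" "\<lambda>n q. exp (- L * q) *\<^sub>R x n q" R, OF countable_Int1[OF countable_rat]]) blast+
  have q: "convergent (\<lambda>n. x (k n) q)" if "q \<in> \<rat>" "0 \<le> q" for q
  proof -
    from that have "q \<in> \<rat> \<inter> {0..}" by auto
    from k(2)[OF this] obtain l where "(\<lambda>n. exp (- L * q) *\<^sub>R x (k n) q) \<longlonglongrightarrow> l" by blast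
    then have "(\<lambda>n. exp (L * q) *\<^sub>R exp (- L * q) *\<^sub>R x (k n) q) \<longlonglongrightarrow> exp (L * q) *\<^sub>R l" by (intro tendsto_intros)
    then show ?thesis by (auto simp: exp_minus intro: convergentI)
  qed
  have "convergent (\<lambda>n. x (k n) t)" if t: "0 \<le> t" for t
    unfolding Cauchy_convergent_iff[symmetric]
  proof (rule metric_CauchyI)
    fix \<epsilon> :: real assume \<epsilon>: "0 < \<epsilon>"
    \<comment> \<open>\<open>C\<close> carries no sign, so a positive majorant is taken; the
      argument \<open>t + 1\<close> suffices because \<open>q\<close> is chosen within distance 1 of
      \<open>t\<close>.\<close>
    define C' where "C' = \<bar>C (t + 1)\<bar> + 1"
    have C': "0 < C'" by (simp add: C'_def)
    have "t < t + min 1 (\<epsilon> / (3 * C'))" using \<epsilon> C' by simp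
    then obtain q where "q \<in> \<rat>" and tq: "t < q" "q < t + min 1 (\<epsilon> / (3 * C'))" using Rats_dense_in_real by blast
    then have "Cauchy (\<lambda>n. x (k n) q)" using q t by (simp add: Cauchy_convergent_iff)
    then obtain N where N: "\<And>m n. N \<le> m \<Longrightarrow> N \<le> n \<Longrightarrow> dist (x (k m) q) (x (k n) q) < \<epsilon> / 3"
      using \<epsilon> metric_CauchyD[of "\<lambda>n. x (k n) q" "\<epsilon> / 3"] by auto
    have near: "dist (x (k n) q) (x (k n) t) < \<epsilon> / 3" for n
    proof -
      have "norm (x (k n) q - x (k n) t) \<le> C (t + 1) * (q - t)" using lip[of t q "t + 1"] t tq by auto
      also have "\<dots> \<le> C' * (q - t)" using tq by (intro mult_right_mono) (auto simp: C'_def)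
      also have "\<dots> < C' * (\<epsilon> / (3 * C'))" using tq C' by (intro mult_strict_left_mono) auto
      also have "\<dots> = \<epsilon> / 3" using C' by simp
      finally show ?thesis by (simp add: dist_norm)
    qed
    have "dist (x (k m) t) (x (k n) t) < \<epsilon>" if "N \<le> m" "N \<le> n" for m n
      using N[OF that] near[of m] near[of n]
        dist_triangle[of "x (k m) t" "x (k n) t" "x (k m) q"] dist_triangle[of "x (k m) q" "x (k n) t" "x (k n) q"]
      by (simp add: dist_commute)
    then show "\<exists>M. \<forall>m\<ge>M. \<forall>n\<ge>M. dist (x (k m) t) (x (k n) t) < \<epsilon>" by blast
  qed
  then show ?thesis using that[OF k(1), of "\<lambda>t. lim (\<lambda>n. x (k n) t)"] by (simp add: convergent_LIMSEQ_iff)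
qed

text \<open>The equation contains a product in which states converge pointwise but controls only
  after averaging. Replacing the state by its limit costs a null sequence; what remains is linear in
  the control and can be averaged, which puts the limit control into the convex hull.\<close>

lemma trajectories_subsequence:
  fixes \<A> :: "(real^'n^'n) set"
  assumes comp: "compact \<A>" and A: "\<And>n. control_function \<A> (A n)"
    and x: "\<And>n. solves_linear_ode (A n) (x n)" and R: "\<And>n. norm (x n 0) \<le> R"
  shows "\<exists>k B y. strict_mono (k :: nat \<Rightarrow> nat) \<and> control_function (convex hull \<A>) B \<and>
    solves_linear_ode B y \<and> (\<forall>t\<ge>0. (\<lambda>n. x (k n) t) \<longlonglongrightarrow> y t)"
proof -
  obtain L where L: "0 < L" "\<And>A. control_function \<A> A \<Longrightarrow> bounded_control L A" "\<And>A x. A \<in> \<A> \<Longrightarrow> norm (A *v x) \<le> L * norm x"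
    using exists_bounded_control[OF compact_imp_bounded[OF comp]] by metis
  note bA = L(2)[OF A]
  have R0: "0 \<le> R" using R[of 0] norm_ge_zero order_trans by blast
  have bound: "norm (x n t) \<le> R * exp (L * t)" if "0 \<le> t" for n t
    by (rule order_trans[OF solves_norm_le[OF bA x that]]) (simp add: R)
  have lip: "norm (x n t - x n s) \<le> (L * R * exp (L * T)) * (t - s)" if "0 \<le> s" "s \<le> t" "t \<le> T" for n s t T
    by (rule order_trans[OF solves_lipschitz[OF bA x that]]) (use R L that in \<open>auto intro!: mult_right_mono mult_left_mono\<close>)
  obtain k y where k: "strict_mono k" and y: "\<And>t. 0 \<le> t \<Longrightarrow> (\<lambda>n. x (k n) t) \<longlonglongrightarrow> y t"
    using locally_lipschitz_subsequence[of x R L "\<lambda>T. L * R * exp (L * T)", OF bound lip] by blast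
  obtain w B N where w: "\<And>i. averaging i (w i)" and B: "control_function (convex hull \<A>) B" and N: "negligible N"
    and lim: "\<And>t. 0 \<le> t \<Longrightarrow> t \<notin> N \<Longrightarrow> (\<lambda>i. avg (w i) (\<lambda>j. A (k j) t)) \<longlonglongrightarrow> B t"
    using control_averages_convergent[OF comp, of "\<lambda>j. A (k j)"] A by blast
  obtain L' where L': "bounded_control L' B"
    using exists_bounded_control[OF bounded_convex_hull[OF compact_imp_bounded[OF comp]]] B by metis
  have ylip: "norm (y t - y s) \<le> (L * R * exp (L * T)) * (t - s)" if "0 \<le> s" "s \<le> t" "t \<le> T" for s t T
    by (rule LIMSEQ_le_const2[where X = "\<lambda>n. norm (x (k n) t - x (k n) s)"])
       (use that lip in \<open>auto intro!: tendsto_intros y\<close>)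
  have ycont: "continuous_on {0..T} y" for T
  proof (rule lipschitz_on_continuous_on[OF lipschitz_onI])
    show "0 \<le> L * R * exp (L * T)" using L R0 by simp
    show "dist (y s) (y t) \<le> L * R * exp (L * T) * dist s t" if "s \<in> {0..T}" "t \<in> {0..T}" for s t
      using ylip[of s t T] ylip[of t s T] that by (cases "s \<le> t") (auto simp: dist_norm norm_minus_commute abs_if)
  qed
  have "solves_linear_ode B y"
  proof (rule solvesI[OF L' ycont])
    fix t :: real assume t: "0 \<le> t"
    \<comment> \<open>The cost of this replacement. It tends to zero before averaging, hence also
      after it.\<close>
    define d where "d j = integral {0..t} (\<lambda>s. A (k j) s *v (x (k j) s - y s))" for j
    have xc: "continuous_on {0..t} (x (k j))" for j by (rule solves_continuous[OF x])
    have yb: "norm (y s) \<le> R * exp (L * t)" if "s \<in> {0..t}" for s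
    proof (rule LIMSEQ_le_const2[OF tendsto_norm[OF y]])
      show "\<exists>N. \<forall>n\<ge>N. norm (x (k n) s) \<le> R * exp (L * t)"
        using bound[of s] that L R0 by (intro exI allI impI order_trans[OF bound]) (auto intro!: mult_left_mono)
    qed (use that in auto)
    have xb: "norm (x (k j) s) \<le> R * exp (L * t)" if "s \<in> {0..t}" for s j
      using that L R0 by (intro order_trans[OF bound]) (auto intro!: mult_left_mono)
    have "(\<lambda>j. integral {0..t} (\<lambda>s. norm (x (k j) s - y s))) \<longlonglongrightarrow> integral {0..t} (\<lambda>s. 0)"
    proof (rule dominated_convergence(2)[where h = "\<lambda>_. 2 * (R * exp (L * t))"])
      show "(\<lambda>s. norm (x (k j) s - y s)) integrable_on {0..t}" for j
        by (intro integrable_continuous_interval continuous_intros xc ycont)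
      show "norm (norm (x (k j) s - y s)) \<le> 2 * (R * exp (L * t))" if "s \<in> {0..t}" for s j
        using norm_triangle_ineq4[of "x (k j) s" "y s"] xb[OF that, of j] yb[OF that] by simp
      show "(\<lambda>j. norm (x (k j) s - y s)) \<longlonglongrightarrow> 0" if "s \<in> {0..t}" for s
        using y[of s] that by (intro tendsto_norm_zero) (simp add: LIM_zero)
    qed auto
    then have "(\<lambda>j. L * integral {0..t} (\<lambda>s. norm (x (k j) s - y s))) \<longlonglongrightarrow> L * 0"
      by (intro tendsto_mult tendsto_const) simp
    then have lim0: "(\<lambda>j. L * integral {0..t} (\<lambda>s. norm (x (k j) s - y s))) \<longlonglongrightarrow> 0" by simp
    have "norm (d j) \<le> L * integral {0..t} (\<lambda>s. norm (x (k j) s - y s))" for j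
      unfolding d_def by (rule integral_control_norm_le[OF bA continuous_on_diff[OF xc ycont] order_refl])
    then have d0: "d \<longlonglongrightarrow> 0"
      by (intro Lim_null_comparison[OF _ lim0] always_eventually) blast
    have eq: "avg (w i) (\<lambda>j. x (k j) t) = avg (w i) (\<lambda>j. x (k j) 0) + 
        integral {0..t} (\<lambda>s. avg (w i) (\<lambda>j. A (k j) s) *v y s) + avg (w i) d" for i
    proof -
      have fin: "finite {j. w i j \<noteq> 0}" using w by (auto simp: averaging_def)
      have int: "(\<lambda>s. A (k j) s *v y s) integrable_on {0..t}" for j
        by (rule control_integrable'[OF bA ycont order_refl])
      have "x (k j) t = x (k j) 0 + integral {0..t} (\<lambda>s. A (k j) s *v y s) + d j" for j
        unfolding d_def matrix_vector_mult_diff_distrib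
        using solves_eq[OF x t, of "k j"] integral_diff[OF control_integrable'[OF bA xc order_refl] int, of "k j" j j] by simp
      then have "avg (w i) (\<lambda>j. x (k j) t) = avg (w i) (\<lambda>j. x (k j) 0) + avg (w i) (\<lambda>j. integral {0..t} (\<lambda>s. A (k j) s *v y s)) + avg (w i) d"
        unfolding avg_add by simp
      also have "avg (w i) (\<lambda>j. integral {0..t} (\<lambda>s. A (k j) s *v y s)) = integral {0..t} (\<lambda>s. \<Sum>j | w i j \<noteq> 0. w i j *\<^sub>R (A (k j) s *v y s))"
        unfolding avg_def using fin by (subst integral_sum) (auto intro!: integrable_cmul int)
      also have "(\<lambda>s. \<Sum>j | w i j \<noteq> 0. w i j *\<^sub>R (A (k j) s *v y s)) = (\<lambda>s. avg (w i) (\<lambda>j. A (k j) s) *v y s)"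
        unfolding avg_matrix_vector_mult by (simp add: avg_def)
      finally show ?thesis .
    qed
    have "(\<lambda>i. integral {0..t} (\<lambda>s. avg (w i) (\<lambda>j. A (k j) s) *v y s)) \<longlonglongrightarrow> integral {0..t} (\<lambda>s. B s *v y s)"
    proof -
      let ?g = "\<lambda>i s. avg (w i) (\<lambda>j. A (k j) s) *v y s"
      have gint: "?g i integrable_on {0..t}" for i
      proof -
        have "?g i = (\<lambda>s. \<Sum>j | w i j \<noteq> 0. w i j *\<^sub>R (A (k j) s *v y s))"
          unfolding avg_matrix_vector_mult by (simp add: avg_def)
        then show ?thesis using w[of i]
          by (auto simp: averaging_def intro!: integrable_sum integrable_cmul control_integrable'[OF bA ycont])
      qed
      \<comment> \<open>Both sides are set to zero on the exceptional null set, so that convergence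
        holds at every time.\<close>
      have "(\<lambda>i. integral {0..t} (\<lambda>s. if s \<in> N then 0 else ?g i s)) \<longlonglongrightarrow> integral {0..t} (\<lambda>s. if s \<in> N then 0 else B s *v y s)"
      proof (rule dominated_convergence(2)[where h = "\<lambda>_. L * (R * exp (L * t))"])
        show "(\<lambda>s. if s \<in> N then 0 else ?g i s) integrable_on {0..t}" for i
          by (rule integrable_spike[OF gint N]) auto
        show "norm (if s \<in> N then 0 else ?g i s) \<le> L * (R * exp (L * t))" if s: "s \<in> {0..t}" for i s
        proof -
          have "avg (w i) (\<lambda>j. A (k j) s) *v y s = avg (w i) (\<lambda>j. A (k j) s *v y s)"
            by (rule avg_matrix_vector_mult)
          also have "norm \<dots> \<le> L * (R * exp (L * t))"
          proof (rule averaging_norm_le[OF w])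
            show "norm (A (k j) s *v y s) \<le> L * (R * exp (L * t))" for j
              by (rule order_trans[OF bounded_control_norm_le[OF bA]]) (use s L yb[OF s] in auto)
          qed
          finally show ?thesis using L R0 by auto
        qed
        show "(\<lambda>i. if s \<in> N then 0 else ?g i s) \<longlonglongrightarrow> (if s \<in> N then 0 else B s *v y s)" if "s \<in> {0..t}" for s
          using lim[of s] that
          by (auto intro!: bounded_bilinear.tendsto[OF bounded_bilinear_matrix_vector_mult])
      qed auto
      moreover have "integral {0..t} (\<lambda>s. if s \<in> N then 0 else ?g i s) = integral {0..t} (?g i)" for i
        by (rule integral_spike[OF N]) auto
      moreover have "integral {0..t} (\<lambda>s. if s \<in> N then 0 else B s *v y s) = integral {0..t} (\<lambda>s. B s *v y s)"
        by (rule integral_spike[OF N]) auto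
      ultimately show ?thesis by simp
    qed
    then have "(\<lambda>i. avg (w i) (\<lambda>j. x (k j) t)) \<longlonglongrightarrow> y 0 + integral {0..t} (\<lambda>s. B s *v y s) + 0"
      unfolding eq by (intro tendsto_add averages_tendsto[OF w] y d0) auto
    moreover have "(\<lambda>i. avg (w i) (\<lambda>j. x (k j) t)) \<longlonglongrightarrow> y t"
      by (intro averages_tendsto[OF w] y t)
    ultimately show "y t = y 0 + integral {0..t} (\<lambda>s. B s *v y s)"
      using LIMSEQ_unique by fastforce
  qed
  then show ?thesis using k B y by blast
qed

section \<open>Strict positivity of irreducible flows\<close>

text \<open>The function vanishes almost everywhere, and an open interval is not negligible; so a
  zero exists strictly inside.\<close>

lemma exists_zero_if_integral_nonpos:
  fixes f :: "real \<Rightarrow> real"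
  assumes T: "0 < T" and f: "f absolutely_integrable_on {0..T}"
    and nonneg: "\<And>t. t \<in> {0..T} \<Longrightarrow> 0 \<le> f t" and le: "integral {0..T} f \<le> 0"
  shows "\<exists>t\<in>{0<..<T}. f t = 0"
proof (rule ccontr)
  assume *: "\<not> (\<exists>t\<in>{0<..<T}. f t = 0)"
  have i: "integrable (lebesgue_on {0..T}) f" by (rule absolutely_integrable_imp_integrable[OF f]) simp
  have "0 \<le> integral {0..T} f"
    using f nonneg by (intro Henstock_Kurzweil_Integration.integral_nonneg set_lebesgue_integral_eq_integral(1)) auto
  then have "integral\<^sup>L (lebesgue_on {0..T}) f = 0"
    using le lebesgue_integral_eq_integral[OF i] by simp
  moreover have "AE t in lebesgue_on {0..T}. 0 \<le> f t"
    using nonneg by (intro AE_I2) simp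
  ultimately have "AE t in lebesgue_on {0..T}. f t = 0"
    using integral_nonneg_eq_0_iff_AE[OF i] by simp
  then have "AE t in lebesgue. t \<in> {0..T} \<longrightarrow> f t = 0"
    by (subst (asm) AE_restrict_space_iff) auto
  then obtain N where N: "negligible N" "{t. \<not> (t \<in> {0..T} \<longrightarrow> f t = 0)} \<subseteq> N"
    unfolding eventually_ae_filter_negligible by blast
  have "box 0 T \<subseteq> N" using N(2) * by (auto simp: subset_iff)
  then have "negligible (box 0 T)" using negligible_subset[OF N(1)] by blast
  then show False unfolding negligible_interval using T by simp
qed

lemma shift_control_shift: "shift_control t (shift_control s A) = shift_control (s + t) A"
  by (simp add: shift_control_def fun_eq_iff add.assoc)

lemma shift_control_0 [simp]: "shift_control 0 A = A"
  by (simp add: shift_control_def fun_eq_iff)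

context proper_cone
begin

text \<open>If the functional vanished on all images of the face, then
  \<open>x + h *\<^sub>R (A *v x)\<close> would stay in the face for \<open>x\<close> in it, and the
  face plane would be invariant. So irreducibility means that every nontrivial face is left to first
  order.\<close>

lemma irreducible_onD:
  assumes irr: "irreducible_on K A" and Metz: "Metzler_on K A"
    and w: "w \<noteq> 0" "\<And>z. z \<in> K \<Longrightarrow> 0 \<le> w \<bullet> z" and y: "y \<in> K" "y \<noteq> 0" "w \<bullet> y = 0"
  shows "\<exists>z\<in>K. w \<bullet> z = 0 \<and> w \<bullet> (A *v z) \<noteq> 0"
proof (rule ccontr)
  assume neg: "\<not> ?thesis"
  define F where "F = K \<inter> {x. w \<bullet> x = 0}"
  have face: "cone_face K F" using w unfolding cone_face_def F_def by blast
  have F0: "F \<noteq> {0}" using y by (auto simp: F_def)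
  obtain h where h: "0 < h" "\<And>x. x \<in> K \<Longrightarrow> x + h *\<^sub>R (A *v x) \<in> K"
    using Metz unfolding Metzler_on_def by blast
  have AF: "A *v x \<in> span F" if x: "x \<in> F" for x
  proof -
    have "x + h *\<^sub>R (A *v x) \<in> F"
      using x h(2)[of x] neg by (auto simp: F_def inner_add_right)
    then have "(x + h *\<^sub>R (A *v x)) - x \<in> span F" by (intro span_diff span_base x)
    then have "(1 / h) *\<^sub>R ((x + h *\<^sub>R (A *v x)) - x) \<in> span F" by (rule span_scale)
    then show ?thesis using h(1) by simp
  qed
  have "A *v x \<in> span F" if "x \<in> span F" for x
  proof -
    have "(*v) A ` span F = span ((*v) A ` F)"
      by (rule linear_span_image[symmetric]) (rule matrix_vector_mul_linear)
    also have "\<dots> \<subseteq> span F" by (rule span_minimal) (use AF in auto)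
    finally show ?thesis using that by auto
  qed
  with irr face F0 show False unfolding irreducible_on_def by blast
qed

text \<open>A vector of the face whose image leaves the supporting hyperplane rules out an invariant
  face plane. In this form irreducibility can be checked for convex combinations.\<close>

lemma irreducible_onI:
  assumes "\<And>w y. w \<noteq> 0 \<Longrightarrow> (\<And>z. z \<in> K \<Longrightarrow> 0 \<le> w \<bullet> z) \<Longrightarrow> y \<in> K \<Longrightarrow> y \<noteq> 0 \<Longrightarrow> w \<bullet> y = 0 \<Longrightarrow>
    \<exists>z\<in>K. w \<bullet> z = 0 \<and> w \<bullet> (A *v z) \<noteq> 0"
  shows "irreducible_on K A"
  unfolding irreducible_on_def
proof (intro allI impI notI, elim conjE)
  fix F assume F: "cone_face K F" "F \<noteq> {0}" and inv: "\<forall>x\<in>span F. A *v x \<in> span F"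
  obtain w where w: "w \<noteq> 0" "\<And>z. z \<in> K \<Longrightarrow> 0 \<le> w \<bullet> z" "F = K \<inter> {x. w \<bullet> x = 0}"
    using F(1) unfolding cone_face_def by blast
  have "0 \<in> F" using zero_K w(3) by simp
  then obtain y where "y \<in> F" "y \<noteq> 0" using F(2) by blast
  with assms[OF w(1,2), of y] w(3) obtain z where z: "z \<in> F" "w \<bullet> (A *v z) \<noteq> 0" by blast
  have "span F \<subseteq> {x. w \<bullet> x = 0}" using w(3) by (intro span_minimal subspace_hyperplane) auto
  moreover have "A *v z \<in> span F" using inv z(1) span_base by blast
  ultimately show False using z(2) by blast
qed

lemma Metzler_inner_nonneg:
  assumes "Metzler_on K A" "\<And>z. z \<in> K \<Longrightarrow> 0 \<le> w \<bullet> z" "z \<in> K" "w \<bullet> z = 0"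
  shows "0 \<le> w \<bullet> (A *v z)"
proof -
  obtain h where h: "0 < h" "z + h *\<^sub>R (A *v z) \<in> K"
    using assms(1,3) unfolding Metzler_on_def by blast
  from assms(2)[OF h(2)] assms(4) h(1) show ?thesis by (simp add: inner_add_right zero_le_mult_iff)
qed

lemma convex_Metzler: "convex {A. Metzler_on K A}"
proof (rule convexI)
  fix A B and a b :: real assume "A \<in> {A. Metzler_on K A}" "B \<in> {A. Metzler_on K A}" and ab: "0 \<le> a" "0 \<le> b" "a + b = 1"
  then obtain h k where h: "0 < h" "\<And>x. x \<in> K \<Longrightarrow> x + h *\<^sub>R (A *v x) \<in> K" and k: "0 < k" "\<And>x. x \<in> K \<Longrightarrow> x + k *\<^sub>R (B *v x) \<in> K"
    unfolding Metzler_on_def by blast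
  \<comment> \<open>A Metzler step may be shortened, by convexity of \<open>K\<close>, so two
    operators can share the smaller step.\<close>
  have shrink: "x + m *\<^sub>R (C *v x) \<in> K" if "x \<in> K" "x + h *\<^sub>R (C *v x) \<in> K" "0 < m" "m \<le> h" for m h and C :: "real^'n^'n" and x
  proof -
    have "(1 - m / h) *\<^sub>R x + (m / h) *\<^sub>R (x + h *\<^sub>R (C *v x)) \<in> K"
      by (rule add_K[OF scale_K scale_K]) (use that in auto)
    moreover have "(1 - m / h) *\<^sub>R x + (m / h) *\<^sub>R (x + h *\<^sub>R (C *v x)) = x + m *\<^sub>R (C *v x)"
      using that by (simp add: scaleR_add_right scaleR_left_diff_distrib)
    ultimately show ?thesis by simp
  qed
  define m where "m = min h k"
  have m: "0 < m" "m \<le> h" "m \<le> k" using h k by (auto simp: m_def)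
  have "x + m *\<^sub>R ((a *\<^sub>R A + b *\<^sub>R B) *v x) \<in> K" if x: "x \<in> K" for x
  proof -
    have "a *\<^sub>R (x + m *\<^sub>R (A *v x)) + b *\<^sub>R (x + m *\<^sub>R (B *v x)) \<in> K"
      by (intro add_K scale_K ab shrink[OF x h(2)[OF x] m(1,2)] shrink[OF x k(2)[OF x] m(1,3)])
    also have "a *\<^sub>R (x + m *\<^sub>R (A *v x)) + b *\<^sub>R (x + m *\<^sub>R (B *v x)) = (a + b) *\<^sub>R x + m *\<^sub>R ((a *\<^sub>R A + b *\<^sub>R B) *v x)"
      by (simp add: algebra_simps scaleR_matrix_vector_assoc[symmetric])
    finally show ?thesis using ab by simp
  qed
  with m show "a *\<^sub>R A + b *\<^sub>R B \<in> {A. Metzler_on K A}" unfolding Metzler_on_def by blast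
qed

text \<open>On a face the supporting functional is nonnegative at the images under Metzler
  operators. Contributions to a convex combination therefore cannot cancel, and one irreducible
  operator with positive weight suffices.\<close>

lemma convex_irreducible_Metzler: "convex {A. Metzler_on K A \<and> irreducible_on K A}"
proof (rule convexI)
  fix A B and a b :: real
  assume AB: "A \<in> {A. Metzler_on K A \<and> irreducible_on K A}" "B \<in> {A. Metzler_on K A \<and> irreducible_on K A}"
    and ab: "0 \<le> a" "0 \<le> b" "a + b = 1"
  have "irreducible_on K (a *\<^sub>R A + b *\<^sub>R B)"
  proof (rule irreducible_onI)
    fix w y assume w: "w \<noteq> 0" "\<And>z. z \<in> K \<Longrightarrow> 0 \<le> w \<bullet> z" and y: "y \<in> K" "y \<noteq> 0" "w \<bullet> y = 0"
    have *: "\<exists>z\<in>K. w \<bullet> z = 0 \<and> w \<bullet> ((a *\<^sub>R A + b *\<^sub>R B) *v z) \<noteq> 0"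
      if A: "Metzler_on K A" "irreducible_on K A" and B: "Metzler_on K B" and ab: "0 < a" "0 \<le> b" for A B and a b :: real
    proof -
      obtain z where z: "z \<in> K" "w \<bullet> z = 0" "w \<bullet> (A *v z) \<noteq> 0" using irreducible_onD[OF A(2,1) w y] by blast
      then have "0 < a * (w \<bullet> (A *v z))" "0 \<le> b * (w \<bullet> (B *v z))"
        using Metzler_inner_nonneg[OF A(1) w(2) z(1,2)] Metzler_inner_nonneg[OF B w(2) z(1,2)] ab by auto
      then show ?thesis using z
        by (intro bexI[of _ z]) (auto simp: matrix_vector_mult_add_rdistrib inner_add_right scaleR_matrix_vector_assoc[symmetric])
    qed
    show "\<exists>z\<in>K. w \<bullet> z = 0 \<and> w \<bullet> ((a *\<^sub>R A + b *\<^sub>R B) *v z) \<noteq> 0"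
    proof (cases "0 < a")
      case True then show ?thesis using *[of A B a b] AB ab by auto
    next
      case False
      then have "0 < b" using ab by simp
      then show ?thesis using *[of B A b a] AB ab by (simp add: add.commute)
    qed
  qed
  moreover have "a *\<^sub>R A + b *\<^sub>R B \<in> {A. Metzler_on K A}"
    using convexD[OF convex_Metzler, of A B a b] AB ab by simp
  ultimately show "a *\<^sub>R A + b *\<^sub>R B \<in> {A. Metzler_on K A \<and> irreducible_on K A}" by simp
qed

end

context Metzler_system
begin

lemma control_Metzler: "control_function \<A> A \<Longrightarrow> 0 \<le> t \<Longrightarrow> Metzler_on K (A t)"
  using Metzler_A by (simp add: control_function_def)

text \<open>
  The solution of the adjoint equation with value \<open>u\<close> at the time \<open>T\<close>.
\<close>

definition costate :: "(real \<Rightarrow> real^'n^'n) \<Rightarrow> real \<Rightarrow> real^'n \<Rightarrow> real \<Rightarrow> real^'n" where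
  "costate A T u t = adjoint (flow (shift_control t A) (T - t)) u"

lemma costate_inner:
  assumes A: "control_function \<A> A" and t: "0 \<le> t" "t \<le> T"
  shows "costate A T u t \<bullet> z = u \<bullet> flow (shift_control t A) (T - t) z"
proof -
  have "linear (flow (shift_control t A) (T - t))"
    using t by (intro linear_flow[OF bounded_control_shift[OF bounded_control[OF A]]]) auto
  from adjoint_works[OF this, of z u] show ?thesis by (simp add: costate_def inner_commute)
qed

lemma costate_flow:
  assumes A: "control_function \<A> A" and t: "0 \<le> s" "s \<le> t" "t \<le> T"
  shows "costate A T u t \<bullet> flow (shift_control s A) (t - s) z = costate A T u s \<bullet> z"
  using flow_shift[OF bounded_control_shift[OF bounded_control[OF A] t(1)], of "t - s" "T - t" z] t
  by (simp add: costate_inner A shift_control_shift)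

lemma costate_flow_0:
  assumes A: "control_function \<A> A" and t: "0 \<le> t" "t \<le> T"
  shows "costate A T u t \<bullet> flow A t z = u \<bullet> flow A T z"
  using costate_flow[OF A order_refl t, of u z] costate_inner[OF A, of 0 T u z] t by simp

lemma costate_nonneg:
  assumes A: "control_function \<A> A" and t: "0 \<le> t" "t \<le> T" and u: "\<And>z. z \<in> K \<Longrightarrow> 0 \<le> u \<bullet> z" and z: "z \<in> K"
  shows "0 \<le> costate A T u t \<bullet> z"
  using t unfolding costate_inner[OF A t] by (intro u flow_K control_function_shift A z) auto

text \<open>Flows are onto, so some \<open>z\<close> is carried to \<open>u\<close>, and the costate
  takes the positive value \<open>u \<bullet> u\<close> at it.\<close>

lemma costate_nonzero:
  assumes A: "control_function \<A> A" and t: "0 \<le> t" "t \<le> T" and u: "u \<noteq> 0"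
  shows "costate A T u t \<noteq> 0"
proof -
  note b = bounded_control_shift[OF bounded_control[OF A] t(1)]
  have "surj (flow (shift_control t A) (T - t))"
    using t by (intro linear_injective_imp_surjective linear_flow[OF b] inj_flow[OF b]) auto
  then obtain z where "u = flow (shift_control t A) (T - t) z" unfolding surj_def by blast
  then have "costate A T u t \<bullet> z = u \<bullet> u" by (simp add: costate_inner[OF A t])
  then show ?thesis using u by auto
qed

text \<open>Pairing the difference of two costates with itself reduces the claim to the displacement
  of the forward flow started at that difference; one factor of its norm then cancels.\<close>

lemma costate_lipschitz:
  assumes A: "control_function \<A> A" and t: "0 \<le> s" "s \<le> t" "t \<le> T"
  shows "norm (costate A T u s - costate A T u t) \<le> norm u * exp (L * T) * (L * exp (L * T)) * (t - s)"
proof -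
  let ?w = "costate A T u s - costate A T u t" and ?S = "flow (shift_control s A) (t - s)"
  have bs: "bounded_control L (shift_control s A)" if "0 \<le> s" for s
    using bounded_control_shift[OF bounded_control[OF A] that] .
  have T: "0 \<le> T" using t by simp
  have "norm ?w * norm ?w = ?w \<bullet> ?w" by (simp add: power2_norm_eq_inner[symmetric] power2_eq_square)
  also have "\<dots> = costate A T u t \<bullet> ?S ?w - costate A T u t \<bullet> ?w"
    by (simp add: inner_diff_left costate_flow[OF A t])
  also have "\<dots> = u \<bullet> flow (shift_control t A) (T - t) (?S ?w - ?w)"
    using t by (simp add: costate_inner[OF A, symmetric] inner_diff_right)
  also have "\<dots> \<le> norm u * norm (flow (shift_control t A) (T - t) (?S ?w - ?w))" by (rule norm_cauchy_schwarz)
  also have "\<dots> \<le> norm u * (norm (?S ?w - ?w) * exp (L * T))"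
  proof (rule mult_left_mono)
    have "norm (flow (shift_control t A) (T - t) (?S ?w - ?w)) \<le> norm (?S ?w - ?w) * exp (L * (T - t))"
      using t by (intro flow_norm_le bs) auto
    also have "\<dots> \<le> norm (?S ?w - ?w) * exp (L * T)" using t L_pos by (intro mult_left_mono) auto
    finally show "norm (flow (shift_control t A) (T - t) (?S ?w - ?w)) \<le> norm (?S ?w - ?w) * exp (L * T)" .
  qed simp
  also have "norm (?S ?w - ?w) \<le> L * norm ?w * exp (L * T) * (t - s)"
    using solves_lipschitz[OF bs[OF t(1)] flow_solves[OF bs[OF t(1)], of ?w], of 0 "t - s" T] t by simp
  finally have "norm ?w * norm ?w \<le> norm u * (L * norm ?w * exp (L * T) * (t - s) * exp (L * T))"
    by (simp add: mult_left_mono mult_right_mono)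
  then have "norm ?w * norm ?w \<le> (norm u * exp (L * T) * (L * exp (L * T)) * (t - s)) * norm ?w"
    by (simp add: mult_ac)
  then show ?thesis using t L_pos
    by (cases "?w = 0") (auto simp: mult_le_cancel_right)
qed

text \<open>
  Writing \<open>w\<close> for the costate and \<open>z\<close> for the trajectory of \<open>b\<close>, the function
  \<open>w t \<bullet> A t z t\<close> is nonnegative, and its integral is a limit of Riemann sums of
  \<open>w t \<bullet> (z t - z s)\<close> with \<open>s \<le> t\<close>. These terms are nonpositive, because \<open>w t\<close> vanishes at \<open>z t\<close>
  and is nonnegative at \<open>z s\<close>. No almost everywhere differentiability is needed.
\<close>

lemma exists_time_tangent:
  assumes A: "control_function \<A> A" and T: "0 < T" and u: "\<And>z. z \<in> K \<Longrightarrow> 0 \<le> u \<bullet> z"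
    and B: "finite B" "B \<subseteq> K" "\<And>b. b \<in> B \<Longrightarrow> u \<bullet> flow A T b = 0"
  shows "\<exists>t\<in>{0<..<T}. \<forall>b\<in>B. costate A T u t \<bullet> (A t *v flow A t b) = 0"
proof -
  let ?w = "costate A T u"
  define g where "g b t = ?w t \<bullet> (A t *v flow A t b)" for b t
  define Cw where "Cw = norm u * exp (L * T) * (L * exp (L * T))"
  have Cw: "0 \<le> Cw" using L_pos by (simp add: Cw_def)
  note bA = bounded_control[OF A]
  have wlip: "norm (?w s - ?w t) \<le> Cw * (t - s)" if "0 \<le> s" "s \<le> t" "t \<le> T" for s t
    unfolding Cw_def by (rule costate_lipschitz[OF A that])
  have wcont: "continuous_on {0..T} ?w"
  proof (rule lipschitz_on_continuous_on[OF lipschitz_onI[OF _ Cw]])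
    show "dist (?w s) (?w t) \<le> Cw * dist s t" if "s \<in> {0..T}" "t \<in> {0..T}" for s t
      using wlip[of s t] wlip[of t s] that by (cases "s \<le> t") (auto simp: dist_norm norm_minus_commute abs_if)
  qed
  have zero: "?w t \<bullet> flow A t b = 0" if "b \<in> B" "0 \<le> t" "t \<le> T" for b t
    using costate_flow_0[OF A that(2,3)] B(3)[OF that(1)] by simp
  have g_nonneg: "0 \<le> g b t" if "b \<in> B" "t \<in> {0..T}" for b t
    unfolding g_def
    using that B(2) by (intro Metzler_inner_nonneg control_Metzler[OF A] costate_nonneg[OF A] u flow_K[OF A] zero) auto
  have vint: "(\<lambda>t. A t *v flow A t b) absolutely_integrable_on {s..t}" if "0 \<le> s" for b s t
    by (intro control_integrable[OF bA] continuous_on_flow[OF bA] that)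
  have g_int: "g b absolutely_integrable_on {s..t}" if "0 \<le> s" "t \<le> T" for b s t
  proof -
    have cw: "continuous_on {s..t} ?w" by (rule continuous_on_subset[OF wcont]) (use that in auto)
    from cw have "bounded (?w ` {s..t})" by (intro compact_imp_bounded compact_continuous_image) auto
    then obtain C where C: "\<And>r. r \<in> {s..t} \<Longrightarrow> norm (?w r) \<le> C" unfolding bounded_iff by blast
    show ?thesis
    proof (rule measurable_bounded_by_integrable_imp_absolutely_integrable)
      show "g b \<in> borel_measurable (lebesgue_on {s..t})"
        unfolding g_def
        by (intro borel_measurable_inner absolutely_integrable_imp_borel_measurable[OF vint[OF that(1)]]
              continuous_imp_measurable_on_sets_lebesgue[OF cw]) auto
      show "(\<lambda>r. C * norm (A r *v flow A r b)) integrable_on {s..t}"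
        using absolutely_integrable_norm[OF vint[OF that(1), of t b]]
        by (intro integrable_on_mult_right) (simp add: o_def set_lebesgue_integral_eq_integral(1))
      show "norm (g b r) \<le> C * norm (A r *v flow A r b)" if "r \<in> {s..t}" for r
        using Cauchy_Schwarz_ineq2[of "?w r" "A r *v flow A r b"] mult_right_mono[OF C[OF that], of "norm (A r *v flow A r b)"]
        by (simp add: g_def)
    qed auto
  qed
  have gi: "g b integrable_on {s..t}" if "0 \<le> s" "t \<le> T" for b s t
    using g_int[OF that] set_lebesgue_integral_eq_integral(1) by blast
  have int_le: "integral {0..T} (g b) \<le> 0" if b: "b \<in> B" for b
  proof -
    define Cz where "Cz = L * (norm b * exp (L * T))"
    have Cz: "norm (A r *v flow A r b) \<le> Cz" if "0 \<le> r" "r \<le> T" for r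
    proof -
      have "norm (A r *v flow A r b) \<le> L * norm (flow A r b)" by (rule bounded_control_norm_le[OF bA that(1)])
      also have "\<dots> \<le> L * (norm b * exp (L * r))" using L_pos by (intro mult_left_mono flow_norm_le[OF bA that(1)]) auto
      also have "\<dots> \<le> Cz" using L_pos that unfolding Cz_def by (intro mult_left_mono) auto
      finally show ?thesis .
    qed
    have "integral {0..T} (g b) \<le> integral {0..0} (g b)"
    proof (rule le_if_quadratic_increments[OF less_imp_le[OF T]])
      fix s t assume st: "0 \<le> s" "s \<le> t" "t \<le> T"
      let ?z = "\<lambda>r. A r *v flow A r b"
      have zi: "?z integrable_on {s..t}" using vint[OF st(1)] set_lebesgue_integral_eq_integral(1) by blast
      have "(\<lambda>r. ?w t \<bullet> ?z r) integrable_on {s..t}"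
        using integrable_linear[OF zi bounded_linear_inner_right, of "?w t"] by (simp add: o_def)
      moreover have "integral {s..t} (\<lambda>r. ?w t \<bullet> ?z r) = ?w t \<bullet> integral {s..t} ?z"
        using integral_linear[OF zi bounded_linear_inner_right, of "?w t"] by (simp add: o_def)
      moreover have "integral {s..t} ?z = flow A t b - flow A s b"
        using solves_increment[OF bA flow_solves[OF bA] st(1,2), of b] by simp
      moreover have "0 \<le> ?w t \<bullet> flow A s b"
        using st b B(2) by (intro costate_nonneg[OF A] u flow_K[OF A]) auto
      moreover have "?w t \<bullet> flow A t b = 0" using st by (intro zero[OF b]) auto
      ultimately have first: "(\<lambda>r. ?w t \<bullet> ?z r) integrable_on {s..t}" "integral {s..t} (\<lambda>r. ?w t \<bullet> ?z r) \<le> 0"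
        by (auto simp: inner_diff_right)
      have "integral {s..t} (g b) \<le> integral {s..t} (\<lambda>r. ?w t \<bullet> ?z r + Cw * Cz * (t - s))"
      proof (rule integral_le[OF gi[OF st(1,3)]])
        show "(\<lambda>r. ?w t \<bullet> ?z r + Cw * Cz * (t - s)) integrable_on {s..t}"
          by (intro integrable_add first(1)) auto
        fix r assume r: "r \<in> {s..t}"
        \<comment> \<open>Freezing the costate at the right endpoint gives a term of nonpositive
          integral; the error is of order \<open>t - s\<close>, hence quadratic after
          integration.\<close>
        have "g b r = ?w t \<bullet> ?z r + (?w r - ?w t) \<bullet> ?z r" by (simp add: g_def inner_diff_left)
        also have "(?w r - ?w t) \<bullet> ?z r \<le> norm (?w r - ?w t) * norm (?z r)" by (rule norm_cauchy_schwarz)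
        also have "\<dots> \<le> (Cw * (t - s)) * Cz"
        proof (rule mult_mono)
          have "norm (?w r - ?w t) \<le> Cw * (t - r)" using r st by (intro wlip) auto
          also have "\<dots> \<le> Cw * (t - s)" using r Cw by (intro mult_left_mono) auto
          finally show "norm (?w r - ?w t) \<le> Cw * (t - s)" .
          show "norm (?z r) \<le> Cz" using r st by (intro Cz) auto
        qed (use Cw st in auto)
        finally show "g b r \<le> ?w t \<bullet> ?z r + Cw * Cz * (t - s)" by (simp add: mult_ac)
      qed
      also have "\<dots> = integral {s..t} (\<lambda>r. ?w t \<bullet> ?z r) + Cw * Cz * (t - s) * (t - s)"
        using st by (subst integral_add[OF first(1)]) auto
      also have "\<dots> \<le> Cw * Cz * (t - s)\<^sup>2" using first(2) by (simp add: power2_eq_square)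
      finally have "integral {s..t} (g b) \<le> Cw * Cz * (t - s)\<^sup>2" .
      moreover have "integral {0..s} (g b) + integral {s..t} (g b) = integral {0..t} (g b)"
        by (rule Henstock_Kurzweil_Integration.integral_combine) (use st in \<open>auto intro!: gi\<close>)
      ultimately show "integral {0..t} (g b) - integral {0..s} (g b) \<le> Cw * Cz * (t - s)\<^sup>2" by linarith
    qed
    then show ?thesis by simp
  qed
  \<comment> \<open>Summing the nonnegative functions over the finite set yields one time that
    serves all \<open>b\<close>.\<close>
  have "\<exists>t\<in>{0<..<T}. (\<Sum>b\<in>B. g b t) = 0"
  proof (rule exists_zero_if_integral_nonpos[OF T])
    show "(\<lambda>t. \<Sum>b\<in>B. g b t) absolutely_integrable_on {0..T}"
      by (intro absolutely_integrable_sum B(1) g_int) auto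
    have "integral {0..T} (\<lambda>t. \<Sum>b\<in>B. g b t) = (\<Sum>b\<in>B. integral {0..T} (g b))"
      by (intro integral_sum B(1) gi) auto
    then show "integral {0..T} (\<lambda>t. \<Sum>b\<in>B. g b t) \<le> 0" using int_le by (simp add: sum_nonpos)
  qed (auto intro!: sum_nonneg g_nonneg)
  then obtain t where t: "t \<in> {0<..<T}" "(\<Sum>b\<in>B. g b t) = 0" by blast
  then have "\<forall>b\<in>B. g b t = 0"
    using sum_nonneg_eq_0_iff[OF B(1), of "\<lambda>b. g b t"] g_nonneg by auto
  then show ?thesis using t(1) by (auto simp: g_def)
qed

text \<open>
  If the trajectory reaches the boundary, then the costate exposes a face \<open>F t\<close> at every time, and
  the flow maps \<open>F s\<close> into \<open>F t\<close> for \<open>s \<le> t\<close>. From a time \<open>a\<close> of maximal dimension on, the flow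
  maps the span of \<open>F a\<close> onto that of \<open>F t\<close>, so that testing on a basis from \<open>F a\<close> yields a time
  \<open>t\<close> at which the face plane is invariant under \<open>A t\<close>.
\<close>

lemma flow_interior:
  assumes irr: "\<forall>A\<in>\<A>. irreducible_on K A" and A: "control_function \<A> A"
    and x: "x \<in> K" "x \<noteq> 0"
  shows "flow A 1 x \<in> interior K"
proof (rule ccontr)
  assume nint: "flow A 1 x \<notin> interior K"
  note bA = bounded_control[OF A]
  have y: "flow A 1 x \<in> K" using flow_K[OF A _ x(1)] by simp
  have "interior K \<noteq> {}" using interior_maximal[OF ball_subset_cball[THEN subset_trans, OF ball_K] open_ball] r_pos by force
  then have nrel: "flow A 1 x \<notin> rel_interior K" using nint rel_interior_nonempty_interior by blast
  have "\<exists>u. u \<noteq> 0 \<and> (\<forall>z\<in>K. u \<bullet> flow A 1 x \<le> u \<bullet> z)"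
  proof (rule supporting_hyperplane_rel_boundary[OF convex_K y nrel])
    fix u assume "u \<noteq> 0" "\<And>z. z \<in> K \<Longrightarrow> u \<bullet> flow A 1 x \<le> u \<bullet> z"
    then show "\<exists>u. u \<noteq> 0 \<and> (\<forall>z\<in>K. u \<bullet> flow A 1 x \<le> u \<bullet> z)" by blast
  qed
  then obtain u where u: "u \<noteq> 0" "\<And>z. z \<in> K \<Longrightarrow> u \<bullet> flow A 1 x \<le> u \<bullet> z" by blast
  \<comment> \<open>A functional minimized over a cone vanishes at the minimizer: compare with zero
    and with the double.\<close>
  have u0: "u \<bullet> flow A 1 x = 0"
    using u(2)[OF zero_K] u(2)[OF scale_K[OF y, of 2]] by simp
  then have unn: "0 \<le> u \<bullet> z" if "z \<in> K" for z using u(2)[OF that] by simp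
  let ?w = "costate A 1 u"
  define F where "F t = K \<inter> {z. ?w t \<bullet> z = 0}" for t
  \<comment> \<open>Dimensions are bounded, so the maximum is attained. The final time is excluded
    in order to leave a nondegenerate interval after \<open>a\<close>.\<close>
  have "\<exists>a. (0 \<le> a \<and> a < 1) \<and> (\<forall>t. (0 \<le> t \<and> t < (1::real)) \<longrightarrow> dim (F t) \<le> dim (F a))"
    by (rule ex_has_greatest_nat[of _ 0 _ "Suc CARD('n)"]) (auto simp: less_Suc_eq_le dim_subset_UNIV_cart)
  then obtain a where a: "0 \<le> a" "a < 1" and amax: "\<And>t. 0 \<le> t \<Longrightarrow> t < 1 \<Longrightarrow> dim (F t) \<le> dim (F a)" by blast
  let ?A = "shift_control a A" and ?T = "1 - a"
  have sA: "control_function \<A> ?A" by (rule control_function_shift[OF A a(1)])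
  obtain B where B: "B \<subseteq> F a" "independent B" "F a \<subseteq> span B" "card B = dim (F a)"
    by (rule basis_exists)
  have "finite B" using B(2) by (rule independent_imp_finite)
  have cs: "costate ?A ?T u t = ?w (a + t)" for t
    by (simp add: costate_def shift_control_shift algebra_simps)
  have "u \<bullet> flow ?A ?T b = 0" if "b \<in> B" for b
    using that B(1) costate_inner[OF A a(1), of 1 u b] a by (auto simp: F_def)
  then obtain \<tau> where \<tau>: "0 < \<tau>" "\<tau> < ?T" "\<And>b. b \<in> B \<Longrightarrow> ?w (a + \<tau>) \<bullet> (?A \<tau> *v flow ?A \<tau> b) = 0"
    using exists_time_tangent[OF sA _ unn \<open>finite B\<close>, of ?T] a B(1) unfolding cs F_def by fastforce
  define t where "t = a + \<tau>"
  have t: "0 \<le> t" "t < 1" "a \<le> t" "t - a = \<tau>" using \<tau> a by (auto simp: t_def)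
  let ?V = "flow ?A \<tau>"
  have linV: "linear ?V" using \<tau> by (intro linear_flow[OF bounded_control[OF sA]]) auto
  have injV: "inj ?V" using \<tau> by (intro inj_flow[OF bounded_control[OF sA]]) auto
  have VF: "?V ` F a \<subseteq> F t"
  proof
    fix y assume "y \<in> ?V ` F a"
    then obtain z where z: "z \<in> F a" "y = ?V z" by blast
    have "y \<in> K" using z \<tau> flow_K[OF sA] by (auto simp: F_def)
    moreover have "?w t \<bullet> y = ?w a \<bullet> z"
      using costate_flow[OF A a(1) t(3), of 1 u z] t z(2) by simp
    ultimately show "y \<in> F t" using z by (simp add: F_def)
  qed
  have "dim (?V ` F a) = dim (F a)" using injV by (intro dim_image_eq[OF linV]) (auto simp: inj_on_def)
  then have "span (?V ` F a) = span (F t)"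
    using amax[OF t(1,2)] by (intro subspace_dim_equal subspace_span span_mono VF) simp
  moreover have "?V ` F a \<subseteq> span (?V ` B)" unfolding linear_span_image[OF linV] using B(3) by blast
  then have "span (?V ` F a) \<subseteq> span (?V ` B)" by (rule span_minimal[OF _ subspace_span])
  ultimately have spanF: "F t \<subseteq> span (?V ` B)" using span_superset[of "F t"] by blast
  have tangent: "?w t \<bullet> (A t *v z) = 0" if "z \<in> F t" for z
  proof -
    have "span (?V ` B) \<subseteq> {z. ?w t \<bullet> (A t *v z) = 0}"
    proof (rule span_minimal)
      show "?V ` B \<subseteq> {z. ?w t \<bullet> (A t *v z) = 0}"
        using \<tau>(3) by (auto simp: t_def shift_control_def)
      show "subspace {z. ?w t \<bullet> (A t *v z) = 0}"
        by (auto simp: subspace_def matrix_vector_right_distrib inner_add_right matrix_vector_mult_scaleR)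
    qed
    then show ?thesis using spanF that by blast
  qed
  have "\<exists>z\<in>K. ?w t \<bullet> z = 0 \<and> ?w t \<bullet> (A t *v z) \<noteq> 0"
  proof (rule irreducible_onD)
    show "irreducible_on K (A t)" "Metzler_on K (A t)"
      using irr A t control_Metzler[OF A] by (auto simp: control_function_def)
    show "?w t \<noteq> 0" using t by (intro costate_nonzero[OF A] u(1)) auto
    show "0 \<le> ?w t \<bullet> z" if "z \<in> K" for z using t by (intro costate_nonneg[OF A] unn that) auto
    show "flow A t x \<in> K" by (rule flow_K[OF A t(1) x(1)])
    show "flow A t x \<noteq> 0" using flow_norm_ge[OF bA t(1), of x] x(2) by auto
    show "?w t \<bullet> flow A t x = 0" using costate_flow_0[OF A t(1), of 1 u x] t u0 by simp
  qed
  with tangent show False by (auto simp: F_def)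
qed

end

section \<open>A positive invariant antinorm\<close>

context Metzler_system
begin

text \<open>Limit controls take values in the convex hull, so invariance of \<open>K\<close> and
  strict positivity have to be available for it with the same constants.\<close>

lemma Metzler_system_hull: "Metzler_system K v e c r (convex hull \<A>) L"
proof unfold_locales
  show "compact (convex hull \<A>)" by (rule compact_convex_hull[OF compact_A])
  show "convex hull \<A> \<noteq> {}" using nonempty_A by simp
  have "convex hull \<A> \<subseteq> {A. Metzler_on K A}"
    using Metzler_A by (intro hull_minimal convex_Metzler) auto
  then show "\<forall>A\<in>convex hull \<A>. Metzler_on K A" by blast
  have "convex {A::real^'n^'n. \<forall>x. norm (A *v x) \<le> L * norm x}"
  proof (rule convexI, clarify)
    fix A B :: "real^'n^'n" and a b :: real and x
    assume *: "\<forall>x. norm (A *v x) \<le> L * norm x" "\<forall>x. norm (B *v x) \<le> L * norm x" and ab: "0 \<le> a" "0 \<le> b" "a + b = 1"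
    have "norm ((a *\<^sub>R A + b *\<^sub>R B) *v x) \<le> a * norm (A *v x) + b * norm (B *v x)"
      using norm_triangle_ineq[of "a *\<^sub>R (A *v x)" "b *\<^sub>R (B *v x)"] ab
      by (simp add: matrix_vector_mult_add_rdistrib scaleR_matrix_vector_assoc[symmetric])
    also have "\<dots> \<le> a * (L * norm x) + b * (L * norm x)" using * ab by (intro add_mono mult_left_mono) auto
    also have "\<dots> = L * norm x" using ab by (simp add: distrib_right[symmetric])
    finally show "norm ((a *\<^sub>R A + b *\<^sub>R B) *v x) \<le> L * norm x" .
  qed
  then have "convex hull \<A> \<subseteq> {A. \<forall>x. norm (A *v x) \<le> L * norm x}"
    using norm_A_le by (intro hull_minimal) auto
  then show "norm (A *v x) \<le> L * norm x" if "A \<in> convex hull \<A>" for A x using that by blast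
qed (use L_pos in auto)

end

locale irreducible_Metzler_system = Metzler_system K v e c r \<A> L
  for K :: "(real^'n) set" and v e :: "real^'n" and c r :: real
    and \<A> :: "(real^'n^'n) set" and L :: real +
  assumes irreducible_A: "\<forall>A\<in>\<A>. irreducible_on K A"
begin

interpretation hull: Metzler_system K v e c r "convex hull \<A>" L
  by (rule Metzler_system_hull)

lemma irreducible_hull: "\<forall>A\<in>convex hull \<A>. irreducible_on K A"
proof -
  have "convex hull \<A> \<subseteq> {A. Metzler_on K A \<and> irreducible_on K A}"
    using Metzler_A irreducible_A by (intro hull_minimal convex_irreducible_Metzler) auto
  then show ?thesis by blast
qed

text \<open>Counterexamples for constants tending to zero would converge to a nonzero trajectory of
  the hull. At time 1 it is interior to \<open>K\<close>, so the approximating points minus small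
  multiples of \<open>e\<close> would eventually be in \<open>K\<close>.\<close>

lemma exists_uniform_positivity:
  "\<exists>\<kappa>>0. \<forall>A x. control_function \<A> A \<longrightarrow> x \<in> K \<longrightarrow> flow A 1 x - (\<kappa> * (v \<bullet> x)) *\<^sub>R e \<in> K"
proof (rule ccontr)
  assume "\<not> ?thesis"
  then have "\<exists>A x. control_function \<A> A \<and> x \<in> K \<and> flow A 1 x - (inverse (real (Suc n)) * (v \<bullet> x)) *\<^sub>R e \<notin> K" for n
    by (metis inverse_positive_iff_positive of_nat_0_less_iff zero_less_Suc)
  then obtain A x where A: "\<And>n. control_function \<A> (A n)" and x: "\<And>n. x n \<in> K"
    and out: "\<And>n. flow (A n) 1 (x n) - (inverse (real (Suc n)) * (v \<bullet> x n)) *\<^sub>R e \<notin> K" by metis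
  have lin: "linear (flow (A n) 1)" for n by (rule linear_flow[OF bounded_control[OF A]]) simp
  have "x n \<noteq> 0" for n using out[of n] zero_K linear_0[OF lin] by auto
  then have vx: "0 < v \<bullet> x n" for n using v_pos[OF x] by blast
  \<comment> \<open>Normalization by \<open>v\<close> gives bounded initial points and keeps their
    limit away from zero.\<close>
  define y where "y n = (1 / (v \<bullet> x n)) *\<^sub>R x n" for n
  have yK: "y n \<in> K" for n unfolding y_def using vx[of n] by (intro scale_K x) auto
  have vy: "v \<bullet> y n = 1" for n using vx[of n] by (simp add: y_def)
  have outy: "flow (A n) 1 (y n) - inverse (real (Suc n)) *\<^sub>R e \<notin> K" for n
  proof
    assume "flow (A n) 1 (y n) - inverse (real (Suc n)) *\<^sub>R e \<in> K"
    then have "(v \<bullet> x n) *\<^sub>R (flow (A n) 1 (y n) - inverse (real (Suc n)) *\<^sub>R e) \<in> K"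
      using vx[of n] by (intro scale_K) auto
    moreover have "(v \<bullet> x n) *\<^sub>R flow (A n) 1 (y n) = flow (A n) 1 (x n)"
      using vx[of n] by (simp add: linear_cmul[OF lin, symmetric] y_def)
    ultimately show False using out[of n] by (simp add: scaleR_diff_right mult.commute)
  qed
  have "norm (flow (A n) 0 (y n)) \<le> 1 / c" for n using norm_le_v[OF yK, of n] vy by simp
  from trajectories_subsequence[of \<A> A "\<lambda>n t. flow (A n) t (y n)" "1 / c",
      OF compact_A A flow_solves[OF bounded_control[OF A]] this]
  obtain k B z where k: "strict_mono k" and B: "control_function (convex hull \<A>) B" and z: "solves_linear_ode B z"
    and lim: "\<And>t. 0 \<le> t \<Longrightarrow> (\<lambda>n. flow (A (k n)) t (y (k n))) \<longlonglongrightarrow> z t" by blast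
  have lim0: "(\<lambda>n. y (k n)) \<longlonglongrightarrow> z 0" using lim[of 0] by simp
  have "z 0 \<in> K" by (rule closed_sequentially[OF closed_K yK lim0])
  moreover have "(\<lambda>n. v \<bullet> y (k n)) \<longlonglongrightarrow> v \<bullet> z 0" by (intro tendsto_intros lim0)
  then have "v \<bullet> z 0 = 1" by (simp add: vy LIMSEQ_const_iff)
  then have "z 0 \<noteq> 0" by auto
  moreover have "z 1 = flow B 1 (z 0)" by (rule flow_eq[OF hull.bounded_control[OF B] z]) simp
  ultimately have int: "z 1 \<in> interior K" using hull.flow_interior[OF irreducible_hull B] by simp
  have "(\<lambda>n. flow (A (k n)) 1 (y (k n)) - inverse (real (Suc (k n))) *\<^sub>R e) \<longlonglongrightarrow> z 1 - 0 *\<^sub>R e"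
    using LIMSEQ_subseq_LIMSEQ[OF LIMSEQ_inverse_real_of_nat k] by (intro tendsto_intros lim) (auto simp: o_def)
  then have "\<forall>\<^sub>F n in sequentially. flow (A (k n)) 1 (y (k n)) - inverse (real (Suc (k n))) *\<^sub>R e \<in> interior K"
    using int by (intro topological_tendstoD[of _ "z 1"]) auto
  then obtain n where "flow (A (k n)) 1 (y (k n)) - inverse (real (Suc (k n))) *\<^sub>R e \<in> interior K"
    using eventually_happens by force
  then show False using outy interior_subset by blast
qed

definition \<kappa> :: real where
  "\<kappa> = (SOME \<kappa>. 0 < \<kappa> \<and> (\<forall>A x. control_function \<A> A \<longrightarrow> x \<in> K \<longrightarrow> flow A 1 x - (\<kappa> * (v \<bullet> x)) *\<^sub>R e \<in> K))"

lemma \<kappa>_pos: "0 < \<kappa>"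
  and flow_1_ge: "control_function \<A> A \<Longrightarrow> x \<in> K \<Longrightarrow> flow A 1 x - (\<kappa> * (v \<bullet> x)) *\<^sub>R e \<in> K"
  using someI_ex[OF exists_uniform_positivity] unfolding \<kappa>_def by blast+

section \<open>Estimates over one unit of time\<close>

definition \<Gamma> :: real where "\<Gamma> = norm v * exp L / c"

lemma v_nonzero: "v \<noteq> 0"
  using v_e_pos by auto

lemma \<Gamma>_pos: "0 < \<Gamma>"
  using v_nonzero c_pos by (simp add: \<Gamma>_def)

lemma v_flow_1_le:
  assumes A: "control_function \<A> A" and x: "x \<in> K"
  shows "v \<bullet> flow A 1 x \<le> \<Gamma> * (v \<bullet> x)"
proof -
  have "v \<bullet> flow A 1 x \<le> norm v * norm (flow A 1 x)" by (rule norm_cauchy_schwarz)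
  also have "\<dots> \<le> norm v * (norm x * exp L)"
    using flow_norm_le[OF bounded_control[OF A], of 1 x] by (intro mult_left_mono) auto
  also have "\<dots> \<le> norm v * ((v \<bullet> x) / c * exp L)" by (intro mult_left_mono mult_right_mono norm_le_v x) auto
  finally show ?thesis by (simp add: \<Gamma>_def mult_ac)
qed

lemma flow_1_add:
  assumes A: "control_function \<A> A" and t: "0 \<le> t"
  shows "flow A (1 + t) x = flow (shift_control 1 A) t (flow A 1 x)"
    and "flow A (t + 1) x = flow (shift_control t A) 1 (flow A t x)"
  using flow_shift[OF bounded_control[OF A]] t by simp_all

lemma v_flow_mono:
  assumes A: "control_function \<A> A" and t: "0 \<le> t" and y: "y - x \<in> K"
  shows "v \<bullet> flow A t x \<le> v \<bullet> flow A t y"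
proof -
  have "flow A t (y - x) \<in> K" by (rule flow_K[OF A t y])
  from v_nonneg[OF this] show ?thesis
    by (simp add: linear_diff[OF linear_flow[OF bounded_control[OF A] t]] inner_diff_right)
qed

text \<open>Time \<open>1 + t\<close> is read in two ways: the first unit of time lifts
  \<open>x\<close> above a multiple of \<open>e\<close>, whose growth is bounded below, and removing
  the last unit costs at most a factor \<Gamma>.\<close>

lemma inf_antinorm_ge_v:
  assumes x: "x \<in> K"
  shows "\<kappa> * c * r / (3 * \<Gamma>) * (v \<bullet> x) \<le> inf_antinorm x"
proof (rule inf_antinorm_ge)
  fix A and t :: real assume A: "control_function \<A> A" and t: "0 \<le> t"
  have s1: "control_function \<A> (shift_control 1 A)" and st: "control_function \<A> (shift_control t A)"
    using control_function_shift[OF A] t by auto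
  let ?S = "flow (shift_control 1 A) t"
  have lin: "linear ?S" by (rule linear_flow[OF bounded_control[OF s1] t])
  have "c * r / 3 * exp (\<sigma> * t) * (\<kappa> * (v \<bullet> x)) \<le> (v \<bullet> ?S e) * (\<kappa> * (v \<bullet> x))"
    using \<kappa>_pos v_nonneg[OF x] by (intro mult_right_mono v_flow_e_ge[OF s1 t]) auto
  also have "\<dots> = v \<bullet> ?S ((\<kappa> * (v \<bullet> x)) *\<^sub>R e)" by (simp add: linear_cmul[OF lin])
  also have "\<dots> \<le> v \<bullet> ?S (flow A 1 x)" by (rule v_flow_mono[OF s1 t flow_1_ge[OF A x]])
  also have "\<dots> = v \<bullet> flow (shift_control t A) 1 (flow A t x)"
    using flow_1_add[OF A t, of x] by (simp add: add.commute)
  also have "\<dots> \<le> \<Gamma> * (v \<bullet> flow A t x)" by (rule v_flow_1_le[OF st flow_K[OF A t x]])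
  finally show "\<kappa> * c * r / (3 * \<Gamma>) * (v \<bullet> x) \<le> exp (- \<sigma> * t) * (v \<bullet> flow A t x)"
    using \<Gamma>_pos by (simp add: exp_minus field_simps)
qed

lemma inf_antinorm_pos: "x \<in> K \<Longrightarrow> x \<noteq> 0 \<Longrightarrow> 0 < inf_antinorm x"
  using \<kappa>_pos c_pos r_pos \<Gamma>_pos
  by (intro less_le_trans[OF _ inf_antinorm_ge_v] mult_pos_pos divide_pos_pos v_pos) auto

text \<open>The first entry of the minimum serves points reached at times at least 1, the second the
  starting point \<open>e\<close>; both then dominate \<rho> times their \<open>v\<close>-value
  times \<open>e\<close>.\<close>

definition \<rho> :: real where "\<rho> = min (\<kappa> / \<Gamma>) (1 / (v \<bullet> e))"

lemma \<rho>_pos: "0 < \<rho>"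
  using \<kappa>_pos \<Gamma>_pos v_e_pos by (simp add: \<rho>_def)

lemma flow_ge_\<rho>:
  assumes A: "control_function \<A> A" and t: "1 \<le> t" and x: "x \<in> K"
  shows "flow A t x - (\<rho> * (v \<bullet> flow A t x)) *\<^sub>R e \<in> K"
proof -
  define s where "s = t - 1"
  have s: "0 \<le> s" "t = s + 1" using t by (auto simp: s_def)
  let ?y = "flow A s x"
  have yK: "?y \<in> K" by (rule flow_K[OF A s(1) x])
  have sA: "control_function \<A> (shift_control s A)" by (rule control_function_shift[OF A s(1)])
  have eq: "flow A t x = flow (shift_control s A) 1 ?y" using flow_1_add(2)[OF A s(1)] s(2) by simp
  have "\<rho> * (v \<bullet> flow A t x) \<le> (\<kappa> / \<Gamma>) * (v \<bullet> flow A t x)"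
    using v_nonneg[OF flow_K[OF A _ x], of t] t by (intro mult_right_mono) (auto simp: \<rho>_def)
  also have "\<dots> \<le> (\<kappa> / \<Gamma>) * (\<Gamma> * (v \<bullet> ?y))"
    unfolding eq using \<kappa>_pos \<Gamma>_pos by (intro mult_left_mono v_flow_1_le[OF sA yK]) auto
  also have "\<dots> = \<kappa> * (v \<bullet> ?y)" using \<Gamma>_pos by simp
  finally have "(\<kappa> * (v \<bullet> ?y) - \<rho> * (v \<bullet> flow A t x)) *\<^sub>R e \<in> K" by (intro scale_K e_K) simp
  from add_K[OF flow_1_ge[OF sA yK] this] show ?thesis unfolding eq by (simp add: algebra_simps)
qed

text \<open>
  Otherwise the values \<open>v \<bullet> flow A (k n) e\<close> at least double, relative to \<open>exp (\<sigma> k n)\<close>, in each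
  period \<open>n\<close> for every control, against \<open>\<sigma>\<close> being the infimum of the exponents.
\<close>

lemma exists_slow_control:
  assumes n: "1 \<le> (n::nat)"
  shows "\<exists>A. control_function \<A> A \<and> v \<bullet> flow A (real n) e \<le> 2 / \<rho> * exp (\<sigma> * real n)"
proof (rule ccontr)
  assume "\<not> ?thesis"
  \<comment> \<open>The factor \<rho> lost in dominating a multiple of \<open>e\<close> is
    compensated here, so that a clear factor 2 per period survives.\<close>
  then have fast: "2 / \<rho> * exp (\<sigma> * real n) \<le> v \<bullet> flow A (real n) e" if "control_function \<A> A" for A
    using that by (meson le_cases)
  define \<beta> where "\<beta> = \<sigma> + ln 2 / real n"
  have "\<sigma> < \<beta>" using n by (simp add: \<beta>_def)
  then obtain \<alpha> where \<alpha>: "\<alpha> \<in> exponents" "\<alpha> < \<beta>" using exponent_lessD by blast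
  then obtain A where A: "control_function \<A> A"
    and bound: "\<And>x. solves_linear_ode A x \<Longrightarrow> \<exists>C. \<forall>t\<ge>0. norm (x t) \<le> C * exp (\<alpha> * t)"
    unfolding exponents_def by blast
  obtain C where C: "\<And>t. 0 \<le> t \<Longrightarrow> norm (flow A t e) \<le> C * exp (\<alpha> * t)"
    using bound[OF flow_solves[OF bounded_control[OF A], of e]] by blast
  define y where "y k = flow A (real k * real n) e" for k
  have yK: "y k \<in> K" for k unfolding y_def by (intro flow_K[OF A] e_K) simp
  have y\<rho>: "y k - (\<rho> * (v \<bullet> y k)) *\<^sub>R e \<in> K" for k
  proof (cases "k = 0")
    case True
    have "\<rho> * (v \<bullet> e) \<le> 1 / (v \<bullet> e) * (v \<bullet> e)" using v_e_pos by (intro mult_right_mono) (auto simp: \<rho>_def)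
    then have "(1 - \<rho> * (v \<bullet> e)) *\<^sub>R e \<in> K" using v_e_pos by (intro scale_K e_K) auto
    then show ?thesis by (simp add: True y_def algebra_simps)
  next
    case False
    then have "1 * 1 \<le> real k * real n" using n by (intro mult_mono) auto
    then show ?thesis unfolding y_def by (intro flow_ge_\<rho>[OF A _ e_K]) simp
  qed
  have step: "2 * exp (\<sigma> * real n) * (v \<bullet> y k) \<le> v \<bullet> y (Suc k)" for k
  proof -
    let ?A = "shift_control (real k * real n) A"
    have sA: "control_function \<A> ?A" by (rule control_function_shift[OF A]) simp
    have y_Suc: "y (Suc k) = flow ?A (real n) (y k)"
      using flow_shift[OF bounded_control[OF A], of "real k * real n" "real n" e] by (simp add: y_def algebra_simps)
    have "2 * exp (\<sigma> * real n) * (v \<bullet> y k) = (\<rho> * (v \<bullet> y k)) * (2 / \<rho> * exp (\<sigma> * real n))"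
      using \<rho>_pos by simp
    also have "\<dots> \<le> (\<rho> * (v \<bullet> y k)) * (v \<bullet> flow ?A (real n) e)"
      using \<rho>_pos v_nonneg[OF yK] by (intro mult_left_mono fast[OF sA]) auto
    also have "\<dots> = v \<bullet> flow ?A (real n) ((\<rho> * (v \<bullet> y k)) *\<^sub>R e)"
      by (simp add: linear_cmul[OF linear_flow[OF bounded_control[OF sA]]])
    also have "\<dots> \<le> v \<bullet> flow ?A (real n) (y k)" by (rule v_flow_mono[OF sA _ y\<rho>]) simp
    finally show ?thesis unfolding y_Suc .
  qed
  have q: "2 * exp (\<sigma> * real n) = exp (\<beta> * real n)"
    using n by (simp add: \<beta>_def distrib_right exp_add)
  have growth: "(v \<bullet> e) * exp (\<beta> * real n) ^ k \<le> v \<bullet> y k" for k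
  proof (induction k)
    case (Suc k)
    have "(v \<bullet> e) * exp (\<beta> * real n) ^ Suc k \<le> exp (\<beta> * real n) * (v \<bullet> y k)"
      using mult_left_mono[OF Suc.IH, of "exp (\<beta> * real n)"] by (simp add: mult_ac)
    then show ?case using step[of k] unfolding q by linarith
  qed (simp add: y_def)
  \<comment> \<open>The ratio per period of the growth allowed by \<alpha> to the growth forced by
    \<beta>, which includes the doubling.\<close>
  define q' where "q' = exp ((\<alpha> - \<beta>) * real n)"
  have q': "0 < q'" "q' < 1" using \<alpha>(2) n by (auto simp: q'_def mult_neg_pos)
  have le: "v \<bullet> e \<le> norm v * C * q' ^ k" for k
  proof -
    have "(v \<bullet> e) * exp (\<beta> * real n) ^ k \<le> norm v * norm (y k)"
      using growth[of k] norm_cauchy_schwarz[of v "y k"] by linarith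
    also have "\<dots> \<le> norm v * (C * exp (\<alpha> * (real k * real n)))"
      unfolding y_def by (intro mult_left_mono C) auto
    also have "exp (\<alpha> * (real k * real n)) = (q' * exp (\<beta> * real n)) ^ k"
      by (simp add: q'_def exp_add[symmetric] exp_of_nat_mult[symmetric] algebra_simps)
    finally have "(v \<bullet> e) * exp (\<beta> * real n) ^ k \<le> (norm v * C * q' ^ k) * exp (\<beta> * real n) ^ k"
      by (simp add: power_mult_distrib mult_ac)
    then show ?thesis by (rule mult_right_le_imp_le) simp
  qed
  have "(\<lambda>k. norm v * C * q' ^ k) \<longlonglongrightarrow> norm v * C * 0"
    using q' by (intro tendsto_intros LIMSEQ_power_zero) auto
  then have "v \<bullet> e \<le> norm v * C * 0" using le by (intro LIMSEQ_le_const) auto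
  then show False using v_e_pos by simp
qed

section \<open>Finite-horizon values with the extremal antinorm as terminal functional\<close>

definition lower_value :: "real \<Rightarrow> real^'n \<Rightarrow> real" where
  "lower_value t x = (INF A\<in>controls. exp (- \<sigma> * t) * inf_antinorm (flow A t x))"

lemma superlinear_lower_value:
  assumes "0 \<le> t" shows "superlinear_on K (lower_value t)"
proof -
  have "superlinear_on K (\<lambda>x. INF A\<in>controls. exp (- \<sigma> * t) * inf_antinorm (flow A t x))"
    using assms controls_nonempty
    by (intro superlinear_on_INF superlinear_flow superlinear_inf_antinorm) auto
  then show ?thesis by (simp add: lower_value_def[abs_def])
qed

lemma lower_value_le:
  assumes "control_function \<A> A" "0 \<le> t" "x \<in> K"
  shows "lower_value t x \<le> exp (- \<sigma> * t) * inf_antinorm (flow A t x)"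
proof -
  have "bdd_below ((\<lambda>A. exp (- \<sigma> * t) * inf_antinorm (flow A t x)) ` controls)"
    using superlinear_onD(1)[OF superlinear_inf_antinorm flow_K] assms
    by (intro bdd_belowI2[where m = 0]) auto
  then show ?thesis unfolding lower_value_def by (rule cINF_lower) (use assms in auto)
qed

lemma lower_value_ge:
  assumes "\<And>A. control_function \<A> A \<Longrightarrow> a \<le> exp (- \<sigma> * t) * inf_antinorm (flow A t x)"
  shows "a \<le> lower_value t x"
  unfolding lower_value_def using controls_nonempty assms by (intro cINF_greatest) auto

lemma lower_value_0: "x \<in> K \<Longrightarrow> inf_antinorm x \<le> lower_value 0 x"
  by (rule lower_value_ge) simp

text \<open>One half of the dynamic programming principle: \<open>A\<close> followed by a control
  for the remaining time competes over the whole horizon.\<close>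

lemma lower_value_flow:
  assumes A: "control_function \<A> A" and t: "0 \<le> t" and s: "0 \<le> s" and x: "x \<in> K"
  shows "lower_value (t + s) x \<le> exp (- \<sigma> * t) * lower_value s (flow A t x)"
proof -
  have "exp (\<sigma> * t) * lower_value (t + s) x \<le> lower_value s (flow A t x)"
  proof (rule lower_value_ge)
    fix B assume B: "control_function \<A> B"
    have "lower_value (t + s) x \<le> exp (- \<sigma> * (t + s)) * inf_antinorm (flow B s (flow A t x))"
      using lower_value_le[OF control_function_concat[OF A B] _ x, of "t + s" t] t s
      by (simp add: flow_concat_control[OF A B t s])
    then have "exp (\<sigma> * t) * lower_value (t + s) x \<le> exp (\<sigma> * t) * (exp (- \<sigma> * (t + s)) * inf_antinorm (flow B s (flow A t x)))"
      by (intro mult_left_mono) auto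
    then show "exp (\<sigma> * t) * lower_value (t + s) x \<le> exp (- \<sigma> * s) * inf_antinorm (flow B s (flow A t x))"
      by (simp add: mult.assoc[symmetric] exp_add[symmetric] algebra_simps)
  qed
  then show ?thesis by (simp add: exp_minus field_simps)
qed

text \<open>This is where extremality of the terminal functional pays off: prolonging any control
  does not decrease the rescaled terminal value.\<close>

lemma lower_value_mono:
  assumes s: "0 \<le> s" "s \<le> t" and x: "x \<in> K"
  shows "lower_value s x \<le> lower_value t x"
proof (rule lower_value_ge)
  fix A assume A: "control_function \<A> A"
  define d where "d = t - s"
  have d: "0 \<le> d" "t = s + d" using s by (auto simp: d_def)
  have "lower_value s x \<le> exp (- \<sigma> * s) * inf_antinorm (flow A s x)" by (rule lower_value_le[OF A s(1) x])
  also have "\<dots> \<le> exp (- \<sigma> * s) * (exp (- \<sigma> * d) * inf_antinorm (flow (shift_control s A) d (flow A s x)))"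
    by (intro mult_left_mono inf_antinorm_flow control_function_shift flow_K A s d x) auto
  also have "\<dots> = exp (- \<sigma> * t) * inf_antinorm (flow A t x)"
    using flow_shift[OF bounded_control[OF A] s(1) d(1), of x] d(2)
    by (simp add: mult.assoc[symmetric] exp_add[symmetric] algebra_simps)
  finally show "lower_value s x \<le> exp (- \<sigma> * t) * inf_antinorm (flow A t x)" .
qed

text \<open>A slow control for \<open>e\<close> is slow for every \<open>x\<close>, because
  \<open>x\<close> is dominated by \<open>(norm x / r) *\<^sub>R e\<close>. Monotonicity allows the
  horizon to be enlarged to a positive integer.\<close>

lemma lower_value_le_norm:
  assumes t: "0 \<le> t" and x: "x \<in> K"
  shows "lower_value t x \<le> 2 / (\<rho> * r) * norm x"
proof -
  define n where "n = nat \<lceil>t\<rceil> + 1"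
  have n: "1 \<le> n" "t \<le> real n" by (auto simp: n_def) linarith
  obtain A where A: "control_function \<A> A" and slow: "v \<bullet> flow A (real n) e \<le> 2 / \<rho> * exp (\<sigma> * real n)"
    using exists_slow_control[OF n(1)] by blast
  have lin: "linear (flow A (real n))" by (rule linear_flow[OF bounded_control[OF A]]) simp
  have fK: "flow A (real n) x \<in> K" by (rule flow_K[OF A _ x]) simp
  have "lower_value t x \<le> lower_value (real n) x" by (rule lower_value_mono[OF t n(2) x])
  also have "\<dots> \<le> exp (- \<sigma> * real n) * inf_antinorm (flow A (real n) x)" by (rule lower_value_le[OF A _ x]) simp
  also have "inf_antinorm (flow A (real n) x) \<le> v \<bullet> flow A (real n) x"
    using inf_antinorm_le[OF A order_refl fK] by simp
  also have "v \<bullet> flow A (real n) x \<le> v \<bullet> flow A (real n) ((norm x / r) *\<^sub>R e)"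
    using r_pos ball_scale_K[of "- x" "norm x / r"] by (intro v_flow_mono[OF A]) auto
  also have "\<dots> = norm x / r * (v \<bullet> flow A (real n) e)" by (simp add: linear_cmul[OF lin])
  also have "\<dots> \<le> norm x / r * (2 / \<rho> * exp (\<sigma> * real n))" using r_pos by (intro mult_left_mono slow) auto
  finally show ?thesis by (simp add: exp_minus mult_ac)
qed

section \<open>The limit of the finite-horizon values\<close>

definition invariant_value :: "real^'n \<Rightarrow> real" where
  "invariant_value x = (SUP t\<in>{0..}. lower_value t x)"

lemma lower_value_le_invariant:
  assumes "0 \<le> t" "x \<in> K" shows "lower_value t x \<le> invariant_value x"
  unfolding invariant_value_def
  by (rule cSUP_upper) (use assms lower_value_le_norm in \<open>auto intro!: bdd_aboveI2\<close>)

text \<open>Horizons below 1 may be ignored by monotonicity; the continuity estimate for the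
  finite-horizon values starts at horizon 1.\<close>

lemma invariant_value_le:
  assumes "\<And>t. 1 \<le> t \<Longrightarrow> lower_value t x \<le> a" "x \<in> K"
  shows "invariant_value x \<le> a"
  unfolding invariant_value_def
proof (rule cSUP_least)
  show "lower_value t x \<le> a" if "t \<in> {0..}" for t
    using lower_value_mono[of t "max 1 t" x] assms(1)[of "max 1 t"] assms(2) that by auto
qed auto

text \<open>Suprema need not preserve superadditivity, but here the family increases, so two
  horizons can be replaced by their maximum.\<close>

lemma superlinear_invariant_value: "superlinear_on K invariant_value"
proof -
  note sl = superlinear_onD[OF superlinear_lower_value]
  have scale: "invariant_value (a *\<^sub>R x) \<le> a * invariant_value x" if "x \<in> K" "0 \<le> a" for a x
    using that lower_value_le_invariant[OF _ that(1)] scale_K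
    by (intro invariant_value_le) (auto simp: sl(2) mult_left_mono)
  have eq: "invariant_value (a *\<^sub>R x) = a * invariant_value x" if x: "x \<in> K" and a: "0 \<le> a" for a x
  proof (cases "a = 0")
    case True
    have "0 \<le> invariant_value 0"
      using lower_value_le_invariant[OF order_refl zero_K] sl(1)[OF order_refl zero_K] by linarith
    then show ?thesis using scale[OF x, of 0] True by simp
  next
    case False
    have "invariant_value ((1 / a) *\<^sub>R (a *\<^sub>R x)) \<le> 1 / a * invariant_value (a *\<^sub>R x)"
      using a by (intro scale scale_K x) auto
    with False a have "a * invariant_value x \<le> invariant_value (a *\<^sub>R x)" by (simp add: field_simps)
    with scale[OF x a] show ?thesis by simp
  qed
  have "invariant_value x + invariant_value y \<le> invariant_value (x + y)" if x: "x \<in> K" and y: "y \<in> K" for x y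
  proof -
    have *: "lower_value s x + lower_value t y \<le> invariant_value (x + y)" if "1 \<le> s" "1 \<le> t" for s t
    proof -
      have "lower_value s x + lower_value t y \<le> lower_value (max s t) x + lower_value (max s t) y"
        using that x y by (intro add_mono lower_value_mono) auto
      also have "\<dots> \<le> lower_value (max s t) (x + y)" using that x y by (intro sl(3)) auto
      also have "\<dots> \<le> invariant_value (x + y)" using that add_K[OF x y] by (intro lower_value_le_invariant) auto
      finally show ?thesis .
    qed
    have "invariant_value y \<le> invariant_value (x + y) - lower_value s x" if "1 \<le> s" for s
      by (rule invariant_value_le[OF _ y]) (use *[OF that] in \<open>simp add: algebra_simps\<close>)
    then have "invariant_value x \<le> invariant_value (x + y) - invariant_value y"
      by (intro invariant_value_le[OF _ x]) (simp add: algebra_simps)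
    then show ?thesis by simp
  qed
  moreover have "0 \<le> invariant_value x" if "x \<in> K" for x
    using lower_value_le_invariant[OF order_refl that] sl(1)[OF order_refl that] by linarith
  ultimately show ?thesis using eq by (auto simp: superlinear_on_def)
qed

lemma invariant_value_flow:
  assumes A: "control_function \<A> A" and t: "0 \<le> t" and x: "x \<in> K"
  shows "invariant_value x \<le> exp (- \<sigma> * t) * invariant_value (flow A t x)"
proof (rule invariant_value_le[OF _ x])
  fix s :: real assume s: "1 \<le> s"
  have "lower_value s x \<le> lower_value (t + s) x" using t s x by (intro lower_value_mono) auto
  also have "\<dots> \<le> exp (- \<sigma> * t) * lower_value s (flow A t x)" using s by (intro lower_value_flow[OF A t _ x]) auto
  also have "\<dots> \<le> exp (- \<sigma> * t) * invariant_value (flow A t x)"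
    using s t x by (intro mult_left_mono lower_value_le_invariant flow_K[OF A]) auto
  finally show "lower_value s x \<le> exp (- \<sigma> * t) * invariant_value (flow A t x)" .
qed

lemma invariant_value_pos: "x \<in> K \<Longrightarrow> x \<noteq> 0 \<Longrightarrow> 0 < invariant_value x"
  using inf_antinorm_pos[of x] lower_value_0[of x] lower_value_le_invariant[of 0 x] by linarith

text \<open>The point \<open>y\<close> need not dominate \<open>(1 - \<delta>) *\<^sub>R x\<close>,
  but after one unit of time it does: the displacement has become at most
  \<open>\<delta> * \<kappa> * (v \<bullet> x)\<close> times \<open>e\<close>, which lies below
  \<delta> times the state reached from \<open>x\<close>. The order then persists. No estimate
  depends on the horizon, so it passes to the supremum.\<close>

lemma lower_value_near:
  assumes \<delta>: "0 < \<delta>" "\<delta> < 1" and x: "x \<in> K" and y: "y \<in> K" and t: "1 \<le> t"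
    and near: "norm (y - x) \<le> r * \<kappa> / exp L * \<delta> * (v \<bullet> x)"
  shows "(1 - \<delta>) * lower_value t x \<le> lower_value t y"
proof (rule lower_value_ge)
  fix A assume A: "control_function \<A> A"
  define s where "s = t - 1"
  have s: "0 \<le> s" "t = 1 + s" using t by (auto simp: s_def)
  have t0: "0 \<le> t" using t by simp
  have sA: "control_function \<A> (shift_control 1 A)" by (rule control_function_shift[OF A]) simp
  have lin1: "linear (flow A 1)" and lint: "linear (flow A t)" using linear_flow[OF bounded_control[OF A]] t by auto
  have "norm (flow A 1 (y - x)) \<le> norm (y - x) * exp L"
    using flow_norm_le[OF bounded_control[OF A], of 1 "y - x"] by simp
  also have "\<dots> \<le> (r * \<kappa> / exp L * \<delta> * (v \<bullet> x)) * exp L" by (rule mult_right_mono[OF near]) simp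
  also have "\<dots> = r * (\<delta> * (\<kappa> * (v \<bullet> x)))" by simp
  finally have "(\<delta> * (\<kappa> * (v \<bullet> x))) *\<^sub>R e + flow A 1 (y - x) \<in> K"
    using \<delta> \<kappa>_pos v_nonneg[OF x] by (intro ball_scale_K) auto
  moreover have "\<delta> *\<^sub>R (flow A 1 x - (\<kappa> * (v \<bullet> x)) *\<^sub>R e) \<in> K" using \<delta> by (intro scale_K flow_1_ge[OF A x]) auto
  ultimately have "((\<delta> * (\<kappa> * (v \<bullet> x))) *\<^sub>R e + flow A 1 (y - x)) + \<delta> *\<^sub>R (flow A 1 x - (\<kappa> * (v \<bullet> x)) *\<^sub>R e) \<in> K"
    by (rule add_K)
  then have "flow A 1 (y - (1 - \<delta>) *\<^sub>R x) \<in> K"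
    by (simp add: linear_add[OF lin1] linear_diff[OF lin1] linear_cmul[OF lin1] algebra_simps)
  then have "flow (shift_control 1 A) s (flow A 1 (y - (1 - \<delta>) *\<^sub>R x)) \<in> K" by (rule flow_K[OF sA s(1)])
  then have "flow A t (y - (1 - \<delta>) *\<^sub>R x) \<in> K" using flow_1_add(1)[OF A s(1)] s(2) by simp
  then have "flow A t y - (1 - \<delta>) *\<^sub>R flow A t x \<in> K"
    by (simp add: linear_diff[OF lint] linear_cmul[OF lint])
  moreover have fx: "flow A t x \<in> K" by (rule flow_K[OF A t0 x])
  ultimately have "inf_antinorm ((1 - \<delta>) *\<^sub>R flow A t x) \<le> inf_antinorm (flow A t y)"
    using \<delta> by (intro superlinear_on_mono[OF superlinear_inf_antinorm] scale_K) auto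
  then have le: "(1 - \<delta>) * inf_antinorm (flow A t x) \<le> inf_antinorm (flow A t y)"
    using superlinear_onD(2)[OF superlinear_inf_antinorm fx, of "1 - \<delta>"] \<delta> by simp
  have "(1 - \<delta>) * lower_value t x \<le> (1 - \<delta>) * (exp (- \<sigma> * t) * inf_antinorm (flow A t x))"
    using \<delta> by (intro mult_left_mono lower_value_le[OF A t0 x]) auto
  also have "\<dots> = exp (- \<sigma> * t) * ((1 - \<delta>) * inf_antinorm (flow A t x))" by simp
  also have "\<dots> \<le> exp (- \<sigma> * t) * inf_antinorm (flow A t y)" by (intro mult_left_mono le) auto
  finally show "(1 - \<delta>) * lower_value t x \<le> exp (- \<sigma> * t) * inf_antinorm (flow A t y)" .
qed

lemma invariant_value_near:
  assumes \<delta>: "0 < \<delta>" "\<delta> < 1" and x: "x \<in> K" and y: "y \<in> K"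
    and near: "norm (y - x) \<le> r * \<kappa> / exp L * \<delta> * (v \<bullet> x)"
  shows "(1 - \<delta>) * invariant_value x \<le> invariant_value y"
proof -
  have "invariant_value x \<le> invariant_value y / (1 - \<delta>)"
  proof (rule invariant_value_le[OF _ x])
    fix t :: real assume t: "1 \<le> t"
    then have "(1 - \<delta>) * lower_value t x \<le> invariant_value y"
      using order_trans[OF lower_value_near[OF \<delta> x y t near] lower_value_le_invariant[OF _ y]] by simp
    then show "lower_value t x \<le> invariant_value y / (1 - \<delta>)" using \<delta> by (simp add: field_simps)
  qed
  then show ?thesis using \<delta> by (simp add: field_simps)
qed

text \<open>Controls nearly optimal for growing horizons have a limit trajectory. Extremality bounds
  its values from below and near optimality from above; both bounds pass to the limit by the
  continuity estimate.\<close>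

lemma exists_invariant_trajectory:
  assumes x0: "x0 \<in> K"
  shows "\<exists>x. generalized_trajectory \<A> x \<and> x 0 = x0 \<and> (\<forall>t\<ge>0. invariant_value (x t) = exp (\<sigma> * t) * invariant_value x0)"
proof (cases "x0 = 0")
  \<comment> \<open>The continuity estimate allows no displacement at the origin, which therefore
    gets the zero trajectory.\<close>
  case True
  obtain A where "control_function \<A> A" by (rule exists_control)
  then have A: "control_function (convex hull \<A>) A" by (auto simp: control_function_def intro: hull_inc)
  have "invariant_value 0 = 0" using superlinear_onD(2)[OF superlinear_invariant_value zero_K, of 0] by simp
  moreover have "solves_linear_ode A (\<lambda>_. 0)" by (simp add: solves_linear_ode_def)
  ultimately show ?thesis using A True unfolding generalized_trajectory_def trajectory_def
    by (intro exI[of _ "\<lambda>_. 0"]) auto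
next
  case False
  have "\<exists>A. control_function \<A> A \<and> exp (- \<sigma> * real n) * inf_antinorm (flow A (real n) x0) < lower_value (real n) x0 + inverse (real (Suc n))" for n
    using cInf_lessD[of "(\<lambda>A. exp (- \<sigma> * real n) * inf_antinorm (flow A (real n) x0)) ` controls"
        "lower_value (real n) x0 + inverse (real (Suc n))"] controls_nonempty
    unfolding lower_value_def by auto
  then obtain A where A: "\<And>n. control_function \<A> (A n)"
    and near_opt: "\<And>n. exp (- \<sigma> * real n) * inf_antinorm (flow (A n) (real n) x0) < lower_value (real n) x0 + inverse (real (Suc n))"
    by metis
  have "norm (flow (A n) 0 x0) \<le> norm x0" for n by simp
  from trajectories_subsequence[of \<A> A "\<lambda>n t. flow (A n) t x0" "norm x0",
      OF compact_A A flow_solves[OF bounded_control[OF A]] this]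
  obtain k B y where k: "strict_mono k" and B: "control_function (convex hull \<A>) B" and y: "solves_linear_ode B y"
    and lim: "\<And>t. 0 \<le> t \<Longrightarrow> (\<lambda>n. flow (A (k n)) t x0) \<longlonglongrightarrow> y t" by blast
  have y0: "y 0 = x0" using lim[of 0] by (simp add: LIMSEQ_const_iff)
  define X where "X n t = flow (A (k n)) t x0" for n t
  have XK: "X n t \<in> K" if "0 \<le> t" for n t unfolding X_def by (rule flow_K[OF A that x0])
  have Xlim: "(\<lambda>n. X n t) \<longlonglongrightarrow> y t" if "0 \<le> t" for t unfolding X_def by (rule lim[OF that])
  have yK: "y t \<in> K" if "0 \<le> t" for t by (rule closed_sequentially[OF closed_K XK[OF that] Xlim[OF that]])
  have vy: "0 < v \<bullet> y t" if "0 \<le> t" for t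
    using solves_norm_ge[OF hull.bounded_control[OF B] y that] y0 False by (intro v_pos yK that) auto
  have close: "\<forall>\<^sub>F n in sequentially. norm (y t - X n t) \<le> \<epsilon>" if "0 \<le> t" "0 < \<epsilon>" for t \<epsilon>
    using tendstoD[OF Xlim[OF that(1)] that(2)] by eventually_elim (simp add: dist_norm norm_minus_commute)
  have rk: "0 < r * \<kappa> / exp L" using r_pos \<kappa>_pos by simp
  \<comment> \<open>Extremality is known for ordinary trajectories only, so it is transferred from
    \<open>X n\<close> to the generalized trajectory \<open>y\<close> up to a factor
    \<open>z\<close> below 1.\<close>
  have lower: "exp (\<sigma> * t) * invariant_value x0 \<le> invariant_value (y t)" if t: "0 \<le> t" for t
  proof (rule field_le_mult_one_interval)
    fix z :: real assume z: "0 < z" "z < 1"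
    define \<delta> where "\<delta> = 1 - z"
    have \<delta>: "0 < \<delta>" "\<delta> < 1" "z = 1 - \<delta>" using z by (auto simp: \<delta>_def)
    have "(\<lambda>n. v \<bullet> X n t) \<longlonglongrightarrow> v \<bullet> y t" by (intro tendsto_intros Xlim t)
    then have "\<forall>\<^sub>F n in sequentially. v \<bullet> y t / 2 < v \<bullet> X n t"
      using vy[OF t] by (intro order_tendstoD(1)[where y = "v \<bullet> y t"]) auto
    moreover have "\<forall>\<^sub>F n in sequentially. norm (y t - X n t) \<le> r * \<kappa> / exp L * \<delta> * (v \<bullet> y t / 2)"
      using rk \<delta> vy[OF t] by (intro close[OF t] mult_pos_pos) auto
    ultimately have "\<forall>\<^sub>F n in sequentially. z * (exp (\<sigma> * t) * invariant_value x0) \<le> invariant_value (y t)"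
    proof eventually_elim
      case (elim n)
      have "r * \<kappa> / exp L * \<delta> * (v \<bullet> y t / 2) \<le> r * \<kappa> / exp L * \<delta> * (v \<bullet> X n t)"
        by (intro mult_left_mono mult_nonneg_nonneg less_imp_le[OF rk] less_imp_le[OF \<delta>(1)] less_imp_le[OF elim(1)])
      with elim(2) have "(1 - \<delta>) * invariant_value (X n t) \<le> invariant_value (y t)"
        by (intro invariant_value_near \<delta> XK[OF t] yK[OF t]) simp
      moreover have "exp (\<sigma> * t) * invariant_value x0 \<le> invariant_value (X n t)"
        using invariant_value_flow[OF A t x0, of "k n"] unfolding X_def by (simp add: exp_minus field_simps)
      then have "z * (exp (\<sigma> * t) * invariant_value x0) \<le> z * invariant_value (X n t)"
        using z by (intro mult_left_mono) auto
      ultimately show ?case by (simp add: \<delta>(3))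
    qed
    then show "z * (exp (\<sigma> * t) * invariant_value x0) \<le> invariant_value (y t)"
      using eventually_happens by force
  qed
  \<comment> \<open>From \<open>X n t\<close> on, the rest of a nearly optimal control competes for
    the remaining time \<open>d\<close>. As \<open>d\<close> finally exceeds any fixed
    \<open>s\<close>, monotonicity in the horizon applies.\<close>
  have upper: "invariant_value (y t) \<le> exp (\<sigma> * t) * invariant_value x0" if t: "0 \<le> t" for t
  proof (rule invariant_value_le[OF _ yK[OF t]])
    fix s :: real assume s: "1 \<le> s"
    show "lower_value s (y t) \<le> exp (\<sigma> * t) * invariant_value x0"
    proof (rule field_le_mult_one_interval)
      fix z :: real assume z: "0 < z" "z < 1"
      define \<delta> where "\<delta> = 1 - z"
      have \<delta>: "0 < \<delta>" "\<delta> < 1" "z = 1 - \<delta>" using z by (auto simp: \<delta>_def)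
      have "\<forall>\<^sub>F n in sequentially. norm (y t - X n t) \<le> r * \<kappa> / exp L * \<delta> * (v \<bullet> y t)"
        using rk \<delta> vy[OF t] by (intro close[OF t] mult_pos_pos) auto
      moreover have "\<forall>\<^sub>F n in sequentially. nat \<lceil>t + s\<rceil> \<le> n" by (rule eventually_ge_at_top)
      ultimately have "\<forall>\<^sub>F n in sequentially. z * lower_value s (y t) \<le> exp (\<sigma> * t) * (invariant_value x0 + inverse (real (Suc (k n))))"
      proof eventually_elim
        case (elim n)
        define d where "d = real (k n) - t"
        have "nat \<lceil>t + s\<rceil> \<le> k n" using elim(2) seq_suble[OF k, of n] by linarith
        then have "t + s \<le> real (k n)" by linarith
        then have d: "0 \<le> d" "s \<le> d" "real (k n) = t + d" using s by (auto simp: d_def)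
        have sA: "control_function \<A> (shift_control t (A (k n)))" by (rule control_function_shift[OF A t])
        have "z * lower_value s (y t) \<le> lower_value s (X n t)"
          unfolding \<delta>(3) using elim(1) s
          by (intro lower_value_near \<delta>(1,2) XK[OF t] yK[OF t]) (auto simp: norm_minus_commute)
        also have "\<dots> \<le> lower_value d (X n t)" using d s by (intro lower_value_mono XK t) auto
        also have "\<dots> \<le> exp (- \<sigma> * d) * inf_antinorm (flow (shift_control t (A (k n))) d (X n t))"
          by (rule lower_value_le[OF sA d(1) XK[OF t]])
        also have "flow (shift_control t (A (k n))) d (X n t) = flow (A (k n)) (real (k n)) x0"
          unfolding X_def d(3) by (rule flow_shift[OF bounded_control[OF A] t d(1), symmetric])
        also have "exp (- \<sigma> * d) * inf_antinorm (flow (A (k n)) (real (k n)) x0) =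
            exp (\<sigma> * t) * (exp (- \<sigma> * real (k n)) * inf_antinorm (flow (A (k n)) (real (k n)) x0))"
          unfolding d(3) by (simp add: mult.assoc[symmetric] exp_add[symmetric] algebra_simps)
        also have "\<dots> \<le> exp (\<sigma> * t) * (lower_value (real (k n)) x0 + inverse (real (Suc (k n))))"
          by (intro mult_left_mono less_imp_le[OF near_opt]) auto
        also have "\<dots> \<le> exp (\<sigma> * t) * (invariant_value x0 + inverse (real (Suc (k n))))"
          by (intro mult_left_mono add_right_mono lower_value_le_invariant x0) auto
        finally show ?case .
      qed
      moreover have "(\<lambda>n. exp (\<sigma> * t) * (invariant_value x0 + inverse (real (Suc (k n))))) \<longlonglongrightarrow> exp (\<sigma> * t) * (invariant_value x0 + 0)"
        using LIMSEQ_subseq_LIMSEQ[OF LIMSEQ_inverse_real_of_nat k] by (intro tendsto_intros) (auto simp: o_def)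
      ultimately have "z * lower_value s (y t) \<le> exp (\<sigma> * t) * (invariant_value x0 + 0)"
        by (intro tendsto_lowerbound[where F = sequentially]) auto
      then show "z * lower_value s (y t) \<le> exp (\<sigma> * t) * invariant_value x0" by simp
    qed
  qed
  show ?thesis
    unfolding generalized_trajectory_def trajectory_def
    using B y y0 lower upper by (intro exI[of _ y]) (auto intro!: antisym)
qed

lemma exists_positive_invariant_antinorm: "\<exists>f. positive_on K f \<and> invariant_antinorm K \<A> f"
proof -
  have "antinorm_on K invariant_value"
    using superlinear_imp_antinorm[OF superlinear_invariant_value e_K] invariant_value_pos[OF e_K e_nonzero] by simp
  then have "extremal_antinorm K \<A> invariant_value"
    by (rule extremal_antinormI) (rule invariant_value_flow)
  then have "invariant_antinorm K \<A> invariant_value"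
    unfolding invariant_antinorm_def using exists_invariant_trajectory by blast
  then show ?thesis using invariant_value_pos unfolding positive_on_def by blast
qed

end

theorem theorem5:
  fixes K :: "(real^'n) set" and \<A> :: "(real^'n^'n) set"
  assumes "solid_cone K"
    and "compact \<A>"
    and "\<forall>A\<in>\<A>. Metzler_on K A"
  shows "(\<exists>f. extremal_antinorm K \<A> f) \<and>
    (\<A> \<noteq> {} \<and> (\<forall>A\<in>\<A>. irreducible_on K A) \<longrightarrow>
      (\<exists>f. positive_on K f \<and> invariant_antinorm K \<A> f))"
proof -
  obtain v e c r where "proper_cone K v e c r" by (rule exists_proper_cone[OF assms(1)])
  then interpret proper_cone K v e c r .
  show ?thesis
  proof (cases "\<A> = {}")
    \<comment> \<open>Without operators there are no trajectories, so extremality is vacuous and any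
      antinorm will do.\<close>
    case True
    have "antinorm_on K (\<lambda>x. v \<bullet> x)"
      using superlinear_imp_antinorm[OF superlinear_on_inner e_K] v_e_pos by simp
    moreover have "\<not> trajectory {} x" for x :: "real \<Rightarrow> real^'n"
      by (auto simp: trajectory_def control_function_def)
    ultimately show ?thesis using True unfolding extremal_antinorm_def by blast
  next
    case False
    obtain L where L: "0 < L" "\<And>A x. A \<in> \<A> \<Longrightarrow> norm (A *v x) \<le> L * norm x"
      using exists_bounded_control[OF compact_imp_bounded[OF assms(2)]] by metis
    interpret Metzler_system K v e c r \<A> L
      by unfold_locales (use assms False L in auto)
    have "\<exists>f. positive_on K f \<and> invariant_antinorm K \<A> f" if "\<forall>A\<in>\<A>. irreducible_on K A"
    proof -
      interpret irreducible_Metzler_system K v e c r \<A> L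
        by unfold_locales (rule that)
      show ?thesis by (rule exists_positive_invariant_antinorm)
    qed
    then show ?thesis using exists_extremal_antinorm by blast
  qed
qed

end
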